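(* Consider the probabilistic PCA setting of the context, and let $\alpha\in(0,1)$. Suppose there exist $K_0\in\{1,\dots,d\}$ and $\mathbf{W}_0\in\mathbb{R}^{d\times K_0}$ with bounded coefficients (i.e. $|(\mathbf{W}_0)_{i,j}|\le C$ for some constant $C$) such that $X_1,\dots,X_n$ are i.i.d. with distribution $P^0=P_{\mathbf{W}_0}$. Then $$\mathbb{E}\Big[\int D_\alpha(P_{\mathbf{W}},P_{\mathbf{W}_0})\,\tilde\pi^{\hat K}_{n,\alpha}(d\mathbf{W}|X_1^n)\Big]=\mathcal{O}\Big(\frac{dK_0\log(dn)}{n}\Big).$$
   Context: Fix $\sigma^2>0$ (known) and $d\ge1$. For $\mathbf{W}\in\mathbb{R}^{d\times K}$, $P_{\mathbf{W}}=\mathcal{N}(0,\mathbf{W}\mathbf{W}^T+\sigma^2\mathbf{I}_d)$. Model $\mathcal{M}_K=\{P_{\mathbf{W}}:\mathbf{W}\in\mathbb{R}^{d\times K}\}$ for $K=1,\dots,d$, with prior weights $\pi_K=1/d$. Conditional prior $\Pi_K$: the columns $W_1,\dots,W_K$ of $\mathbf{W}$ are i.i.d. $\mathcal{N}(0,s^2\mathbf{I}_d)$ for a fixed $s>0$. Variational set $\mathcal{F}_K$: distributions on $\mathbb{R}^{d\times K}$ under which the columns are independent with $W_j\sim\mathcal{N}(\mu_j,\mathbf{\Sigma}_j)$, $\mu_j\in\mathbb{R}^d$, $\mathbf{\Sigma}_j$ positive definite. Log-likelihood $\ell_n(\mathbf{W})=\sum_{i=1}^n\log p_{\mathbf{W}}(X_i)$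 where $p_{\mathbf{W}}$ is the Gaussian density. Variational approximation $\tilde\pi^K_{n,\alpha}(\cdot|X_1^n)=\arg\max_{\rho\in\mathcal{F}_K}\{\alpha\int\ell_n d\rho-\mathrm{KL}(\rho,\Pi_K)\}$ (equivalently the KL-projection onto $\mathcal{F}_K$ of the tempered posterior $\propto e^{\alpha\ell_n}\Pi_K$); $\mathrm{ELBO}(K)$ is the value of this maximum and $\hat K=\arg\max_{K}\{\mathrm{ELBO}(K)-\log(1/\pi_K)\}$. The expectation is over $X_1,\dots,X_n$ i.i.d. $\sim P^0$. Rényi divergence: $D_\alpha(P,R)=\frac1{\alpha-1}\log\int(dP/dR)^{\alpha-1}dP$ if $P\ll R$, $+\infty$ otherwise. $\mathrm{KL}$ is the Kullback–Leibler divergence. *)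

theory Defs
  imports "HOL-Probability.Probability"
    "Jordan_Normal_Form.Determinant"
    "Jordan_Normal_Form.Gauss_Jordan_Elimination"
begin

text \<open>Vectors of R^d are functions nat => real (coordinates i < d), living in the
  product space lborel_d d.  A d x K matrix W is stored column-wise as a function
  nat => (nat => real): W j is the j-th column (j < K), W j i is the entry (i,j).
  Determinants and inverses are those of Jordan_Normal_Form.\<close>

definition lborel_d :: "nat \<Rightarrow> (nat \<Rightarrow> real) measure" where
  "lborel_d d = PiM {..<d} (\<lambda>_. lborel)"

definition to_mat :: "nat \<Rightarrow> (nat \<Rightarrow> nat \<Rightarrow> real) \<Rightarrow> real mat" where
  "to_mat d S = mat d d (\<lambda>(i, j). S i j)"

definition mat_inv :: "real mat \<Rightarrow> real mat" where
  "mat_inv A = the (mat_inverse A)"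

definition pos_def :: "nat \<Rightarrow> (nat \<Rightarrow> nat \<Rightarrow> real) \<Rightarrow> bool" where
  "pos_def d S \<longleftrightarrow> (\<forall>i<d. \<forall>j<d. S i j = S j i) \<and>
     (\<forall>x. (\<exists>i<d. x i \<noteq> 0) \<longrightarrow> (\<Sum>i<d. \<Sum>j<d. x i * S i j * x j) > 0)"

definition gauss_pdf :: "nat \<Rightarrow> (nat \<Rightarrow> real) \<Rightarrow> (nat \<Rightarrow> nat \<Rightarrow> real) \<Rightarrow> (nat \<Rightarrow> real) \<Rightarrow> real" where
  "gauss_pdf d mu S x =
     (let P = mat_inv (to_mat d S) in
      exp (- (\<Sum>i<d. \<Sum>j<d. (x i - mu i) * P $$ (i, j) * (x j - mu j)) / 2)
      / sqrt ((2 * pi) ^ d * det (to_mat d S)))"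

definition gauss_measure :: "nat \<Rightarrow> (nat \<Rightarrow> real) \<Rightarrow> (nat \<Rightarrow> nat \<Rightarrow> real) \<Rightarrow> (nat \<Rightarrow> real) measure" where
  "gauss_measure d mu S = density (lborel_d d) (\<lambda>x. ennreal (gauss_pdf d mu S x))"

definition ppca_cov :: "real \<Rightarrow> nat \<Rightarrow> nat \<Rightarrow> (nat \<Rightarrow> nat \<Rightarrow> real) \<Rightarrow> (nat \<Rightarrow> nat \<Rightarrow> real)" where
  "ppca_cov \<sigma>2 d K W = (\<lambda>i i'. (\<Sum>j<K. W j i * W j i') + (if i = i' then \<sigma>2 else 0))"

definition ppca_pdf :: "real \<Rightarrow> nat \<Rightarrow> nat \<Rightarrow> (nat \<Rightarrow> nat \<Rightarrow> real) \<Rightarrow> (nat \<Rightarrow> real) \<Rightarrow> real" where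
  "ppca_pdf \<sigma>2 d K W = gauss_pdf d (\<lambda>_. 0) (ppca_cov \<sigma>2 d K W)"

definition P_W :: "real \<Rightarrow> nat \<Rightarrow> nat \<Rightarrow> (nat \<Rightarrow> nat \<Rightarrow> real) \<Rightarrow> (nat \<Rightarrow> real) measure" where
  "P_W \<sigma>2 d K W = gauss_measure d (\<lambda>_. 0) (ppca_cov \<sigma>2 d K W)"

definition mat_space :: "nat \<Rightarrow> nat \<Rightarrow> (nat \<Rightarrow> nat \<Rightarrow> real) measure" where
  "mat_space d K = PiM {..<K} (\<lambda>_. lborel_d d)"

definition loglik :: "real \<Rightarrow> nat \<Rightarrow> nat \<Rightarrow> nat \<Rightarrow> (nat \<Rightarrow> nat \<Rightarrow> real) \<Rightarrow> (nat \<Rightarrow> nat \<Rightarrow> real) \<Rightarrow> real" where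
  "loglik \<sigma>2 d K n X W = (\<Sum>i<n. ln (ppca_pdf \<sigma>2 d K W (X i)))"

definition prior_K :: "real \<Rightarrow> nat \<Rightarrow> nat \<Rightarrow> (nat \<Rightarrow> nat \<Rightarrow> real) measure" where
  "prior_K s d K = PiM {..<K} (\<lambda>_. gauss_measure d (\<lambda>_. 0) (\<lambda>i i'. if i = i' then s\<^sup>2 else 0))"

definition var_family :: "nat \<Rightarrow> nat \<Rightarrow> (nat \<Rightarrow> nat \<Rightarrow> real) measure set" where
  "var_family d K = {PiM {..<K} (\<lambda>j. gauss_measure d (mu j) (S j)) | mu S.
       \<forall>j<K. pos_def d (S j)}"

text \<open>KL(rho, Pi) in nats: KL_divergence b M N is KL(N || M).\<close>
definition KL :: "'a measure \<Rightarrow> 'a measure \<Rightarrow> real" where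
  "KL P R = KL_divergence (exp 1) R P"

definition elbo_obj :: "real \<Rightarrow> real \<Rightarrow> real \<Rightarrow> nat \<Rightarrow> nat \<Rightarrow> nat \<Rightarrow> (nat \<Rightarrow> nat \<Rightarrow> real)
    \<Rightarrow> (nat \<Rightarrow> nat \<Rightarrow> real) measure \<Rightarrow> real" where
  "elbo_obj \<sigma>2 s \<alpha> d K n X \<rho> =
     \<alpha> * (\<integral>W. loglik \<sigma>2 d K n X W \<partial>\<rho>) - KL \<rho> (prior_K s d K)"

definition var_post :: "real \<Rightarrow> real \<Rightarrow> real \<Rightarrow> nat \<Rightarrow> nat \<Rightarrow> nat \<Rightarrow> (nat \<Rightarrow> nat \<Rightarrow> real)
    \<Rightarrow> (nat \<Rightarrow> nat \<Rightarrow> real) measure" where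
  "var_post \<sigma>2 s \<alpha> d K n X =
     (SOME \<rho>. \<rho> \<in> var_family d K \<and>
        (\<forall>\<rho>' \<in> var_family d K. elbo_obj \<sigma>2 s \<alpha> d K n X \<rho>' \<le> elbo_obj \<sigma>2 s \<alpha> d K n X \<rho>))"

definition ELBO :: "real \<Rightarrow> real \<Rightarrow> real \<Rightarrow> nat \<Rightarrow> nat \<Rightarrow> nat \<Rightarrow> (nat \<Rightarrow> nat \<Rightarrow> real) \<Rightarrow> real" where
  "ELBO \<sigma>2 s \<alpha> d K n X = elbo_obj \<sigma>2 s \<alpha> d K n X (var_post \<sigma>2 s \<alpha> d K n X)"

text \<open>Model selection with prior weights pi_K = 1/d, so log(1/pi_K) = log d.\<close>
definition K_hat :: "real \<Rightarrow> real \<Rightarrow> real \<Rightarrow> nat \<Rightarrow> nat \<Rightarrow> (nat \<Rightarrow> nat \<Rightarrow> real) \<Rightarrow> nat" where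
  "K_hat \<sigma>2 s \<alpha> d n X =
     (SOME K. K \<in> {1..d} \<and> (\<forall>K' \<in> {1..d}.
        ELBO \<sigma>2 s \<alpha> d K' n X - ln (1 / (1 / real d))
          \<le> ELBO \<sigma>2 s \<alpha> d K n X - ln (1 / (1 / real d))))"

definition renyi_div :: "real \<Rightarrow> 'a measure \<Rightarrow> 'a measure \<Rightarrow> ereal" where
  "renyi_div \<alpha> P R =
     (if absolutely_continuous R P
      then ereal (1 / (\<alpha> - 1) *
             ln (\<integral>x. (enn2real (RN_deriv R P x)) powr (\<alpha> - 1) \<partial>P))
      else \<infinity>)"

definition risk :: "real \<Rightarrow> real \<Rightarrow> real \<Rightarrow> nat \<Rightarrow> nat \<Rightarrow> (nat \<Rightarrow> nat \<Rightarrow> real) \<Rightarrow> nat \<Rightarrow> ennreal" where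
  "risk \<sigma>2 s \<alpha> d K0 W0 n =
     (\<integral>\<^sup>+ X. (\<integral>\<^sup>+ W. e2ennreal (renyi_div \<alpha> (P_W \<sigma>2 d (K_hat \<sigma>2 s \<alpha> d n X) W) (P_W \<sigma>2 d K0 W0))
                  \<partial>(var_post \<sigma>2 s \<alpha> d (K_hat \<sigma>2 s \<alpha> d n X) n X))
      \<partial>(PiM {..<n} (\<lambda>_. P_W \<sigma>2 d K0 W0)))"

end

theory Submission
  imports Defs
begin

text \<open>
  Let \<open>r W\<close> be the log-likelihood ratio of \<open>W0\<close> against \<open>W\<close>. Since \<open>E exp (-\<alpha> r W) = exp (-n (1-\<alpha>) D\<^sub>\<alpha>(W))\<close>,
  the variable \<open>exp (-\<alpha> r W + n (1-\<alpha>) D\<^sub>\<alpha>(W))\<close> integrated against the prior of each model has mean at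
  most one. The variational inequality for the Kullback-Leibler divergence turns this into
  \<open>n (1-\<alpha>) \<integral>D\<^sub>\<alpha> d\<rho> \<le> \<alpha> \<integral>r d\<rho> + KL(\<rho>, \<Pi>\<^sub>K) + ln d + ...\<close> simultaneously for all models \<open>K\<close> and all \<open>\<rho>\<close>,
  where the remainder has nonpositive mean. At the selected model and its variational posterior the
  right-hand side is minus the ELBO up to terms free of \<open>\<rho>\<close>, hence it is at most its value at \<open>K0\<close> and the
  Gaussian with mean \<open>W0\<close> and covariance \<open>\<epsilon>\<^sup>2 I\<close>, \<open>\<epsilon>\<^sup>2 = 1 / (n\<^sup>2 d K0)\<close>. There the divergence term costs
  \<open>O(d K0 ln (d n))\<close>, and \<open>r\<close> is controlled by the Loewner comparison of the covariances of \<open>W\<close> and \<open>W0\<close> up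
  to a factor \<open>1 + O(1/n)\<close>. That the ELBO is attained follows from continuity and coercivity in the mean
  and the Cholesky factor of the covariance.
\<close>

subsection \<open>Cholesky factorisation and quadratic forms\<close>

text \<open>\<open>K_hat\<close> and \<open>var_post\<close> are picked by \<open>SOME\<close>, so
  no measurability in the sample is at hand for either. Estimates are therefore made pointwise in
  \<open>X\<close>, with the random model absorbed into a sum over all \<open>d\<close> models, and
  only this measurable majorant is integrated; monotonicity of \<open>nn_integral\<close> holds for
  arbitrary functions. \<open>SOME\<close> also makes the existence of a maximiser a genuine
  obligation. Positive definite matrices form an open set, so compactness must come from the
  objective: in the divergence, \<open>- ln\<close> keeps the diagonal of the Cholesky factor away
  from 0 and the squares keep all entries bounded. The same factor turns every Gaussian into an
  affine image of one fixed standard Gaussian, so that normalising constants, moments, divergences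
  and dominated convergence in the parameters reduce to the standard normal law. The scale
  \<epsilon> makes the mean squared perturbation \<open>d * K0 * \<epsilon>\<^sup>2\<close> equal to
  \<open>1 / n\<^sup>2\<close>; splitting squares with weight \<open>1 / n\<close> then costs O(1/n)
  per observation, hence O(1) over the sample, times a second moment of order d K0.\<close>

definition lower_tri :: "nat \<Rightarrow> (nat \<Rightarrow> nat \<Rightarrow> real) \<Rightarrow> bool" where
  "lower_tri d A \<longleftrightarrow> (\<forall>i<d. A i i > 0) \<and> (\<forall>i<d. \<forall>k<d. i < k \<longrightarrow> A i k = 0)"

definition gram :: "nat \<Rightarrow> (nat \<Rightarrow> nat \<Rightarrow> real) \<Rightarrow> nat \<Rightarrow> nat \<Rightarrow> real" where
  "gram d A i i' = (\<Sum>k<d. A i k * A i' k)"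

text \<open>Completing the square in coordinate 0: the Schur complement of the pivot
  \<open>S 0 0\<close> is the form that remains after minimising over that coordinate. This is one
  elimination step of the Cholesky recursion.\<close>

lemma pos_def_schur:
  assumes S: "pos_def (Suc d) S"
  shows "S 0 0 > 0" "pos_def d (\<lambda>i j. S (Suc i) (Suc j) - S (Suc i) 0 * S (Suc j) 0 / S 0 0)"
proof -
  have sym: "S i j = S j i" if "i < Suc d" "j < Suc d" for i j
    using S that unfolding pos_def_def by blast
  have pos: "(\<Sum>i<Suc d. \<Sum>j<Suc d. x i * S i j * x j) > 0" if "\<exists>i<Suc d. x i \<noteq> 0" for x
    using S that unfolding pos_def_def by blast
  have "0 < (\<Sum>i<Suc d. \<Sum>j<Suc d. (if i = 0 then 1 else 0) * S i j * (if j = 0 then 1 else 0))"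
    by (rule pos) auto
  then show S00: "S 0 0 > 0"
    by (simp add: sum.lessThan_Suc_shift del: sum.lessThan_Suc)
  let ?T = "\<lambda>i j. S (Suc i) (Suc j) - S (Suc i) 0 * S (Suc j) 0 / S 0 0"
  show "pos_def d ?T"
    unfolding pos_def_def
  proof (intro conjI allI impI)
    fix i j assume "i < d" "j < d"
    then show "?T i j = ?T j i" using sym[of "Suc i" "Suc j"] by simp
  next
    fix x :: "nat \<Rightarrow> real" assume ex: "\<exists>i<d. x i \<noteq> 0"
    define b where "b = (\<Sum>i<d. x i * S (Suc i) 0)"
    \<comment> \<open>\<open>- b / S 0 0\<close> minimises the form over coordinate 0 with the
      others fixed to \<open>x\<close>; the pivot term and the two cross terms then combine to
      \<open>- b * b / S 0 0\<close>.\<close>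
    define y where "y = (\<lambda>i. case i of 0 \<Rightarrow> - b / S 0 0 | Suc k \<Rightarrow> x k)"
    have b1: "(\<Sum>j<d. S 0 (Suc j) * x j) = b"
      unfolding b_def by (intro sum.cong) (auto simp: sym[of 0])
    have "0 < (\<Sum>i<Suc d. \<Sum>j<Suc d. y i * S i j * y j)"
      by (rule pos) (use ex in \<open>force simp: y_def\<close>)
    also have "\<dots> = y 0 * S 0 0 * y 0 + y 0 * b + y 0 * b
        + (\<Sum>i<d. \<Sum>j<d. x i * S (Suc i) (Suc j) * x j)"
    proof -
      have e1: "(\<Sum>j<d. y 0 * S 0 (Suc j) * x j) = y 0 * b"
        unfolding b1[symmetric] by (simp add: sum_distrib_left mult.assoc)
      have e2: "(\<Sum>j<d. x j * S (Suc j) 0 * y 0) = y 0 * b"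
        unfolding b_def by (simp add: sum_distrib_left mult_ac)
      have ys: "y (Suc i) = x i" for i by (simp add: y_def)
      show ?thesis
        by (simp add: sum.lessThan_Suc_shift ys sum.distrib e1 e2 del: sum.lessThan_Suc)
    qed
    also have "\<dots> = (\<Sum>i<d. \<Sum>j<d. x i * S (Suc i) (Suc j) * x j) - b * b / S 0 0"
      using S00 by (simp add: y_def field_simps)
    also have "b * b / S 0 0 = (\<Sum>i<d. \<Sum>j<d. x i * (S (Suc i) 0 * S (Suc j) 0 / S 0 0) * x j)"
      unfolding b_def by (simp add: sum_product sum_divide_distrib mult_ac)
    finally show "0 < (\<Sum>i<d. \<Sum>j<d. x i * ?T i j * x j)"
      by (simp add: sum_subtractf[symmetric] algebra_simps)
  qed
qed

lemma cholesky:
  assumes "pos_def d S"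
  shows "\<exists>A. lower_tri d A \<and> (\<forall>i<d. \<forall>j<d. S i j = gram d A i j)"
  using assms
proof (induction d arbitrary: S)
  case 0
  then show ?case by (simp add: lower_tri_def)
next
  case (Suc d)
  note schur = pos_def_schur[OF Suc.prems]
  obtain A where A: "lower_tri d A"
    and eq: "\<And>i j. i < d \<Longrightarrow> j < d \<Longrightarrow>
      S (Suc i) (Suc j) - S (Suc i) 0 * S (Suc j) 0 / S 0 0 = gram d A i j"
    using Suc.IH[OF schur(2)] by blast
  have sym: "S i j = S j i" if "i < Suc d" "j < Suc d" for i j
    using Suc.prems that unfolding pos_def_def by blast
  \<comment> \<open>The first column is that of \<open>S\<close> divided by the root of the pivot,
    the rest of row 0 vanishes, and the block shifted by one is the factor of the Schur
    complement.\<close>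
  define B where "B = (\<lambda>i k. case k of 0 \<Rightarrow> S i 0 / sqrt (S 0 0)
     | Suc k' \<Rightarrow> (case i of 0 \<Rightarrow> 0 | Suc i' \<Rightarrow> A i' k'))"
  have B0: "B i 0 = S i 0 / sqrt (S 0 0)" and B1: "B 0 (Suc k) = 0"
    and B2: "B (Suc i) (Suc k) = A i k" for i k
    by (auto simp: B_def)
  have "lower_tri (Suc d) B"
    using A schur(1) unfolding lower_tri_def
    by (auto simp: B_def less_Suc_eq_0_disj split: nat.split)
  moreover have "S i j = gram (Suc d) B i j" if "i < Suc d" "j < Suc d" for i j
    using that eq[of "i - 1" "j - 1"] schur(1) sym[of 0 j]
    unfolding gram_def sum.lessThan_Suc_shift
    by (cases i; cases j) (auto simp: B0 B1 B2)
  ultimately show ?case by blast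
qed

text \<open>Forward substitution: in row \<open>i\<close> the entries right of the diagonal vanish
  and the earlier \<open>z k\<close> are already 0, which leaves
  \<open>A i i * z i = 0\<close>.\<close>

lemma lower_tri_inj:
  assumes A: "lower_tri d A" and eq: "\<And>i. i < d \<Longrightarrow> (\<Sum>k<d. A i k * z k) = 0"
  shows "i < d \<Longrightarrow> z i = 0"
proof (induction i rule: less_induct)
  case (less i)
  have "0 = (\<Sum>k<d. A i k * z k)" using eq less.prems by simp
  also have "\<dots> = (\<Sum>k<d. if k = i then A i i * z i else 0)"
  proof (intro sum.cong refl)
    fix k assume "k \<in> {..<d}"
    then show "A i k * z k = (if k = i then A i i * z i else 0)"
      using A less by (cases k i rule: linorder_cases) (auto simp: lower_tri_def)
  qed
  also have "\<dots> = A i i * z i" using less.prems by simp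
  finally show ?case using A less.prems by (auto simp: lower_tri_def)
qed

section \<open>Determinants, inverses and linear systems\<close>

lemma det_gram:
  assumes "lower_tri d A"
  shows "det (to_mat d (gram d A)) = (\<Prod>i<d. A i i)\<^sup>2"
proof -
  have c: "to_mat d A \<in> carrier_mat d d" by (simp add: to_mat_def)
  have "to_mat d (gram d A) = to_mat d A * transpose_mat (to_mat d A)"
    by (rule eq_matI) (auto simp: to_mat_def gram_def scalar_prod_def atLeast0LessThan)
  then have "det (to_mat d (gram d A)) = det (to_mat d A) * det (to_mat d A)"
    using c by (simp add: det_mult[of _ d] det_transpose[of _ d])
  also have "det (to_mat d A) = (\<Prod>i<d. A i i)"
  proof -
    have "det (to_mat d A) = prod_list (diag_mat (to_mat d A))"
      by (rule det_lower_triangular[OF _ c])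
        (use assms in \<open>auto simp: lower_tri_def to_mat_def\<close>)
    also have "\<dots> = (\<Prod>i<d. to_mat d A $$ (i, i))"
      using c by (simp add: prod_list_diag_prod atLeast0LessThan)
    finally show ?thesis by (simp add: to_mat_def)
  qed
  finally show ?thesis by (simp add: power2_eq_square)
qed

lemma to_mat_cong: "(\<And>i j. i < d \<Longrightarrow> j < d \<Longrightarrow> S i j = T i j) \<Longrightarrow> to_mat d S = to_mat d T"
  unfolding to_mat_def by (rule eq_matI) auto

lemma det_pos_def:
  assumes "pos_def d S" shows "det (to_mat d S) > 0"
proof -
  obtain A where A: "lower_tri d A" "\<And>i j. i < d \<Longrightarrow> j < d \<Longrightarrow> S i j = gram d A i j"
    using cholesky[OF assms] by blast
  have "det (to_mat d S) = (\<Prod>i<d. A i i)\<^sup>2"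
    using det_gram[OF A(1)] to_mat_cong[of d S "gram d A"] A(2) by simp
  moreover have "(\<Prod>i<d. A i i) > 0"
    using A(1) by (intro prod_pos) (auto simp: lower_tri_def)
  ultimately show ?thesis by (metis zero_less_power)
qed

lemma mat_inv_mult:
  assumes "det (to_mat d S) \<noteq> 0"
  shows "mat_inv (to_mat d S) \<in> carrier_mat d d"
    "to_mat d S * mat_inv (to_mat d S) = 1\<^sub>m d"
    "mat_inv (to_mat d S) * to_mat d S = 1\<^sub>m d"
proof -
  have c: "to_mat d S \<in> carrier_mat d d" by (simp add: to_mat_def)
  have "to_mat d S \<in> Units (ring_mat TYPE(real) d d)"
    by (rule det_non_zero_imp_unit[OF c assms])
  then obtain B where "mat_inverse (to_mat d S) = Some B"
    using mat_inverse(1)[OF c, of d] by (cases "mat_inverse (to_mat d S)") auto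
  with mat_inverse(2)[OF c this]
  show "mat_inv (to_mat d S) \<in> carrier_mat d d"
    "to_mat d S * mat_inv (to_mat d S) = 1\<^sub>m d"
    "mat_inv (to_mat d S) * to_mat d S = 1\<^sub>m d"
    by (auto simp: mat_inv_def)
qed

definition inv_form :: "nat \<Rightarrow> (nat \<Rightarrow> nat \<Rightarrow> real) \<Rightarrow> (nat \<Rightarrow> real) \<Rightarrow> real" where
  "inv_form d S x = (\<Sum>i<d. \<Sum>j<d. x i * mat_inv (to_mat d S) $$ (i, j) * x j)"

definition form :: "nat \<Rightarrow> (nat \<Rightarrow> nat \<Rightarrow> real) \<Rightarrow> (nat \<Rightarrow> real) \<Rightarrow> real" where
  "form d S x = (\<Sum>i<d. \<Sum>j<d. x i * S i j * x j)"

text \<open>Evaluations of inverse forms go through this lemma: it suffices to exhibit a solution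
  \<open>y\<close> of \<open>S y = x\<close>, and no entry of the inverse has to be known.\<close>

lemma inv_form_eq_solution:
  assumes "det (to_mat d S) \<noteq> 0" "\<And>i. i < d \<Longrightarrow> (\<Sum>j<d. S i j * y j) = x i"
  shows "inv_form d S x = (\<Sum>i<d. x i * y i)"
proof -
  let ?P = "mat_inv (to_mat d S)"
  note inv = mat_inv_mult[OF assms(1)]
  have one: "(\<Sum>j<d. ?P $$ (i, j) * S j k) = (if i = k then 1 else 0)" if "i < d" "k < d" for i k
  proof -
    have "(?P * to_mat d S) $$ (i, k) = (\<Sum>j<d. ?P $$ (i, j) * S j k)"
      using that inv(1) by (auto simp: to_mat_def scalar_prod_def atLeast0LessThan)
    then show ?thesis using that by (simp add: inv(3))
  qed
  have "(\<Sum>j<d. ?P $$ (i, j) * x j) = y i" if "i < d" for i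
  proof -
    have "(\<Sum>j<d. ?P $$ (i, j) * x j) = (\<Sum>j<d. \<Sum>k<d. ?P $$ (i, j) * S j k * y k)"
      by (intro sum.cong) (auto simp: assms(2)[symmetric] sum_distrib_left mult.assoc)
    also have "\<dots> = (\<Sum>k<d. (\<Sum>j<d. ?P $$ (i, j) * S j k) * y k)"
      by (subst sum.swap) (simp add: sum_distrib_right)
    also have "\<dots> = (\<Sum>k<d. if i = k then y k else 0)"
      by (intro sum.cong) (auto simp: one that)
    finally show ?thesis using that by simp
  qed
  then have "(\<Sum>i<d. x i * (\<Sum>j<d. ?P $$ (i, j) * x j)) = (\<Sum>i<d. x i * y i)"
    by (intro sum.cong) auto
  then show ?thesis
    unfolding inv_form_def by (simp add: sum_distrib_left mult.assoc)
qed

lemma solution_exists: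
  assumes "det (to_mat d S) \<noteq> 0"
  obtains y where "\<And>i. i < d \<Longrightarrow> (\<Sum>j<d. S i j * y j) = x i"
proof -
  let ?P = "mat_inv (to_mat d S)"
  note inv = mat_inv_mult[OF assms]
  have one: "(\<Sum>j<d. S i j * ?P $$ (j, k)) = (if i = k then 1 else 0)" if "i < d" "k < d" for i k
  proof -
    have "(to_mat d S * ?P) $$ (i, k) = (\<Sum>j<d. S i j * ?P $$ (j, k))"
      using that inv(1) by (auto simp: to_mat_def scalar_prod_def atLeast0LessThan)
    then show ?thesis using that by (simp add: inv(2))
  qed
  show ?thesis
  proof (rule that)
    fix i assume i: "i < d"
    have "(\<Sum>j<d. S i j * (\<Sum>k<d. ?P $$ (j, k) * x k)) = (\<Sum>j<d. \<Sum>k<d. S i j * ?P $$ (j, k) * x k)"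
      by (simp add: sum_distrib_left mult.assoc)
    also have "\<dots> = (\<Sum>k<d. (\<Sum>j<d. S i j * ?P $$ (j, k)) * x k)"
      by (subst sum.swap) (simp add: sum_distrib_right)
    also have "\<dots> = (\<Sum>k<d. if i = k then x k else 0)"
      by (intro sum.cong) (auto simp: one i)
    finally show "(\<Sum>j<d. S i j * (\<Sum>k<d. ?P $$ (j, k) * x k)) = x i" using i by simp
  qed
qed

text \<open>If \<open>y\<close> solves \<open>A A^T y = u\<close> and \<open>u = A z\<close>, then
  \<open>w = A^T y\<close> satisfies \<open>A w = A z\<close>, so \<open>w = z\<close> by
  injectivity, and \<open>u . y = z . A^T y = z . z\<close>.\<close>

lemma inv_form_gram:
  assumes A: "lower_tri d A" and u: "\<And>i. i < d \<Longrightarrow> u i = (\<Sum>k<d. A i k * z k)"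
  shows "inv_form d (gram d A) u = (\<Sum>k<d. (z k)\<^sup>2)"
proof -
  have det: "det (to_mat d (gram d A)) \<noteq> 0"
    using A by (auto simp: det_gram lower_tri_def)
  obtain y where y: "\<And>i. i < d \<Longrightarrow> (\<Sum>j<d. gram d A i j * y j) = u i"
    using solution_exists[OF det] by blast
  define w where "w k = (\<Sum>j<d. A j k * y j)" for k
  have "(\<Sum>k<d. A i k * (w k - z k)) = 0" if "i < d" for i
  proof -
    have "(\<Sum>k<d. A i k * w k) = (\<Sum>k<d. \<Sum>j<d. A i k * A j k * y j)"
      by (simp add: w_def sum_distrib_left mult.assoc)
    also have "\<dots> = (\<Sum>j<d. gram d A i j * y j)"
      by (subst sum.swap) (simp add: gram_def sum_distrib_right)
    finally show ?thesis
      using y[OF that] u[OF that] by (simp add: algebra_simps sum_subtractf)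
  qed
  from lower_tri_inj[OF A this] have w: "w k = z k" if "k < d" for k
    using that by force
  have "inv_form d (gram d A) u = (\<Sum>i<d. u i * y i)"
    by (rule inv_form_eq_solution[OF det y])
  also have "\<dots> = (\<Sum>i<d. \<Sum>k<d. z k * (A i k * y i))"
    by (intro sum.cong) (auto simp: u sum_distrib_left mult_ac)
  also have "\<dots> = (\<Sum>k<d. z k * w k)"
    by (subst sum.swap) (simp add: w_def sum_distrib_left)
  also have "\<dots> = (\<Sum>k<d. (z k)\<^sup>2)"
    by (intro sum.cong) (auto simp: w power2_eq_square)
  finally show ?thesis .
qed

section \<open>Loewner comparison of inverse forms\<close>

lemma form_minus_smult:
  assumes "\<And>i j. i < d \<Longrightarrow> j < d \<Longrightarrow> S i j = S j i"
    and "\<And>i. i < d \<Longrightarrow> (\<Sum>j<d. S i j * u j) = x i"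
  shows "form d S (\<lambda>i. u i - t * y i)
    = (\<Sum>i<d. x i * u i) - 2 * t * (\<Sum>i<d. x i * y i) + t\<^sup>2 * form d S y"
proof -
  have "form d S (\<lambda>i. u i - t * y i) =
      (\<Sum>i<d. \<Sum>j<d. u i * (S i j * u j)) - t * (\<Sum>i<d. \<Sum>j<d. y i * (S i j * u j))
      - t * (\<Sum>i<d. \<Sum>j<d. u i * S i j * y j) + t\<^sup>2 * form d S y"
    by (simp add: form_def sum_distrib_left sum.distrib[symmetric] sum_subtractf[symmetric]
        algebra_simps power2_eq_square)
  also have "(\<Sum>i<d. \<Sum>j<d. u i * (S i j * u j)) = (\<Sum>i<d. x i * u i)"
    by (intro sum.cong refl) (simp add: sum_distrib_left[symmetric] assms(2); simp add: mult.commute)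
  also have "(\<Sum>i<d. \<Sum>j<d. y i * (S i j * u j)) = (\<Sum>i<d. x i * y i)"
    by (intro sum.cong refl) (simp add: sum_distrib_left[symmetric] assms(2); simp add: mult.commute)
  also have "(\<Sum>i<d. \<Sum>j<d. u i * S i j * y j) = (\<Sum>j<d. \<Sum>i<d. y j * (S j i * u i))"
    by (subst sum.swap, intro sum.cong refl) (simp add: assms(1) mult_ac)
  also have "\<dots> = (\<Sum>i<d. x i * y i)"
    by (intro sum.cong refl) (simp add: sum_distrib_left[symmetric] assms(2); simp add: mult.commute)
  finally show ?thesis by simp
qed

lemma pos_def_form_nonneg: "pos_def d S \<Longrightarrow> form d S x \<ge> 0"
proof (cases "\<exists>i<d. x i \<noteq> 0")
  case False
  then show ?thesis by (simp add: form_def)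
next
  assume "pos_def d S" and "\<exists>i<d. x i \<noteq> 0"
  then show ?thesis unfolding pos_def_def form_def by (blast intro: less_imp_le)
qed

text \<open>Inversion reverses the Loewner order: evaluate the form of \<open>S\<close> at \<open>S\<inverse>x - T\<inverse>x / c\<close>.\<close>
lemma inv_form_antimono:
  assumes S: "pos_def d S" and T: "pos_def d T" and c: "c > 0"
    and le: "\<And>y. form d S y \<le> c * form d T y"
  shows "inv_form d T x \<le> c * inv_form d S x"
proof -
  have dS: "det (to_mat d S) \<noteq> 0" and dT: "det (to_mat d T) \<noteq> 0"
    using det_pos_def[OF S] det_pos_def[OF T] by auto
  obtain u where u: "\<And>i. i < d \<Longrightarrow> (\<Sum>j<d. S i j * u j) = x i" using solution_exists[OF dS] by blast
  obtain y where y: "\<And>i. i < d \<Longrightarrow> (\<Sum>j<d. T i j * y j) = x i" using solution_exists[OF dT] by blast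
  define q where "q = (\<Sum>i<d. x i * y i)"
  have "form d T y = (\<Sum>i<d. y i * (\<Sum>j<d. T i j * y j))"
    by (simp add: form_def sum_distrib_left mult.assoc)
  also have "\<dots> = q" unfolding q_def by (intro sum.cong refl) (simp add: y; simp add: mult.commute)
  finally have Ty: "form d T y = q" .
  \<comment> \<open>The weight \<open>t = 1 / c\<close> minimises
    \<open>- 2 * t * q + t\<^sup>2 * (c * q)\<close>, which bounds the part of the expansion that
    depends on \<open>t\<close>.\<close>
  have "0 \<le> form d S (\<lambda>i. u i - 1 / c * y i)" by (rule pos_def_form_nonneg[OF S])
  also have "\<dots> = (\<Sum>i<d. x i * u i) - 2 * (1 / c) * q + (1 / c)\<^sup>2 * form d S y"
    unfolding q_def
    by (rule form_minus_smult[OF _ u]) (use S in \<open>auto simp: pos_def_def\<close>)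
  also have "\<dots> \<le> (\<Sum>i<d. x i * u i) - 2 * (1 / c) * q + (1 / c)\<^sup>2 * (c * q)"
    using le[of y] by (auto intro!: mult_left_mono simp: Ty divide_right_mono)
  also have "\<dots> = (\<Sum>i<d. x i * u i) - q / c"
    using c by (simp add: field_simps power2_eq_square)
  finally show ?thesis
    using c inv_form_eq_solution[OF dS u] inv_form_eq_solution[OF dT y]
    by (simp add: q_def field_simps)
qed

lemma scaled_identity:
  assumes "c > 0" shows "inv_form d (\<lambda>i j. if i = j then c else 0) x = (\<Sum>i<d. (x i)\<^sup>2) / c"
    and "pos_def d (\<lambda>i j. if i = j then c else 0)"
    and "det (to_mat d (\<lambda>i j. if i = j then c else 0)) = c ^ d"
    and "form d (\<lambda>i j. if i = j then c else 0) x = c * (\<Sum>i<d. (x i)\<^sup>2)"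
proof -
  have f: "form d (\<lambda>i j. if i = j then c else 0) x = c * (\<Sum>i<d. (x i)\<^sup>2)" for x
    by (simp add: form_def sum_distrib_left power2_eq_square if_distrib if_distribR mult_ac
        cong: if_cong)
  then show "form d (\<lambda>i j. if i = j then c else 0) x = c * (\<Sum>i<d. (x i)\<^sup>2)" .
  show pd: "pos_def d (\<lambda>i j. if i = j then c else 0)"
    unfolding pos_def_def
  proof (intro conjI allI impI)
    fix x :: "nat \<Rightarrow> real" assume "\<exists>i<d. x i \<noteq> 0"
    then have "(\<Sum>i<d. (x i)\<^sup>2) > 0" by (auto intro: sum_pos2)
    then show "0 < (\<Sum>i<d. \<Sum>j<d. x i * (if i = j then c else 0) * x j)"
      using f[of x] assms by (simp add: form_def)
  qed auto
  have "to_mat d (\<lambda>i j. if i = j then c else 0) = c \<cdot>\<^sub>m 1\<^sub>m d"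
    by (rule eq_matI) (auto simp: to_mat_def)
  then show "det (to_mat d (\<lambda>i j. if i = j then c else 0)) = c ^ d" by simp
  have "inv_form d (\<lambda>i j. if i = j then c else 0) x = (\<Sum>i<d. x i * (x i / c))"
    by (rule inv_form_eq_solution)
      (use det_pos_def[OF pd] assms in \<open>auto simp: if_distrib if_distribR cong: if_cong\<close>)
  then show "inv_form d (\<lambda>i j. if i = j then c else 0) x = (\<Sum>i<d. (x i)\<^sup>2) / c"
    by (simp add: sum_divide_distrib power2_eq_square)
qed

lemma inv_form_nonneg: "pos_def d S \<Longrightarrow> inv_form d S x \<ge> 0"
proof -
  assume S: "pos_def d S"
  then have dS: "det (to_mat d S) \<noteq> 0" using det_pos_def by force
  obtain u where u: "\<And>i. i < d \<Longrightarrow> (\<Sum>j<d. S i j * u j) = x i" using solution_exists[OF dS] by blast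
  have "inv_form d S x = (\<Sum>i<d. x i * u i)" by (rule inv_form_eq_solution[OF dS u])
  also have "\<dots> = form d S u"
    unfolding form_def by (intro sum.cong refl) (simp add: u[symmetric] sum_distrib_left mult_ac)
  finally show ?thesis using pos_def_form_nonneg[OF S] by simp
qed

subsection \<open>Gaussian measures as images of the standard Gaussian\<close>

lemma PiM_density:
  fixes f :: "'i \<Rightarrow> 'a \<Rightarrow> ennreal"
  assumes I: "finite I" and M: "\<And>i. sigma_finite_measure (M i)"
    and D: "\<And>i. sigma_finite_measure (density (M i) (f i))"
    and f[measurable]: "\<And>i. f i \<in> borel_measurable (M i)"
  shows "PiM I (\<lambda>i. density (M i) (f i)) = density (PiM I M) (\<lambda>x. \<Prod>i\<in>I. f i (x i))"
proof -
  interpret D: product_sigma_finite "\<lambda>i. density (M i) (f i)" by (simp add: product_sigma_finite_def D)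
  interpret M: product_sigma_finite M by (simp add: product_sigma_finite_def M)
  show ?thesis
  proof (rule D.PiM_eqI[symmetric, OF I])
    show "sets (density (PiM I M) (\<lambda>x. \<Prod>i\<in>I. f i (x i))) = sets (PiM I (\<lambda>i. density (M i) (f i)))"
      by (simp cong: sets_PiM_cong)
    fix A assume "\<And>i. i \<in> I \<Longrightarrow> A i \<in> sets (density (M i) (f i))"
    then have A: "\<And>i. i \<in> I \<Longrightarrow> A i \<in> sets (M i)" by simp
    have PA: "Pi\<^sub>E I A \<in> sets (PiM I M)" using A I by (intro sets_PiM_I_finite) auto
    have "emeasure (density (PiM I M) (\<lambda>x. \<Prod>i\<in>I. f i (x i))) (Pi\<^sub>E I A)
        = (\<integral>\<^sup>+x. (\<Prod>i\<in>I. f i (x i)) * indicator (Pi\<^sub>E I A) x \<partial>PiM I M)"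
      using PA by (subst emeasure_density) auto
    also have "\<dots> = (\<integral>\<^sup>+x. (\<Prod>i\<in>I. f i (x i) * indicator (A i) (x i)) \<partial>PiM I M)"
    proof (intro nn_integral_cong)
      fix x assume "x \<in> space (PiM I M)"
      then have "indicator (Pi\<^sub>E I A) x = (\<Prod>i\<in>I. indicator (A i) (x i) :: ennreal)"
        using I by (auto simp: indicator_def space_PiM PiE_iff prod_zero_iff)
      then show "(\<Prod>i\<in>I. f i (x i)) * indicator (Pi\<^sub>E I A) x = (\<Prod>i\<in>I. f i (x i) * indicator (A i) (x i))"
        by (simp add: prod.distrib)
    qed
    also have "\<dots> = (\<Prod>i\<in>I. \<integral>\<^sup>+x. f i x * indicator (A i) x \<partial>M i)"
      using A by (intro M.product_nn_integral_prod I) auto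
    also have "\<dots> = (\<Prod>i\<in>I. emeasure (density (M i) (f i)) (A i))"
      using A by (intro prod.cong refl) (simp add: emeasure_density)
    finally show "emeasure (density (PiM I M) (\<lambda>x. \<Prod>i\<in>I. f i (x i))) (Pi\<^sub>E I A)
        = (\<Prod>i\<in>I. emeasure (density (M i) (f i)) (A i))" .
  qed
qed

lemma PiM_distr:
  assumes I: "finite I" and M: "\<And>i. prob_space (M i)"
    and f[measurable]: "\<And>i. f i \<in> measurable (M i) (N i)"
  shows "PiM I (\<lambda>i. distr (M i) (N i) (f i)) = distr (PiM I M) (PiM I N) (\<lambda>x. \<lambda>i\<in>I. f i (x i))"
proof -
  have p: "prob_space (distr (M i) (N i) (f i))" for i
    by (rule prob_space.prob_space_distr[OF M f])
  interpret D: product_prob_space "\<lambda>i. distr (M i) (N i) (f i)"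
    by (intro product_prob_spaceI p)
  interpret M: product_prob_space M by (intro product_prob_spaceI M)
  show ?thesis
  proof (rule D.PiM_eqI[symmetric, OF I])
    show "sets (distr (PiM I M) (PiM I N) (\<lambda>x. \<lambda>i\<in>I. f i (x i))) = sets (PiM I (\<lambda>i. distr (M i) (N i) (f i)))"
      by (simp cong: sets_PiM_cong)
    fix A assume "\<And>i. i \<in> I \<Longrightarrow> A i \<in> sets (distr (M i) (N i) (f i))"
    then have A[measurable]: "\<And>i. i \<in> I \<Longrightarrow> A i \<in> sets (N i)" by simp
    have PA: "Pi\<^sub>E I A \<in> sets (PiM I N)" using A I by (intro sets_PiM_I_finite) auto
    have "emeasure (distr (PiM I M) (PiM I N) (\<lambda>x. \<lambda>i\<in>I. f i (x i))) (Pi\<^sub>E I A)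
       = emeasure (PiM I M) ((\<lambda>x. \<lambda>i\<in>I. f i (x i)) -` Pi\<^sub>E I A \<inter> space (PiM I M))"
      using PA by (subst emeasure_distr) (auto intro!: measurable_restrict)
    also have "(\<lambda>x. \<lambda>i\<in>I. f i (x i)) -` Pi\<^sub>E I A \<inter> space (PiM I M)
        = Pi\<^sub>E I (\<lambda>i. f i -` A i \<inter> space (M i))"
      by (auto simp: space_PiM PiE_iff)
    also have "emeasure (PiM I M) \<dots> = (\<Prod>i\<in>I. emeasure (M i) (f i -` A i \<inter> space (M i)))"
      by (intro M.emeasure_PiM I) auto
    also have "\<dots> = (\<Prod>i\<in>I. emeasure (distr (M i) (N i) (f i)) (A i))"
      using A by (intro prod.cong refl) (simp add: emeasure_distr)
    finally show "emeasure (distr (PiM I M) (PiM I N) (\<lambda>x. \<lambda>i\<in>I. f i (x i))) (Pi\<^sub>E I A)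
        = (\<Prod>i\<in>I. emeasure (distr (M i) (N i) (f i)) (A i))" .
  qed
qed

lemma measurable_lborel_d_component[measurable]:
  "i < d \<Longrightarrow> (\<lambda>x. x i) \<in> borel_measurable (lborel_d d)"
  unfolding lborel_d_def using measurable_component_singleton[of i "{..<d}" "\<lambda>_. lborel :: real measure"] by simp

lemma sigma_finite_lborel_d: "sigma_finite_measure (lborel_d d)"
proof -
  interpret product_sigma_finite "\<lambda>_. lborel" by standard
  show ?thesis unfolding lborel_d_def by (rule sigma_finite) simp
qed

text \<open>The restriction keeps the values in the space of \<open>lborel_d d\<close>, whose points
  are \<open>undefined\<close> outside \<open>{..<d}\<close>.\<close>

definition aff_map :: "nat \<Rightarrow> (nat \<Rightarrow> real) \<Rightarrow> (nat \<Rightarrow> nat \<Rightarrow> real) \<Rightarrow> (nat \<Rightarrow> real) \<Rightarrow> nat \<Rightarrow> real" where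
  "aff_map d mu A z = (\<lambda>i\<in>{..<d}. mu i + (\<Sum>k<d. A i k * z k))"

lemma aff_map_apply: "i < d \<Longrightarrow> aff_map d mu A z i = mu i + (\<Sum>k<d. A i k * z k)"
  by (simp add: aff_map_def)

lemma measurable_aff_map[measurable]: "aff_map d mu A \<in> measurable (lborel_d d) (lborel_d d)"
  unfolding aff_map_def[abs_def] lborel_d_def
  by (rule measurable_restrict) (simp, unfold lborel_d_def[symmetric], measurable)

text \<open>Change of variables by induction on the dimension. By triangularity the last coordinate
  is affine in its own variable, with slope \<open>A d d\<close> and a shift that depends on the
  earlier ones only; so one-dimensional substitution and Fubini suffice, and the slopes multiply to
  the Jacobian.\<close>

lemma nn_integral_affine_lower_tri:
  assumes "lower_tri d A" and "g \<in> borel_measurable (lborel_d d)"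
  shows "(\<integral>\<^sup>+x. g x \<partial>lborel_d d) = ennreal (\<Prod>i<d. A i i) * (\<integral>\<^sup>+z. g (aff_map d mu A z) \<partial>lborel_d d)"
  using assms
proof (induction d arbitrary: g)
  case 0
  have "(\<integral>\<^sup>+x. g x \<partial>lborel_d 0) = (\<integral>\<^sup>+z. g (aff_map 0 mu A z) \<partial>lborel_d 0)"
    by (intro nn_integral_cong arg_cong[of _ _ g]) (auto simp: lborel_d_def space_PiM aff_map_def fun_eq_iff)
  then show ?case by simp
next
  case (Suc d)
  interpret product_sigma_finite "\<lambda>_::nat. lborel :: real measure" by standard
  interpret L: sigma_finite_measure "lborel_d d" by (rule sigma_finite_lborel_d)
  have A: "lower_tri d A" "A d d > 0" and Ad: "\<And>i. i < d \<Longrightarrow> A i d = 0"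
    using Suc.prems(1) by (auto simp: lower_tri_def)
  have Pp: "(\<Prod>i<d. A i i) > 0" using A(1) by (intro prod_pos) (auto simp: lower_tri_def)
  have ins: "{..<Suc d} = insert d {..<d}" by auto
  have upd[measurable]: "(\<lambda>(x, y). x(d := y)) \<in> measurable (lborel_d d \<Otimes>\<^sub>M borel) (lborel_d (Suc d))"
  proof -
    have "(\<lambda>(x, y). x(d := y)) \<in> measurable (PiM {..<d} (\<lambda>_. lborel) \<Otimes>\<^sub>M lborel) (PiM (insert d {..<d}) (\<lambda>_. lborel :: real measure))"
      by (rule measurable_add_dim)
    then show ?thesis unfolding lborel_d_def ins
      by (simp cong: measurable_cong_sets sets_pair_measure_cong)
  qed
  have split: "(\<integral>\<^sup>+x. h x \<partial>lborel_d (Suc d)) = (\<integral>\<^sup>+x. (\<integral>\<^sup>+y. h (x(d := y)) \<partial>lborel) \<partial>lborel_d d)"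
    if "h \<in> borel_measurable (lborel_d (Suc d))" for h
    using that unfolding lborel_d_def ins by (subst product_nn_integral_insert) auto
  note g[measurable] = Suc.prems(2)
  have gy: "(\<lambda>y. g (x(d := y))) \<in> borel_measurable borel" if "x \<in> space (lborel_d d)" for x
    using that by measurable
  \<comment> \<open>Column \<open>d\<close> vanishes above the diagonal, so the new variable
    \<open>y\<close> enters the last coordinate only.\<close>
  have aff: "aff_map (Suc d) mu A (z(d := y)) =
      (aff_map d mu A z)(d := (mu d + (\<Sum>k<d. A d k * z k)) + A d d * y)" for z y
  proof
    fix i
    have "(\<Sum>k<d. A i k * (if k = d then y else z k)) = (\<Sum>k<d. A i k * z k)"
      by (intro sum.cong) auto
    then show "aff_map (Suc d) mu A (z(d := y)) i =
      ((aff_map d mu A z)(d := (mu d + (\<Sum>k<d. A d k * z k)) + A d d * y)) i"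
      by (auto simp: aff_map_def Ad less_Suc_eq)
  qed
  have "(\<integral>\<^sup>+x. g x \<partial>lborel_d (Suc d)) = (\<integral>\<^sup>+x. (\<integral>\<^sup>+y. g (x(d := y)) \<partial>lborel) \<partial>lborel_d d)"
    by (rule split[OF g])
  also have "\<dots> = ennreal (\<Prod>i<d. A i i) *
      (\<integral>\<^sup>+z. (\<integral>\<^sup>+y. g ((aff_map d mu A z)(d := y)) \<partial>lborel) \<partial>lborel_d d)"
    by (rule Suc.IH[OF A(1)]) measurable
  also have "(\<integral>\<^sup>+z. (\<integral>\<^sup>+y. g ((aff_map d mu A z)(d := y)) \<partial>lborel) \<partial>lborel_d d)
    = (\<integral>\<^sup>+z. ennreal (A d d) * (\<integral>\<^sup>+y. g (aff_map (Suc d) mu A (z(d := y))) \<partial>lborel) \<partial>lborel_d d)"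
  proof (intro nn_integral_cong)
    fix z assume "z \<in> space (lborel_d d)"
    then have "aff_map d mu A z \<in> space (lborel_d d)" by (rule measurable_space[OF measurable_aff_map])
    from gy[OF this] show "(\<integral>\<^sup>+y. g ((aff_map d mu A z)(d := y)) \<partial>lborel)
      = ennreal (A d d) * (\<integral>\<^sup>+y. g (aff_map (Suc d) mu A (z(d := y))) \<partial>lborel)"
      using A(2) unfolding aff
      by (subst nn_integral_real_affine[where c = "A d d" and t = "mu d + (\<Sum>k<d. A d k * z k)"]) auto
  qed
  also have "\<dots> = ennreal (A d d) * (\<integral>\<^sup>+z. (\<integral>\<^sup>+y. g (aff_map (Suc d) mu A (z(d := y))) \<partial>lborel) \<partial>lborel_d d)"
    by (rule nn_integral_cmult) measurable
  also have "(\<integral>\<^sup>+z. (\<integral>\<^sup>+y. g (aff_map (Suc d) mu A (z(d := y))) \<partial>lborel) \<partial>lborel_d d)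
     = (\<integral>\<^sup>+z. g (aff_map (Suc d) mu A z) \<partial>lborel_d (Suc d))"
    by (rule split[symmetric]) measurable
  also have "ennreal (\<Prod>i<d. A i i) * (ennreal (A d d) * (\<integral>\<^sup>+z. g (aff_map (Suc d) mu A z) \<partial>lborel_d (Suc d)))
    = ennreal (\<Prod>i<Suc d. A i i) * (\<integral>\<^sup>+z. g (aff_map (Suc d) mu A z) \<partial>lborel_d (Suc d))"
    using Pp A(2) by (simp add: ennreal_mult mult.assoc)
  finally show ?case .
qed

lemma gauss_pdf_eq:
  "gauss_pdf d mu S x = exp (- inv_form d S (\<lambda>i. x i - mu i) / 2) / sqrt ((2 * pi) ^ d * det (to_mat d S))"
  by (simp add: gauss_pdf_def inv_form_def Let_def)

lemma measurable_gauss_pdf[measurable]: "gauss_pdf d mu S \<in> borel_measurable (lborel_d d)"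
  unfolding gauss_pdf_eq[abs_def] inv_form_def by measurable

lemma gauss_pdf_pos: "pos_def d S \<Longrightarrow> gauss_pdf d mu S x > 0"
  unfolding gauss_pdf_eq using det_pos_def[of d S] by simp

definition std_gauss :: "nat \<Rightarrow> (nat \<Rightarrow> real) measure" where
  "std_gauss d = PiM {..<d} (\<lambda>_. density lborel (\<lambda>x. ennreal (std_normal_density x)))"

lemma std_normal_prob: "prob_space (density lborel (\<lambda>x. ennreal (std_normal_density x)))"
  by (rule prob_space_normal_density) simp

lemma prob_space_std_gauss: "prob_space (std_gauss d)"
  unfolding std_gauss_def by (intro prob_space_PiM std_normal_prob)

lemma std_gauss_density:
  "std_gauss d = density (lborel_d d) (\<lambda>z. ennreal (\<Prod>i<d. std_normal_density (z i)))"
  unfolding std_gauss_def lborel_d_def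
  by (subst PiM_density)
    (auto simp: prod_ennreal intro!: prob_space_imp_sigma_finite std_normal_prob lborel.sigma_finite_measure_axioms)

lemma sets_std_gauss[measurable_cong, simp]: "sets (std_gauss d) = sets (lborel_d d)"
  by (simp add: std_gauss_density)

text \<open>At the image of \<open>z\<close> the inverse form of the centred point is the squared
  norm of \<open>z\<close>, and the root of the determinant is the Jacobian, which cancels.\<close>

lemma gauss_pdf_affine:
  assumes A: "lower_tri d A"
  shows "(\<Prod>i<d. A i i) * gauss_pdf d mu (gram d A) (aff_map d mu A z) = (\<Prod>i<d. std_normal_density (z i))"
proof -
  have P: "(\<Prod>i<d. A i i) > 0" using A by (intro prod_pos) (auto simp: lower_tri_def)
  have "inv_form d (gram d A) (\<lambda>i. aff_map d mu A z i - mu i) = (\<Sum>k<d. (z k)\<^sup>2)"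
    by (rule inv_form_gram[OF A]) (simp add: aff_map_apply)
  then have "gauss_pdf d mu (gram d A) (aff_map d mu A z)
    = exp (- (\<Sum>k<d. (z k)\<^sup>2) / 2) / (sqrt ((2 * pi) ^ d) * (\<Prod>i<d. A i i))"
    unfolding gauss_pdf_eq det_gram[OF A] real_sqrt_mult using P by simp
  moreover have "(\<Prod>i<d. std_normal_density (z i)) = exp (- (\<Sum>k<d. (z k)\<^sup>2) / 2) / sqrt ((2 * pi) ^ d)"
    unfolding std_normal_density_def
    by (simp add: prod_dividef exp_sum[symmetric] sum_negf sum_divide_distrib real_sqrt_power[symmetric] power_mult_distrib)
  moreover have "(\<Prod>i<d. A i i) \<noteq> 0" using P by linarith
  ultimately show ?thesis by (simp del: prod_zero_iff)
qed

lemma gauss_measure_eq_distr: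
  assumes A: "lower_tri d A"
  shows "gauss_measure d mu (gram d A) = distr (std_gauss d) (lborel_d d) (aff_map d mu A)"
proof (rule measure_eqI)
  have P: "(\<Prod>i<d. A i i) > 0" using A by (intro prod_pos) (auto simp: lower_tri_def)
  fix B assume "B \<in> sets (gauss_measure d mu (gram d A))"
  then have B[measurable]: "B \<in> sets (lborel_d d)" by (simp add: gauss_measure_def)
  have "emeasure (gauss_measure d mu (gram d A)) B
      = (\<integral>\<^sup>+x. ennreal (gauss_pdf d mu (gram d A) x) * indicator B x \<partial>lborel_d d)"
    unfolding gauss_measure_def by (subst emeasure_density) auto
  also have "\<dots> = ennreal (\<Prod>i<d. A i i) *
     (\<integral>\<^sup>+z. ennreal (gauss_pdf d mu (gram d A) (aff_map d mu A z)) * indicator B (aff_map d mu A z) \<partial>lborel_d d)"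
    by (rule nn_integral_affine_lower_tri[OF A]) measurable
  also have "\<dots> = (\<integral>\<^sup>+z. ennreal (\<Prod>i<d. A i i) *
     (ennreal (gauss_pdf d mu (gram d A) (aff_map d mu A z)) * indicator B (aff_map d mu A z)) \<partial>lborel_d d)"
    by (rule nn_integral_cmult[symmetric]) measurable
  also have "\<dots> = (\<integral>\<^sup>+z. ennreal (\<Prod>i<d. std_normal_density (z i)) * indicator B (aff_map d mu A z) \<partial>lborel_d d)"
    using P by (simp add: gauss_pdf_affine[OF A, of mu, symmetric] ennreal_mult' mult.assoc)
  also have "\<dots> = emeasure (distr (std_gauss d) (lborel_d d) (aff_map d mu A)) B"
    by (subst nn_integral_indicator[symmetric], simp, subst nn_integral_distr)
      (auto simp: std_gauss_density nn_integral_density)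
  finally show "emeasure (gauss_measure d mu (gram d A)) B
    = emeasure (distr (std_gauss d) (lborel_d d) (aff_map d mu A)) B" .
qed (simp add: gauss_measure_def)

lemma gauss_measure_cong:
  assumes "\<And>i j. i < d \<Longrightarrow> j < d \<Longrightarrow> S i j = T i j"
  shows "gauss_measure d mu S = gauss_measure d mu T"
  unfolding gauss_measure_def gauss_pdf_def using to_mat_cong[OF assms] by simp

text \<open>Total mass one is inherited from the product of standard normal laws through a Cholesky
  factor, so no multivariate Gaussian integral is computed.\<close>

lemma prob_space_gauss_measure:
  assumes "pos_def d S" shows "prob_space (gauss_measure d mu S)"
proof -
  obtain A where A: "lower_tri d A" "\<And>i j. i < d \<Longrightarrow> j < d \<Longrightarrow> S i j = gram d A i j"
    using cholesky[OF assms] by blast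
  show ?thesis
    unfolding gauss_measure_cong[of d S "gram d A" mu, OF A(2), simplified] gauss_measure_eq_distr[OF A(1)]
    by (intro prob_space.prob_space_distr prob_space_std_gauss) measurable
qed

lemma pos_def_gram:
  assumes A: "lower_tri d A" shows "pos_def d (gram d A)"
  unfolding pos_def_def
proof (intro conjI allI impI)
  fix x :: "nat \<Rightarrow> real" assume ex: "\<exists>i<d. x i \<noteq> 0"
  have eq: "(\<Sum>i<d. \<Sum>j<d. x i * gram d A i j * x j) = (\<Sum>k<d. (\<Sum>i<d. A i k * x i)\<^sup>2)"
  proof -
    have "(\<Sum>k<d. (\<Sum>i<d. A i k * x i)\<^sup>2) = (\<Sum>k<d. \<Sum>i<d. \<Sum>j<d. x i * (A i k * A j k) * x j)"
      by (simp add: power2_eq_square sum_product mult_ac)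
    also have "\<dots> = (\<Sum>i<d. \<Sum>k<d. \<Sum>j<d. x i * (A i k * A j k) * x j)"
      by (rule sum.swap)
    also have "\<dots> = (\<Sum>i<d. \<Sum>j<d. \<Sum>k<d. x i * (A i k * A j k) * x j)"
      by (intro sum.cong refl sum.swap)
    finally show ?thesis by (simp add: gram_def sum_distrib_left sum_distrib_right)
  qed
  \<comment> \<open>For the last nonzero coordinate \<open>i0\<close>, column \<open>i0\<close> of
    \<open>A\<close> vanishes above the diagonal and \<open>x\<close> vanishes below it. The square
    belonging to \<open>k = i0\<close> thus has the single term
    \<open>A i0 i0 * x i0\<close>.\<close>
  obtain i0 where i0: "i0 < d" "x i0 \<noteq> 0" "\<And>i. i < d \<Longrightarrow> i0 < i \<Longrightarrow> x i = 0"
  proof -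
    define m where "m = Max {i. i < d \<and> x i \<noteq> 0}"
    have "m \<in> {i. i < d \<and> x i \<noteq> 0}" unfolding m_def using ex by (intro Max_in) auto
    moreover have "x i = 0" if "i < d" "m < i" for i
    proof (rule ccontr)
      assume "x i \<noteq> 0"
      then have "i \<le> m" unfolding m_def using that by (intro Max_ge) auto
      then show False using that by simp
    qed
    ultimately show ?thesis using that by blast
  qed
  have "(\<Sum>i<d. A i i0 * x i) = (\<Sum>i<d. if i = i0 then A i0 i0 * x i0 else 0)"
  proof (intro sum.cong refl)
    fix i assume "i \<in> {..<d}"
    then show "A i i0 * x i = (if i = i0 then A i0 i0 * x i0 else 0)"
      using A i0 by (cases i i0 rule: linorder_cases) (auto simp: lower_tri_def)
  qed
  also have "\<dots> = A i0 i0 * x i0" using i0 by simp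
  finally have "(\<Sum>i<d. A i i0 * x i) = A i0 i0 * x i0" .
  then have "(\<Sum>i<d. A i i0 * x i)\<^sup>2 > 0" using A i0 by (auto simp: lower_tri_def)
  then show "0 < (\<Sum>i<d. \<Sum>j<d. x i * gram d A i j * x j)"
    unfolding eq using i0(1) by (intro sum_pos2[of _ i0]) auto
qed (simp add: gram_def mult.commute)

section \<open>First and second moments\<close>

lemma std_normal_moments:
  "has_bochner_integral (density lborel (\<lambda>x. ennreal (std_normal_density x))) (\<lambda>x. x) 0"
  "has_bochner_integral (density lborel (\<lambda>x. ennreal (std_normal_density x))) (\<lambda>x. x\<^sup>2) 1"
  using std_normal_moment_odd[of 0] std_normal_moment_even[of 1]
  by (auto intro!: has_bochner_integral_density simp: fact_numeral)

lemma std_gauss_component_moment: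
  assumes "k < d" "l < d"
  shows "has_bochner_integral (std_gauss d) (\<lambda>z. z k * z l) (if k = l then 1 else 0)"
    "has_bochner_integral (std_gauss d) (\<lambda>z. z k) 0"
proof -
  let ?N = "density lborel (\<lambda>x. ennreal (std_normal_density x))"
  interpret N: prob_space ?N by (rule std_normal_prob)
  interpret product_sigma_finite "\<lambda>_::nat. ?N" by standard
  have one: "integrable ?N (\<lambda>x. x)" "integral\<^sup>L ?N (\<lambda>x. x) = 0"
    and two: "integrable ?N (\<lambda>x. x\<^sup>2)" "integral\<^sup>L ?N (\<lambda>x. x\<^sup>2) = 1"
    using std_normal_moments by (auto simp: has_bochner_integral_iff)
  \<comment> \<open>Each moment is written as the integral of a product of one-coordinate functions,
    with factor 1 on the coordinates that do not occur; independence then gives the product of the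
    integrals, and one centred factor makes it 0.\<close>
  have *: "has_bochner_integral (std_gauss d) (\<lambda>z. \<Prod>i<d. f i (z i)) (\<Prod>i<d. integral\<^sup>L ?N (f i))"
    if "\<And>i. i < d \<Longrightarrow> integrable ?N (f i)" for f :: "nat \<Rightarrow> real \<Rightarrow> real"
    using that unfolding has_bochner_integral_iff std_gauss_def
    by (auto intro!: product_integrable_prod product_integral_prod)
  have eq1: "(\<Prod>i<d. (if i = k then h (z i) else (1::real))) = h (z k)" for h :: "real \<Rightarrow> real" and z :: "nat \<Rightarrow> real"
    using assms by (subst prod.delta) auto
  have pz: "(\<Prod>i<d. integral\<^sup>L ?N (f i)) = 0" if "integral\<^sup>L ?N (f k) = 0" for f :: "nat \<Rightarrow> real \<Rightarrow> real"
    using assms that by (intro prod_zero) auto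
  have a: "has_bochner_integral (std_gauss d) (\<lambda>z. \<Prod>i<d. (if i = k then z i else 1))
     (\<Prod>i<d. integral\<^sup>L ?N (\<lambda>x. if i = k then x else 1))"
    by (rule *, rename_tac i, case_tac "i = k") (auto simp: one)
  then show "has_bochner_integral (std_gauss d) (\<lambda>z. z k) 0"
    by (subst (asm) pz) (simp_all add: one eq1[of "\<lambda>x. x"])
  show "has_bochner_integral (std_gauss d) (\<lambda>z. z k * z l) (if k = l then 1 else 0)"
  proof (cases "k = l")
    case True
    have "has_bochner_integral (std_gauss d) (\<lambda>z. \<Prod>i<d. (if i = k then (z i)\<^sup>2 else 1))
      (\<Prod>i<d. integral\<^sup>L ?N (\<lambda>x. if i = k then x\<^sup>2 else 1))"
      by (rule *, rename_tac i, case_tac "i = k") (auto simp: two)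
    moreover have "(\<Prod>i<d. integral\<^sup>L ?N (\<lambda>x. if i = k then x\<^sup>2 else 1)) = 1"
      by (intro prod.neutral ballI, rename_tac i, case_tac "i = k") (use N.prob_space in \<open>auto simp: two\<close>)
    ultimately show ?thesis using True assms by (simp add: power2_eq_square)
  next
    case False
    have "has_bochner_integral (std_gauss d) (\<lambda>z. \<Prod>i<d. (if i = k \<or> i = l then z i else 1))
      (\<Prod>i<d. integral\<^sup>L ?N (\<lambda>x. if i = k \<or> i = l then x else 1))"
      by (rule *, rename_tac i, case_tac "i = k \<or> i = l") (auto simp: one)
    moreover have "(\<Prod>i<d. (if i = k \<or> i = l then z i else 1)) = z k * z l" for z :: "nat \<Rightarrow> real"
    proof -
      have "(\<Prod>i<d. (if i = k \<or> i = l then z i else 1)) = (\<Prod>i<d. (if i = k then z i else 1) * (if i = l then z i else 1))"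
        using False by (intro prod.cong) auto
      also have "\<dots> = z k * z l" using assms by (simp add: prod.distrib)
      finally show ?thesis .
    qed
    ultimately show ?thesis using False by (simp add: pz one)
  qed
qed

lemma std_gauss_affine_square:
  "has_bochner_integral (std_gauss d) (\<lambda>z. (a + (\<Sum>k<d. b k * z k))\<^sup>2) (a\<^sup>2 + (\<Sum>k<d. (b k)\<^sup>2))"
proof -
  interpret prob_space "std_gauss d" by (rule prob_space_std_gauss)
  have c: "has_bochner_integral (std_gauss d) (\<lambda>z. a\<^sup>2) (a\<^sup>2)"
    by (simp add: has_bochner_integral_iff prob_space)
  have "has_bochner_integral (std_gauss d) (\<lambda>z. a\<^sup>2 + (2 * a) * (\<Sum>k<d. b k * z k) + (\<Sum>k<d. \<Sum>l<d. (b k * b l) * (z k * z l)))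
     (a\<^sup>2 + (2 * a) * (\<Sum>k<d. b k * 0) + (\<Sum>k<d. \<Sum>l<d. (b k * b l) * (if k = l then 1 else 0)))"
    by (intro has_bochner_integral_add c has_bochner_integral_sum has_bochner_integral_mult_right
        std_gauss_component_moment) auto
  moreover have "a\<^sup>2 + (2 * a) * (\<Sum>k<d. b k * z k) + (\<Sum>k<d. \<Sum>l<d. (b k * b l) * (z k * z l))
     = (a + (\<Sum>k<d. b k * z k))\<^sup>2" for z
    by (simp add: power2_sum) (simp add: power2_eq_square sum_product mult_ac)
  moreover have "(\<Sum>k<d. \<Sum>l<d. (b k * b l) * (if k = l then 1 else 0)) = (\<Sum>k<d. (b k)\<^sup>2)"
    by (simp add: if_distrib power2_eq_square cong: if_cong)
  ultimately show ?thesis by simp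
qed

text \<open>The Gaussian normalisation read backwards: it represents the determinant by an integral
  that sees \<open>S\<close> only through its inverse form, so an order between inverse forms
  carries over to determinants.\<close>

lemma nn_integral_inv_form:
  assumes "pos_def d S"
  shows "(\<integral>\<^sup>+x. ennreal (exp (- inv_form d S x / 2)) \<partial>lborel_d d) = ennreal (sqrt ((2 * pi) ^ d * det (to_mat d S)))"
proof -
  let ?c = "sqrt ((2 * pi) ^ d * det (to_mat d S))"
  interpret prob_space "gauss_measure d (\<lambda>_. 0) S" by (rule prob_space_gauss_measure[OF assms])
  have c: "?c > 0" using det_pos_def[OF assms] by simp
  have [measurable]: "(\<lambda>x. inv_form d S x) \<in> borel_measurable (lborel_d d)"
    unfolding inv_form_def by measurable
  have "(\<integral>\<^sup>+x. ennreal (exp (- inv_form d S x / 2)) \<partial>lborel_d d)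
     = (\<integral>\<^sup>+x. ennreal ?c * ennreal (gauss_pdf d (\<lambda>_. 0) S x) \<partial>lborel_d d)"
    using c by (intro nn_integral_cong, subst ennreal_mult[symmetric])
      (auto simp: gauss_pdf_eq simp del: real_sqrt_mult)
  also have "\<dots> = ennreal ?c * (\<integral>\<^sup>+x. ennreal (gauss_pdf d (\<lambda>_. 0) S x) \<partial>lborel_d d)"
    by (rule nn_integral_cmult) measurable
  also have "(\<integral>\<^sup>+x. ennreal (gauss_pdf d (\<lambda>_. 0) S x) \<partial>lborel_d d) = emeasure (gauss_measure d (\<lambda>_. 0) S) (space (gauss_measure d (\<lambda>_. 0) S))"
    unfolding gauss_measure_def
    by (subst emeasure_density) (auto intro!: nn_integral_cong simp: indicator_def)
  finally show ?thesis by (simp add: emeasure_space_1)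
qed

text \<open>Compare the normalising constants of the two Gaussian densities.\<close>
lemma det_mono:
  assumes S: "pos_def d S" and T: "pos_def d T" and le: "\<And>y. form d S y \<le> form d T y"
  shows "det (to_mat d S) \<le> det (to_mat d T)"
proof -
  have "ennreal (sqrt ((2 * pi) ^ d * det (to_mat d S))) \<le> ennreal (sqrt ((2 * pi) ^ d * det (to_mat d T)))"
    unfolding nn_integral_inv_form[OF S, symmetric] nn_integral_inv_form[OF T, symmetric]
    using inv_form_antimono[OF S T, of 1] le by (intro nn_integral_mono ennreal_leI) simp
  then have "sqrt ((2 * pi) ^ d * det (to_mat d S)) \<le> sqrt ((2 * pi) ^ d * det (to_mat d T))"
    using det_pos_def[OF T] by (subst (asm) ennreal_le_iff) auto
  then show ?thesis by (simp add: real_sqrt_le_iff)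
qed

subsection \<open>The PPCA density\<close>

lemma det_to_mat:
  "det (to_mat d S) = (\<Sum>p | p permutes {0..<d}. signof p * (\<Prod>i = 0..<d. S i (p i)))"
proof -
  have "det (to_mat d S) = (\<Sum>p | p permutes {0..<d}. signof p * (\<Prod>i = 0..<d. to_mat d S $$ (i, p i)))"
    by (rule det_def') (simp add: to_mat_def)
  also have "\<dots> = (\<Sum>p | p permutes {0..<d}. signof p * (\<Prod>i = 0..<d. S i (p i)))"
  proof (intro sum.cong refl arg_cong2[of _ _ _ _ "(*)"] prod.cong)
    fix p i assume "p \<in> {p. p permutes {0..<d}}" "i \<in> {0..<d}"
    then have "i < d" "p i < d" using permutes_in_image[of p "{0..<d}" i] by auto
    then show "to_mat d S $$ (i, p i) = S i (p i)" by (simp add: to_mat_def)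
  qed
  finally show ?thesis .
qed

text \<open>Cramer's rule. \<open>mat_inv\<close> comes from Gauss-Jordan elimination, whose case
  distinctions show neither continuity nor measurability; a quotient of two polynomials in the
  entries shows both. The shifted indices delete row \<open>j\<close> and column
  \<open>i\<close>.\<close>

lemma mat_inv_entry:
  assumes det: "det (to_mat d S) \<noteq> 0" and ij: "i < d" "j < d"
  shows "mat_inv (to_mat d S) $$ (i, j) = (- 1) ^ (j + i) *
     det (to_mat (d - 1) (\<lambda>a b. S (if a < j then a else Suc a) (if b < i then b else Suc b)))
     / det (to_mat d S)"
proof -
  let ?A = "to_mat d S"
  have c: "?A \<in> carrier_mat d d" by (simp add: to_mat_def)
  note inv = mat_inv_mult[OF det]
  note adj = adj_mat[OF c]
  have "mat_inv ?A * (?A * adj_mat ?A) = adj_mat ?A"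
    using inv c adj(1) by (simp add: assoc_mult_mat[symmetric, of _ d d _ d _ d])
  then have "adj_mat ?A = det ?A \<cdot>\<^sub>m mat_inv ?A"
    using inv(1) by (simp add: adj(2) mult_smult_distrib[of _ d d _ d])
  then have "adj_mat ?A $$ (i, j) = det ?A * mat_inv ?A $$ (i, j)"
    using ij inv(1) by simp
  moreover have "adj_mat ?A $$ (i, j) = cofactor ?A j i"
    using ij c by (simp add: adj_mat_def)
  moreover have "mat_delete ?A j i
      = to_mat (d - 1) (\<lambda>a b. S (if a < j then a else Suc a) (if b < i then b else Suc b))"
    using ij by (intro eq_matI) (auto simp: mat_delete_def to_mat_def)
  ultimately show ?thesis using det by (simp add: cofactor_def field_simps)
qed

lemma measurable_det:
  assumes "\<And>i j. i < d \<Longrightarrow> j < d \<Longrightarrow> (\<lambda>\<omega>. S \<omega> i j) \<in> borel_measurable M"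
  shows "(\<lambda>\<omega>. det (to_mat d (S \<omega>))) \<in> borel_measurable M"
  unfolding det_to_mat
proof (intro borel_measurable_sum borel_measurable_times borel_measurable_const borel_measurable_prod)
  fix p i assume "p \<in> {p. p permutes {0..<d}}" "i \<in> {0..<d}"
  then show "(\<lambda>\<omega>. S \<omega> i (p i)) \<in> borel_measurable M"
    using permutes_in_image[of p "{0..<d}" i] by (intro assms) auto
qed

lemma tendsto_det:
  assumes "\<And>i j. i < d \<Longrightarrow> j < d \<Longrightarrow> ((\<lambda>\<omega>. S \<omega> i j) \<longlongrightarrow> T i j) F"
  shows "((\<lambda>\<omega>. det (to_mat d (S \<omega>))) \<longlongrightarrow> det (to_mat d T)) F"
  unfolding det_to_mat
proof (intro tendsto_sum tendsto_mult tendsto_const tendsto_prod)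
  fix p i assume "p \<in> {p. p permutes {0..<d}}" "i \<in> {0..<d}"
  then show "((\<lambda>\<omega>. S \<omega> i (p i)) \<longlongrightarrow> T i (p i)) F"
    using permutes_in_image[of p "{0..<d}" i] by (intro assms) auto
qed

text \<open>Covariance and argument vary together, as the exchange of the integrals over parameters
  and observations requires.\<close>

lemma measurable_gauss_pdf_param:
  assumes S: "\<And>i j. i < d \<Longrightarrow> j < d \<Longrightarrow> (\<lambda>\<omega>. S \<omega> i j) \<in> borel_measurable M"
    and x[measurable]: "\<And>i. i < d \<Longrightarrow> (\<lambda>\<omega>. x \<omega> i) \<in> borel_measurable M"
    and det: "\<And>\<omega>. det (to_mat d (S \<omega>)) \<noteq> 0"
  shows "(\<lambda>\<omega>. gauss_pdf d (\<lambda>_. 0) (S \<omega>) (x \<omega>)) \<in> borel_measurable M"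
proof -
  note [measurable] = measurable_det[OF S]
  have [measurable]: "(\<lambda>\<omega>. mat_inv (to_mat d (S \<omega>)) $$ (i, j)) \<in> borel_measurable M" if "i < d" "j < d" for i j
    using that by (simp add: mat_inv_entry[OF det])
      (intro borel_measurable_divide borel_measurable_times borel_measurable_const measurable_det S; auto)
  show ?thesis unfolding gauss_pdf_def Let_def by measurable
qed

lemma tendsto_gauss_pdf:
  assumes S: "\<And>i j. i < d \<Longrightarrow> j < d \<Longrightarrow> ((\<lambda>\<omega>. S \<omega> i j) \<longlongrightarrow> T i j) F"
    and det: "\<And>\<omega>. det (to_mat d (S \<omega>)) \<noteq> 0" "det (to_mat d T) > 0"
  shows "((\<lambda>\<omega>. gauss_pdf d mu (S \<omega>) x) \<longlongrightarrow> gauss_pdf d mu T x) F"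
proof -
  have "((\<lambda>\<omega>. mat_inv (to_mat d (S \<omega>)) $$ (i, j)) \<longlongrightarrow> mat_inv (to_mat d T) $$ (i, j)) F"
    if "i < d" "j < d" for i j
  proof -
    have T: "det (to_mat d T) \<noteq> 0" using det(2) by simp
    show ?thesis
      unfolding mat_inv_entry[OF det(1) that] mat_inv_entry[OF T that]
      using that T by (intro tendsto_divide tendsto_mult tendsto_const tendsto_det S) auto
  qed
  then show ?thesis unfolding gauss_pdf_def Let_def
    using det(2) by (intro tendsto_intros tendsto_det S) auto
qed

section \<open>Loewner bounds for the PPCA covariance and its density\<close>

lemma form_ppca_cov:
  "form d (ppca_cov \<sigma>2 d K W) y = (\<Sum>j<K. (\<Sum>i<d. W j i * y i)\<^sup>2) + \<sigma>2 * (\<Sum>i<d. (y i)\<^sup>2)"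
proof -
  have "form d (ppca_cov \<sigma>2 d K W) y = (\<Sum>i<d. \<Sum>i'<d. y i * (\<Sum>j<K. W j i * W j i') * y i')
     + (\<Sum>i<d. \<Sum>i'<d. y i * (if i = i' then \<sigma>2 else 0) * y i')"
    unfolding form_def ppca_cov_def by (simp add: algebra_simps sum.distrib)
  also have "(\<Sum>i<d. \<Sum>i'<d. y i * (if i = i' then \<sigma>2 else 0) * y i') = \<sigma>2 * (\<Sum>i<d. (y i)\<^sup>2)"
    by (simp add: sum_distrib_left power2_eq_square if_distrib if_distribR mult_ac cong: if_cong)
  also have "(\<Sum>i<d. \<Sum>i'<d. y i * (\<Sum>j<K. W j i * W j i') * y i')
      = (\<Sum>i<d. \<Sum>i'<d. \<Sum>j<K. (W j i * y i) * (W j i' * y i'))"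
    by (simp add: sum_distrib_left sum_distrib_right mult_ac)
  also have "\<dots> = (\<Sum>i<d. \<Sum>j<K. \<Sum>i'<d. (W j i * y i) * (W j i' * y i'))"
    by (intro sum.cong refl sum.swap)
  also have "\<dots> = (\<Sum>j<K. \<Sum>i<d. \<Sum>i'<d. (W j i * y i) * (W j i' * y i'))"
    by (rule sum.swap)
  also have "\<dots> = (\<Sum>j<K. (\<Sum>i<d. W j i * y i)\<^sup>2)"
    by (simp add: power2_eq_square sum_product)
  finally show ?thesis .
qed

lemma pos_def_ppca_cov:
  assumes "\<sigma>2 > 0" shows "pos_def d (ppca_cov \<sigma>2 d K W)"
  unfolding pos_def_def
proof (intro conjI allI impI)
  fix i j show "ppca_cov \<sigma>2 d K W i j = ppca_cov \<sigma>2 d K W j i"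
    by (simp add: ppca_cov_def mult.commute)
next
  fix x :: "nat \<Rightarrow> real" assume "\<exists>i<d. x i \<noteq> 0"
  then have "(\<Sum>i<d. (x i)\<^sup>2) > 0" by (auto intro: sum_pos2)
  then have "0 < form d (ppca_cov \<sigma>2 d K W) x"
    unfolding form_ppca_cov using assms by (intro add_nonneg_pos sum_nonneg) auto
  then show "0 < (\<Sum>i<d. \<Sum>j<d. x i * ppca_cov \<sigma>2 d K W i j * x j)" by (simp add: form_def)
qed

lemma ppca_pdf_pos: "\<sigma>2 > 0 \<Longrightarrow> ppca_pdf \<sigma>2 d K W x > 0"
  unfolding ppca_pdf_def by (intro gauss_pdf_pos pos_def_ppca_cov)

lemma ln_ppca_pdf:
  assumes "\<sigma>2 > 0"
  shows "ln (ppca_pdf \<sigma>2 d K W x) = - inv_form d (ppca_cov \<sigma>2 d K W) x / 2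
     - (d * ln (2 * pi) + ln (det (to_mat d (ppca_cov \<sigma>2 d K W)))) / 2"
  using det_pos_def[OF pos_def_ppca_cov[OF assms], of d K W]
  by (simp add: ppca_pdf_def gauss_pdf_eq ln_div ln_sqrt ln_mult ln_realpow algebra_simps)

text \<open>The low-rank part adds only squares to the form of \<open>\<sigma>2 I\<close>. This
  floor bounds the density from above uniformly in \<open>K\<close>, \<open>W\<close> and
  \<open>x\<close>.\<close>

lemma det_ppca_cov_ge:
  assumes "\<sigma>2 > 0" shows "\<sigma>2 ^ d \<le> det (to_mat d (ppca_cov \<sigma>2 d K W))"
  unfolding scaled_identity(3)[OF assms, symmetric]
  by (rule det_mono[OF scaled_identity(2)[OF assms] pos_def_ppca_cov[OF assms]])
    (simp add: scaled_identity(4)[OF assms] form_ppca_cov sum_nonneg)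

lemma inv_form_ppca_cov_le:
  assumes "\<sigma>2 > 0" shows "inv_form d (ppca_cov \<sigma>2 d K W) x \<le> (\<Sum>i<d. (x i)\<^sup>2) / \<sigma>2"
  using inv_form_antimono[OF scaled_identity(2)[OF assms] pos_def_ppca_cov[OF assms], of 1 d K W x]
  by (simp add: scaled_identity[OF assms] form_ppca_cov sum_nonneg)

text \<open>Cauchy-Schwarz bounds \<open>W W^T\<close> by its squared Frobenius norm times the
  identity. The bound is crude, but only its logarithm enters.\<close>

lemma det_ppca_cov_le:
  assumes "\<sigma>2 > 0"
  shows "det (to_mat d (ppca_cov \<sigma>2 d K W)) \<le> (\<sigma>2 + (\<Sum>j<K. \<Sum>i<d. (W j i)\<^sup>2)) ^ d"
proof -
  let ?c = "\<sigma>2 + (\<Sum>j<K. \<Sum>i<d. (W j i)\<^sup>2)"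
  have c: "?c > 0" using assms by (intro add_pos_nonneg sum_nonneg) auto
  show ?thesis
    unfolding scaled_identity(3)[OF c, symmetric]
  proof (rule det_mono[OF pos_def_ppca_cov[OF assms] scaled_identity(2)[OF c]])
    fix y
    have "(\<Sum>j<K. (\<Sum>i<d. W j i * y i)\<^sup>2) \<le> (\<Sum>j<K. (\<Sum>i<d. (W j i)\<^sup>2) * (\<Sum>i<d. (y i)\<^sup>2))"
      by (intro sum_mono Cauchy_Schwarz_ineq_sum)
    then show "form d (ppca_cov \<sigma>2 d K W) y \<le> form d (\<lambda>i j. if i = j then ?c else 0) y"
      unfolding form_ppca_cov scaled_identity(4)[OF c] by (simp add: algebra_simps sum_distrib_left)
  qed
qed

lemma ln_ppca_pdf_le:
  assumes "\<sigma>2 > 0"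
  shows "ln (ppca_pdf \<sigma>2 d K W x) \<le> - (d * ln (2 * pi) + d * ln \<sigma>2) / 2"
proof -
  have "d * ln \<sigma>2 \<le> ln (det (to_mat d (ppca_cov \<sigma>2 d K W)))"
    using det_ppca_cov_ge[OF assms, of d K W] assms det_pos_def[OF pos_def_ppca_cov[OF assms], of d K W]
    by (simp add: ln_realpow[symmetric])
  then show ?thesis
    unfolding ln_ppca_pdf[OF assms] using inv_form_nonneg[OF pos_def_ppca_cov[OF assms], of d K W x] by argo
qed

lemma ln_ppca_pdf_ge:
  assumes "\<sigma>2 > 0"
  shows "ln (ppca_pdf \<sigma>2 d K W x) \<ge>
    - ((\<Sum>i<d. (x i)\<^sup>2) / \<sigma>2 + d * ln (2 * pi) + d * (\<sigma>2 + (\<Sum>j<K. \<Sum>i<d. (W j i)\<^sup>2))) / 2"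
proof -
  let ?c = "\<sigma>2 + (\<Sum>j<K. \<Sum>i<d. (W j i)\<^sup>2)"
  have c: "?c > 0" using assms by (intro add_pos_nonneg sum_nonneg) auto
  have "ln (det (to_mat d (ppca_cov \<sigma>2 d K W))) \<le> ln (?c ^ d)"
    using det_ppca_cov_le[OF assms, of d K W] c det_pos_def[OF pos_def_ppca_cov[OF assms], of d K W]
    by (intro ln_mono) auto
  also have "\<dots> = d * ln ?c" using c by (simp add: ln_realpow)
  \<comment> \<open>Replacing \<open>ln ?c\<close> by \<open>?c\<close> gives a bound that is linear
    in the squared entries of \<open>W\<close>, hence integrable under every Gaussian.\<close>
  also have "\<dots> \<le> d * ?c" using ln_bound[OF c] by (intro mult_left_mono) auto
  finally show ?thesis
    unfolding ln_ppca_pdf[OF assms] using inv_form_ppca_cov_le[OF assms, of d K W x] by argo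
qed

lemma sq_add_le:
  fixes a b \<eta> :: real
  assumes "\<eta> > 0" shows "(a + b)\<^sup>2 \<le> (1 + \<eta>) * a\<^sup>2 + (1 + 1 / \<eta>) * b\<^sup>2"
proof -
  have "0 \<le> (\<eta> * a - b)\<^sup>2 / \<eta>" using assms by simp
  also have "\<dots> = \<eta> * a\<^sup>2 - 2 * a * b + b\<^sup>2 / \<eta>" using assms by (simp add: power2_eq_square field_simps)
  finally show ?thesis by (simp add: power2_sum algebra_simps)
qed

text \<open>The relative error in the Loewner comparison of the two covariances:
  \<open>\<eta>\<close> is the weight used to split squares, and the squared Frobenius distance is
  measured in units of the noise \<open>\<sigma>2\<close>. Its symmetry in \<open>W\<close> and
  \<open>V\<close> gives the comparison in both directions.\<close>

definition pert :: "real \<Rightarrow> nat \<Rightarrow> nat \<Rightarrow> real \<Rightarrow> (nat \<Rightarrow> nat \<Rightarrow> real) \<Rightarrow> (nat \<Rightarrow> nat \<Rightarrow> real) \<Rightarrow> real" where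
  "pert \<sigma>2 d K \<eta> W V = \<eta> + (1 + 1 / \<eta>) * (\<Sum>j<K. \<Sum>i<d. (W j i - V j i)\<^sup>2) / \<sigma>2"

lemma pert_nonneg: "\<sigma>2 > 0 \<Longrightarrow> \<eta> > 0 \<Longrightarrow> pert \<sigma>2 d K \<eta> W V \<ge> 0"
  unfolding pert_def by (intro add_nonneg_nonneg divide_nonneg_nonneg mult_nonneg_nonneg sum_nonneg) auto

lemma pert_commute: "pert \<sigma>2 d K \<eta> W V = pert \<sigma>2 d K \<eta> V W"
  unfolding pert_def by (simp add: power2_commute)

text \<open>Split \<open>W^T y = V^T y + (W - V)^T y\<close>, apply the weighted square inequality
  to each column and Cauchy-Schwarz to the error. The noise term \<open>\<sigma>2 * Y\<close> is
  always part of the form, so it absorbs a multiple of \<open>Y\<close>, whatever the rank of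
  \<open>V\<close>.\<close>

lemma form_ppca_cov_pert:
  assumes "\<sigma>2 > 0" "\<eta> > 0"
  shows "form d (ppca_cov \<sigma>2 d K W) y \<le> (1 + pert \<sigma>2 d K \<eta> W V) * form d (ppca_cov \<sigma>2 d K V) y"
proof -
  define E where "E = (\<Sum>j<K. \<Sum>i<d. (W j i - V j i)\<^sup>2)"
  define Y where "Y = (\<Sum>i<d. (y i)\<^sup>2)"
  define v where "v = (\<Sum>j<K. (\<Sum>i<d. V j i * y i)\<^sup>2)"
  have nn: "E \<ge> 0" "Y \<ge> 0" "v \<ge> 0" unfolding E_def Y_def v_def by (auto intro!: sum_nonneg)
  have "(\<Sum>j<K. (\<Sum>i<d. W j i * y i)\<^sup>2)
     = (\<Sum>j<K. ((\<Sum>i<d. V j i * y i) + (\<Sum>i<d. (W j i - V j i) * y i))\<^sup>2)"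
    by (simp add: sum.distrib[symmetric] algebra_simps)
  also have "\<dots> \<le> (\<Sum>j<K. (1 + \<eta>) * (\<Sum>i<d. V j i * y i)\<^sup>2 + (1 + 1 / \<eta>) * (\<Sum>i<d. (W j i - V j i) * y i)\<^sup>2)"
    by (intro sum_mono sq_add_le assms)
  also have "\<dots> \<le> (\<Sum>j<K. (1 + \<eta>) * (\<Sum>i<d. V j i * y i)\<^sup>2 + (1 + 1 / \<eta>) * ((\<Sum>i<d. (W j i - V j i)\<^sup>2) * Y))"
    unfolding Y_def using assms(2)
    by (intro sum_mono add_left_mono mult_left_mono Cauchy_Schwarz_ineq_sum) auto
  also have "\<dots> = (1 + \<eta>) * v + (1 + 1 / \<eta>) * E * Y"
    by (simp add: v_def E_def sum.distrib sum_distrib_left sum_distrib_right mult.assoc)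
  finally have "form d (ppca_cov \<sigma>2 d K W) y \<le> (1 + \<eta>) * v + (1 + 1 / \<eta>) * E * Y + \<sigma>2 * Y"
    unfolding form_ppca_cov Y_def by simp
  also have "\<dots> \<le> (1 + (\<eta> + (1 + 1 / \<eta>) * E / \<sigma>2)) * (v + \<sigma>2 * Y)"
  proof -
    have "(1 + (\<eta> + (1 + 1 / \<eta>) * E / \<sigma>2)) * (v + \<sigma>2 * Y)
      = (1 + \<eta>) * v + (1 + 1 / \<eta>) * E * Y + \<sigma>2 * Y + (\<eta> * \<sigma>2 * Y + (1 + 1 / \<eta>) * E / \<sigma>2 * v)"
      using assms by (simp add: field_simps)
    moreover have "\<eta> * \<sigma>2 * Y + (1 + 1 / \<eta>) * E / \<sigma>2 * v \<ge> 0" using assms nn by simp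
    ultimately show ?thesis by linarith
  qed
  finally show ?thesis unfolding form_ppca_cov pert_def E_def v_def Y_def .
qed

lemma pos_def_smult: "pos_def d S \<Longrightarrow> c > 0 \<Longrightarrow> pos_def d (\<lambda>i j. c * S i j)"
  unfolding pos_def_def
proof (intro conjI allI impI)
  fix x :: "nat \<Rightarrow> real"
  assume S: "(\<forall>i<d. \<forall>j<d. S i j = S j i) \<and>
     (\<forall>x. (\<exists>i<d. x i \<noteq> 0) \<longrightarrow> (\<Sum>i<d. \<Sum>j<d. x i * S i j * x j) > 0)" and c: "c > 0"
    and ex: "\<exists>i<d. x i \<noteq> 0"
  have "(\<Sum>i<d. \<Sum>j<d. x i * (c * S i j) * x j) = c * (\<Sum>i<d. \<Sum>j<d. x i * S i j * x j)"
    by (simp add: sum_distrib_left mult_ac)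
  then show "0 < (\<Sum>i<d. \<Sum>j<d. x i * (c * S i j) * x j)" using S c ex by simp
qed auto

lemma det_ppca_cov_pert:
  assumes "\<sigma>2 > 0" "\<eta> > 0"
  shows "det (to_mat d (ppca_cov \<sigma>2 d K W))
    \<le> (1 + pert \<sigma>2 d K \<eta> W V) ^ d * det (to_mat d (ppca_cov \<sigma>2 d K V))"
proof -
  let ?c = "1 + pert \<sigma>2 d K \<eta> W V" and ?S = "ppca_cov \<sigma>2 d K V"
  have c: "?c > 0" using pert_nonneg[OF assms, of d K W V] by simp
  have "det (to_mat d (ppca_cov \<sigma>2 d K W)) \<le> det (to_mat d (\<lambda>i j. ?c * ?S i j))"
    using form_ppca_cov_pert[OF assms, of d K W _ V]
    by (intro det_mono pos_def_smult pos_def_ppca_cov assms c)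
      (simp add: form_def sum_distrib_left mult_ac)
  also have "to_mat d (\<lambda>i j. ?c * ?S i j) = ?c \<cdot>\<^sub>m to_mat d ?S"
    by (rule eq_matI) (auto simp: to_mat_def)
  also have "det \<dots> = ?c ^ d * det (to_mat d ?S)" by (simp add: to_mat_def)
  finally show ?thesis .
qed

text \<open>Both directions of the comparison are used: the determinant of \<open>W\<close> is at
  most \<open>(1 + p)^d\<close> times that of \<open>V\<close>, and the form of \<open>V\<close> is
  at most \<open>1 + p\<close> times that of \<open>W\<close>, which inversion turns into a bound on
  the inverse form of \<open>W\<close>. With \<open>ln (1 + p) \<le> p\<close> both errors are
  linear in \<open>p\<close>, so their mean under a Gaussian \<open>W\<close> is a second
  moment.\<close>

lemma ln_ppca_pdf_diff_le:
  assumes "\<sigma>2 > 0" "\<eta> > 0"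
  shows "ln (ppca_pdf \<sigma>2 d K V x) - ln (ppca_pdf \<sigma>2 d K W x)
    \<le> pert \<sigma>2 d K \<eta> W V / 2 * ((\<Sum>i<d. (x i)\<^sup>2) / \<sigma>2 + d)"
proof -
  let ?p = "pert \<sigma>2 d K \<eta> W V" and ?SV = "ppca_cov \<sigma>2 d K V" and ?SW = "ppca_cov \<sigma>2 d K W"
  have p: "?p \<ge> 0" by (rule pert_nonneg[OF assms])
  note pd = pos_def_ppca_cov[OF assms(1)]
  have "ln (det (to_mat d ?SW)) \<le> ln ((1 + ?p) ^ d * det (to_mat d ?SV))"
    using det_pos_def[OF pd[of d K W]] det_ppca_cov_pert[OF assms, of d K W V] by (intro ln_mono) auto
  also have "\<dots> = d * ln (1 + ?p) + ln (det (to_mat d ?SV))"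
    using det_pos_def[OF pd[of d K V]] p by (simp add: ln_mult ln_realpow)
  also have "d * ln (1 + ?p) \<le> d * ?p" using p by (intro mult_left_mono ln_add_one_self_le_self) auto
  finally have 1: "ln (det (to_mat d ?SW)) - ln (det (to_mat d ?SV)) \<le> d * ?p" by simp
  have "inv_form d ?SW x \<le> (1 + ?p) * inv_form d ?SV x"
    using p form_ppca_cov_pert[OF assms, of d K V _ W]
    by (intro inv_form_antimono pd) (auto simp: pert_commute[of _ _ _ _ V W])
  moreover have "?p * inv_form d ?SV x \<le> ?p * ((\<Sum>i<d. (x i)\<^sup>2) / \<sigma>2)"
    by (intro mult_left_mono inv_form_ppca_cov_le assms p)
  ultimately have 2: "inv_form d ?SW x - inv_form d ?SV x \<le> ?p * ((\<Sum>i<d. (x i)\<^sup>2) / \<sigma>2)"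
    by (simp add: algebra_simps)
  show ?thesis unfolding ln_ppca_pdf[OF assms(1)] using 1 2 by (simp add: algebra_simps add_divide_distrib)
qed

lemma measurable_ppca_pdf:
  assumes "\<sigma>2 > 0" and [measurable]: "\<And>j i. j < K \<Longrightarrow> i < d \<Longrightarrow> (\<lambda>\<omega>. W \<omega> j i) \<in> borel_measurable M"
    "\<And>i. i < d \<Longrightarrow> (\<lambda>\<omega>. x \<omega> i) \<in> borel_measurable M"
  shows "(\<lambda>\<omega>. ppca_pdf \<sigma>2 d K (W \<omega>) (x \<omega>)) \<in> borel_measurable M"
  unfolding ppca_pdf_def
proof (rule measurable_gauss_pdf_param)
  fix i j assume [simp]: "i < d" "j < d"
  show "(\<lambda>\<omega>. ppca_cov \<sigma>2 d K (W \<omega>) i j) \<in> borel_measurable M"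
    unfolding ppca_cov_def by measurable
next
  fix \<omega> show "det (to_mat d (ppca_cov \<sigma>2 d K (W \<omega>))) \<noteq> 0"
    using det_pos_def[OF pos_def_ppca_cov[OF assms(1)], of d K "W \<omega>"] by simp
qed measurable

lemma tendsto_ppca_pdf:
  assumes "\<sigma>2 > 0" and "\<And>j i. j < K \<Longrightarrow> i < d \<Longrightarrow> ((\<lambda>\<omega>. W \<omega> j i) \<longlongrightarrow> V j i) F"
  shows "((\<lambda>\<omega>. ppca_pdf \<sigma>2 d K (W \<omega>) x) \<longlongrightarrow> ppca_pdf \<sigma>2 d K V x) F"
  unfolding ppca_pdf_def
proof (rule tendsto_gauss_pdf)
  fix i j assume "i < d" "j < d"
  then show "((\<lambda>\<omega>. ppca_cov \<sigma>2 d K (W \<omega>) i j) \<longlongrightarrow> ppca_cov \<sigma>2 d K V i j) F"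
    unfolding ppca_cov_def by (intro tendsto_intros assms) auto
next
  show "det (to_mat d (ppca_cov \<sigma>2 d K (W \<omega>))) \<noteq> 0" for \<omega>
    using det_pos_def[OF pos_def_ppca_cov[OF assms(1)], of d K "W \<omega>"] by simp
  show "det (to_mat d (ppca_cov \<sigma>2 d K V)) > 0"
    by (intro det_pos_def pos_def_ppca_cov assms)
qed

subsection \<open>Gaussian variational families\<close>

definition vgauss :: "nat \<Rightarrow> nat \<Rightarrow> (nat \<Rightarrow> nat \<Rightarrow> real) \<Rightarrow> (nat \<Rightarrow> nat \<Rightarrow> nat \<Rightarrow> real) \<Rightarrow> (nat \<Rightarrow> nat \<Rightarrow> real) measure" where
  "vgauss d K mu A = PiM {..<K} (\<lambda>j. gauss_measure d (mu j) (gram d (A j)))"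

definition std_mat :: "nat \<Rightarrow> nat \<Rightarrow> (nat \<Rightarrow> nat \<Rightarrow> real) measure" where
  "std_mat d K = PiM {..<K} (\<lambda>_. std_gauss d)"

text \<open>Reparametrisation: integrals against \<open>vgauss\<close> become integrals against the
  fixed law \<open>std_mat\<close>, with the parameters in the integrand only. Dominated convergence
  in the parameters relies on this.\<close>

definition mat_map :: "nat \<Rightarrow> nat \<Rightarrow> (nat \<Rightarrow> nat \<Rightarrow> real) \<Rightarrow> (nat \<Rightarrow> nat \<Rightarrow> nat \<Rightarrow> real) \<Rightarrow> (nat \<Rightarrow> nat \<Rightarrow> real) \<Rightarrow> nat \<Rightarrow> nat \<Rightarrow> real" where
  "mat_map d K mu A Z = (\<lambda>j\<in>{..<K}. aff_map d (mu j) (A j) (Z j))"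

definition lower_tris :: "nat \<Rightarrow> nat \<Rightarrow> (nat \<Rightarrow> nat \<Rightarrow> nat \<Rightarrow> real) \<Rightarrow> bool" where
  "lower_tris d K A \<longleftrightarrow> (\<forall>j<K. lower_tri d (A j))"

lemma mat_map_apply: "j < K \<Longrightarrow> i < d \<Longrightarrow> mat_map d K mu A Z j i = mu j i + (\<Sum>k<d. A j i k * Z j k)"
  by (simp add: mat_map_def aff_map_apply)

lemma var_family_eq: "var_family d K = {vgauss d K mu A | mu A. lower_tris d K A}"
proof (intro equalityI subsetI)
  fix \<rho> assume "\<rho> \<in> var_family d K"
  then obtain mu S where \<rho>: "\<rho> = PiM {..<K} (\<lambda>j. gauss_measure d (mu j) (S j))" and S: "\<And>j. j < K \<Longrightarrow> pos_def d (S j)"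
    unfolding var_family_def by blast
  have "\<exists>A. lower_tri d A \<and> (\<forall>i<d. \<forall>i'<d. S j i i' = gram d A i i')" if "j < K" for j
    by (rule cholesky[OF S[OF that]])
  then have "\<exists>A. \<forall>j<K. lower_tri d (A j) \<and> (\<forall>i<d. \<forall>i'<d. S j i i' = gram d (A j) i i')"
    by (intro choice[of "\<lambda>j A. j < K \<longrightarrow> lower_tri d A \<and> (\<forall>i<d. \<forall>i'<d. S j i i' = gram d A i i')", simplified]) blast
  then obtain A where A: "\<And>j. j < K \<Longrightarrow> lower_tri d (A j)"
    "\<And>j i i'. j < K \<Longrightarrow> i < d \<Longrightarrow> i' < d \<Longrightarrow> S j i i' = gram d (A j) i i'" by blast
  have "\<rho> = vgauss d K mu A"
    unfolding \<rho> vgauss_def by (intro PiM_cong refl gauss_measure_cong A) auto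
  then show "\<rho> \<in> {vgauss d K mu A | mu A. lower_tris d K A}"
    using A(1) by (auto simp: lower_tris_def)
next
  fix \<rho> assume "\<rho> \<in> {vgauss d K mu A | mu A. lower_tris d K A}"
  then obtain mu A where \<rho>: "\<rho> = vgauss d K mu A" "lower_tris d K A" by blast
  then show "\<rho> \<in> var_family d K"
    unfolding var_family_def vgauss_def lower_tris_def using pos_def_gram
    by (intro CollectI exI[of _ mu] exI[of _ "\<lambda>j. gram d (A j)"]) auto
qed

lemma lower_tri_id: "c > 0 \<Longrightarrow> lower_tri d (\<lambda>i k. if i = k then c else 0)"
  by (simp add: lower_tri_def)

text \<open>The product lemmas ask for well-behaved factors at every index, so columns beyond
  \<open>K\<close> are filled with the identity.\<close>

lemma lower_tris_extend:
  assumes "lower_tris d K A"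
  obtains B where "\<And>j. lower_tri d (B j)" "\<And>j. j < K \<Longrightarrow> B j = A j"
proof (rule that)
  fix j show "lower_tri d ((\<lambda>j. if j < K then A j else (\<lambda>i k. if i = k then 1 else 0)) j)"
    using assms by (auto simp: lower_tris_def lower_tri_id)
qed auto

lemma sets_mat_space: "sets (PiM {..<K} (\<lambda>j. gauss_measure d (mu j) (S j))) = sets (mat_space d K)"
  unfolding mat_space_def by (intro sets_PiM_cong) (auto simp: gauss_measure_def)

lemma sets_vgauss[measurable_cong, simp]: "sets (vgauss d K mu A) = sets (mat_space d K)"
  unfolding vgauss_def by (rule sets_mat_space)

lemma sets_std_mat[measurable_cong, simp]: "sets (std_mat d K) = sets (mat_space d K)"
  unfolding std_mat_def mat_space_def by (intro sets_PiM_cong) auto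

lemma measurable_mat_space_column:
  "j < K \<Longrightarrow> (\<lambda>W. W j) \<in> measurable (mat_space d K) (lborel_d d)"
  unfolding mat_space_def by simp

lemma measurable_mat_space_entry:
  "j < K \<Longrightarrow> i < d \<Longrightarrow> (\<lambda>W. W j i) \<in> borel_measurable (mat_space d K)"
  by (rule measurable_compose[OF measurable_mat_space_column measurable_lborel_d_component])

lemma measurable_mat_map: "mat_map d K mu A \<in> measurable (mat_space d K) (mat_space d K)"
  unfolding mat_map_def[abs_def] mat_space_def
  by (rule measurable_restrict)
    (rule measurable_compose[OF _ measurable_aff_map], rule measurable_component_singleton, simp)

lemma measurable_mat_map_std: "mat_map d K mu A \<in> measurable (std_mat d K) (mat_space d K)"
  using measurable_mat_map by (simp cong: measurable_cong_sets)

lemma prob_space_std_mat: "prob_space (std_mat d K)"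
  unfolding std_mat_def by (intro prob_space_PiM prob_space_std_gauss)

lemma vgauss_distr:
  assumes "lower_tris d K A"
  shows "vgauss d K mu A = distr (std_mat d K) (mat_space d K) (mat_map d K mu A)"
proof -
  obtain B where B: "\<And>j. lower_tri d (B j)" "\<And>j. j < K \<Longrightarrow> B j = A j"
    using lower_tris_extend[OF assms] by blast
  have "vgauss d K mu A = PiM {..<K} (\<lambda>j. distr (std_gauss d) (lborel_d d) (aff_map d (mu j) (B j)))"
    unfolding vgauss_def gauss_measure_eq_distr[OF B(1), symmetric] using B(2) by (intro PiM_cong) auto
  also have "\<dots> = distr (std_mat d K) (mat_space d K) (\<lambda>x. \<lambda>i\<in>{..<K}. aff_map d (mu i) (B i) (x i))"
    unfolding std_mat_def mat_space_def using measurable_aff_map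
    by (intro PiM_distr prob_space_std_gauss) (simp_all cong: measurable_cong_sets)
  also have "(\<lambda>x. \<lambda>i\<in>{..<K}. aff_map d (mu i) (B i) (x i)) = mat_map d K mu A"
    using B(2) by (intro ext) (auto simp: mat_map_def restrict_def)
  finally show ?thesis .
qed

lemma prob_space_vgauss: "lower_tris d K A \<Longrightarrow> prob_space (vgauss d K mu A)"
  unfolding vgauss_distr by (intro prob_space.prob_space_distr prob_space_std_mat measurable_mat_map_std)

lemma sigma_finite_mat_space: "sigma_finite_measure (mat_space d K)"
proof -
  interpret product_sigma_finite "\<lambda>_. lborel_d d"
    by (simp add: product_sigma_finite_def sigma_finite_lborel_d)
  show ?thesis unfolding mat_space_def by (rule sigma_finite) simp
qed

lemma vgauss_density:
  assumes "lower_tris d K A"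
  shows "vgauss d K mu A = density (mat_space d K) (\<lambda>W. ennreal (\<Prod>j<K. gauss_pdf d (mu j) (gram d (A j)) (W j)))"
proof -
  obtain B where B: "\<And>j. lower_tri d (B j)" "\<And>j. j < K \<Longrightarrow> B j = A j"
    using lower_tris_extend[OF assms] by blast
  have "vgauss d K mu A = PiM {..<K} (\<lambda>j. density (lborel_d d) (\<lambda>x. ennreal (gauss_pdf d (mu j) (gram d (B j)) x)))"
    unfolding vgauss_def gauss_measure_def using B(2) by (intro PiM_cong) auto
  also have "\<dots> = density (mat_space d K) (\<lambda>W. \<Prod>j<K. ennreal (gauss_pdf d (mu j) (gram d (B j)) (W j)))"
    unfolding mat_space_def
    by (rule PiM_density)
      (auto simp: gauss_measure_def[symmetric] intro!: sigma_finite_lborel_d prob_space_imp_sigma_finite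
        prob_space_gauss_measure pos_def_gram B)
  also have "(\<lambda>W. \<Prod>j<K. ennreal (gauss_pdf d (mu j) (gram d (B j)) (W j)))
     = (\<lambda>W. ennreal (\<Prod>j<K. gauss_pdf d (mu j) (gram d (A j)) (W j)))"
    using assms
    by (intro ext, subst prod_ennreal[symmetric])
      (auto intro!: prod.cong less_imp_le gauss_pdf_pos pos_def_gram simp: B(2) lower_tris_def)
  finally show ?thesis .
qed

lemma gram_scaled_id:
  assumes "i < d"
  shows "gram d (\<lambda>i k. if i = k then c else 0) i i' = (if i = i' then c\<^sup>2 else 0)"
proof -
  have "gram d (\<lambda>i k. if i = k then c else 0) i i' = (\<Sum>k<d. if k = i then (if i = i' then c\<^sup>2 else 0) else 0)"
    unfolding gram_def by (intro sum.cong) (auto simp: power2_eq_square)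
  then show ?thesis using assms by simp
qed

lemma prior_K_eq_vgauss:
  "prior_K s d K = vgauss d K (\<lambda>_ _. 0) (\<lambda>_ i k. if i = k then s else 0)"
  unfolding prior_K_def vgauss_def
  by (intro PiM_cong refl gauss_measure_cong) (simp add: gram_scaled_id)

section \<open>Kullback-Leibler divergence from the prior\<close>

definition log_ratio :: "real \<Rightarrow> nat \<Rightarrow> nat \<Rightarrow> (nat \<Rightarrow> nat \<Rightarrow> real) \<Rightarrow> (nat \<Rightarrow> nat \<Rightarrow> nat \<Rightarrow> real) \<Rightarrow> (nat \<Rightarrow> nat \<Rightarrow> real) \<Rightarrow> real" where
  "log_ratio s d K mu A W = ln ((\<Prod>j<K. gauss_pdf d (mu j) (gram d (A j)) (W j)) /
      (\<Prod>j<K. gauss_pdf d (\<lambda>_. 0) (gram d (\<lambda>i k. if i = k then s else 0)) (W j)))"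

text \<open>The closed form of the divergence, spread over the entries: the row norms of the
  Cholesky factor add up to the trace of the covariance, and half its log-determinant is the sum of
  the \<open>ln (A j i i)\<close>.\<close>

definition kl_gauss :: "real \<Rightarrow> nat \<Rightarrow> nat \<Rightarrow> (nat \<Rightarrow> nat \<Rightarrow> real) \<Rightarrow> (nat \<Rightarrow> nat \<Rightarrow> nat \<Rightarrow> real) \<Rightarrow> real" where
  "kl_gauss s d K mu A = (\<Sum>j<K. \<Sum>i<d.
     ((mu j i)\<^sup>2 + (\<Sum>k<d. (A j i k)\<^sup>2)) / (2 * s\<^sup>2) - 1 / 2 - ln (A j i i) + ln s)"

lemma measurable_prod_gauss_pdf[measurable]:
  "(\<lambda>W. \<Prod>j<K. gauss_pdf d (mu j) (S j) (W j)) \<in> borel_measurable (mat_space d K)"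
  by (intro borel_measurable_prod measurable_compose[OF measurable_mat_space_column measurable_gauss_pdf]) auto

lemma measurable_log_ratio[measurable]: "log_ratio s d K mu A \<in> borel_measurable (mat_space d K)"
  unfolding log_ratio_def[abs_def]
  by (intro borel_measurable_ln borel_measurable_divide measurable_prod_gauss_pdf)

text \<open>Evaluating at the image of a standard point removes the inverse covariance; only squares
  of \<open>z\<close> and the diagonal of the factor are left.\<close>

lemma ln_gauss_pdf_aff_map:
  assumes A: "lower_tri d A"
  shows "ln (gauss_pdf d mu (gram d A) (aff_map d mu A z)) =
     (\<Sum>i<d. - (z i)\<^sup>2 / 2 - ln (A i i)) - d * ln (2 * pi) / 2"
proof -
  have P: "(\<Prod>i<d. A i i) > 0" using A by (intro prod_pos) (auto simp: lower_tri_def)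
  have g: "gauss_pdf d mu (gram d A) (aff_map d mu A z) > 0" by (intro gauss_pdf_pos pos_def_gram A)
  have "ln (\<Prod>i<d. A i i) + ln (gauss_pdf d mu (gram d A) (aff_map d mu A z))
      = ln (\<Prod>i<d. std_normal_density (z i))"
    unfolding gauss_pdf_affine[OF A, of mu z, symmetric] by (rule ln_mult_pos[symmetric, OF P g])
  also have "\<dots> = (\<Sum>i<d. ln (std_normal_density (z i)))"
    using less_imp_neq[OF normal_density_pos[of 1 0], symmetric] by (intro ln_prod) auto
  also have "\<dots> = (\<Sum>i<d. - (z i)\<^sup>2 / 2 - ln (2 * pi) / 2)"
    by (intro sum.cong) (auto simp: std_normal_density_def ln_mult ln_div ln_sqrt)
  also have "ln (\<Prod>i<d. A i i) = (\<Sum>i<d. ln (A i i))"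
    using A by (intro ln_prod) (auto simp: lower_tri_def)
  finally show ?thesis by (simp add: sum_subtractf)
qed

lemma ln_gauss_pdf_scaled_id:
  assumes "s > 0"
  shows "ln (gauss_pdf d (\<lambda>_. 0) (gram d (\<lambda>i k. if i = k then s else 0)) x)
    = (\<Sum>i<d. - (x i)\<^sup>2 / (2 * s\<^sup>2) - ln s) - d * ln (2 * pi) / 2"
proof -
  have s2: "s\<^sup>2 > 0" using assms by simp
  have eq: "to_mat d (gram d (\<lambda>i k. if i = k then s else 0)) = to_mat d (\<lambda>i j. if i = j then s\<^sup>2 else 0)"
    by (rule to_mat_cong) (simp add: gram_scaled_id)
  have "gauss_pdf d (\<lambda>_. 0) (gram d (\<lambda>i k. if i = k then s else 0)) x
     = gauss_pdf d (\<lambda>_. 0) (\<lambda>i j. if i = j then s\<^sup>2 else 0) x"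
    unfolding gauss_pdf_def eq ..
  then show ?thesis
    using assms
    by (simp add: gauss_pdf_eq scaled_identity[OF s2] ln_div ln_sqrt ln_mult ln_realpow
        sum_subtractf sum_negf sum_divide_distrib algebra_simps)
qed

text \<open>After reparametrisation the log-density ratio is a quadratic polynomial in
  \<open>Z\<close>, so its mean follows from second moments.\<close>

lemma log_ratio_mat_map:
  assumes A: "lower_tris d K A" and s: "s > 0"
  shows "log_ratio s d K mu A (mat_map d K mu A Z) = (\<Sum>j<K. \<Sum>i<d.
     (mu j i + (\<Sum>k<d. A j i k * Z j k))\<^sup>2 / (2 * s\<^sup>2) - (Z j i)\<^sup>2 / 2 - ln (A j i i) + ln s)"
proof -
  let ?W = "mat_map d K mu A Z" and ?I = "\<lambda>i k :: nat. if i = k then s else 0"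
  have p1: "gauss_pdf d (mu j) (gram d (A j)) x > 0" if "j < K" for j x
    using A that by (intro gauss_pdf_pos pos_def_gram) (auto simp: lower_tris_def)
  have p2: "gauss_pdf d (\<lambda>_. 0) (gram d ?I) x > 0" for x
    using s by (intro gauss_pdf_pos pos_def_gram lower_tri_id)
  have "log_ratio s d K mu A ?W = ln (\<Prod>j<K. gauss_pdf d (mu j) (gram d (A j)) (?W j))
     - ln (\<Prod>j<K. gauss_pdf d (\<lambda>_. 0) (gram d ?I) (?W j))"
    unfolding log_ratio_def using p1 p2 by (intro ln_divide_pos) (auto intro!: prod_pos)
  also have "\<dots> = (\<Sum>j<K. ln (gauss_pdf d (mu j) (gram d (A j)) (?W j))
     - ln (gauss_pdf d (\<lambda>_. 0) (gram d ?I) (?W j)))"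
    using less_imp_neq[OF p1, symmetric] less_imp_neq[OF p2, symmetric]
    by (subst (1 2) ln_prod) (auto simp: sum_subtractf)
  also have "\<dots> = (\<Sum>j<K. \<Sum>i<d.
     (mu j i + (\<Sum>k<d. A j i k * Z j k))\<^sup>2 / (2 * s\<^sup>2) - (Z j i)\<^sup>2 / 2 - ln (A j i i) + ln s)"
  proof (intro sum.cong refl)
    fix j assume "j \<in> {..<K}"
    then have j: "j < K" by simp
    then have "?W j = aff_map d (mu j) (A j) (Z j)" by (simp add: mat_map_def)
    moreover have "lower_tri d (A j)" using A j by (simp add: lower_tris_def)
    ultimately show "ln (gauss_pdf d (mu j) (gram d (A j)) (?W j)) - ln (gauss_pdf d (\<lambda>_. 0) (gram d ?I) (?W j))
       = (\<Sum>i<d. (mu j i + (\<Sum>k<d. A j i k * Z j k))\<^sup>2 / (2 * s\<^sup>2) - (Z j i)\<^sup>2 / 2 - ln (A j i i) + ln s)"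
      by (simp add: ln_gauss_pdf_aff_map ln_gauss_pdf_scaled_id[OF s] sum_subtractf sum.distrib sum_negf
          aff_map_apply)
  qed
  finally show ?thesis .
qed

lemma has_bochner_integral_PiM_component:
  assumes M: "\<And>i. i \<in> I \<Longrightarrow> prob_space (M i)" and j: "j \<in> I"
    and f: "has_bochner_integral (M j) f c"
  shows "has_bochner_integral (PiM I M) (\<lambda>x. f (x j)) (c :: real)"
proof -
  have e: "distr (PiM I M) (M j) (\<lambda>x. x j) = M j"
    by (rule distr_PiM_component[OF M j])
  have m: "(\<lambda>x. x j) \<in> measurable (PiM I M) (M j)"
    by (rule measurable_component_singleton[OF j])
  have f': "f \<in> borel_measurable (M j)" using f by (rule borel_measurable_has_bochner_integral)
  show ?thesis
    using f integrable_distr_eq[OF m f'] integral_distr[OF m f']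
    unfolding has_bochner_integral_iff e by metis
qed

lemma has_bochner_integral_std_mat_column:
  assumes "j < K" and "has_bochner_integral (std_gauss d) f c"
  shows "has_bochner_integral (std_mat d K) (\<lambda>Z. f (Z j)) (c :: real)"
  unfolding std_mat_def using assms
  by (intro has_bochner_integral_PiM_component prob_space_std_gauss) auto

lemma std_mat_affine_square:
  assumes "j < K"
  shows "has_bochner_integral (std_mat d K) (\<lambda>Z. (a + (\<Sum>k<d. b k * Z j k))\<^sup>2) (a\<^sup>2 + (\<Sum>k<d. (b k)\<^sup>2))"
  using has_bochner_integral_std_mat_column[OF assms std_gauss_affine_square] .

lemma std_mat_square:
  assumes "j < K" "i < d"
  shows "has_bochner_integral (std_mat d K) (\<lambda>Z. (Z j i)\<^sup>2) 1"
  using has_bochner_integral_std_mat_column[OF assms(1) std_gauss_component_moment(1)[OF assms(2) assms(2)]]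
  by (simp add: power2_eq_square)

lemma integrable_vgauss_iff:
  fixes f :: "_ \<Rightarrow> real"
  assumes "lower_tris d K A" "f \<in> borel_measurable (mat_space d K)"
  shows "integrable (vgauss d K mu A) f \<longleftrightarrow> integrable (std_mat d K) (\<lambda>Z. f (mat_map d K mu A Z))"
  unfolding vgauss_distr[OF assms(1)] by (intro integrable_distr_eq measurable_mat_map_std assms)

lemma integral_vgauss:
  fixes f :: "_ \<Rightarrow> real"
  assumes "lower_tris d K A" "f \<in> borel_measurable (mat_space d K)"
  shows "integral\<^sup>L (vgauss d K mu A) f = (\<integral>Z. f (mat_map d K mu A Z) \<partial>std_mat d K)"
  unfolding vgauss_distr[OF assms(1)] by (intro integral_distr measurable_mat_map_std assms)

lemma log_ratio_integral:
  assumes A: "lower_tris d K A" and s: "s > 0"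
  shows "has_bochner_integral (vgauss d K mu A) (log_ratio s d K mu A) (kl_gauss s d K mu A)"
proof -
  interpret prob_space "std_mat d K" by (rule prob_space_std_mat)
  have c: "has_bochner_integral (std_mat d K) (\<lambda>Z. c) c" for c :: real
    by (simp add: has_bochner_integral_iff prob_space)
  have "has_bochner_integral (std_mat d K) (\<lambda>Z. \<Sum>j<K. \<Sum>i<d.
     (mu j i + (\<Sum>k<d. A j i k * Z j k))\<^sup>2 / (2 * s\<^sup>2) - (Z j i)\<^sup>2 / 2 - ln (A j i i) + ln s)
     (kl_gauss s d K mu A)"
    unfolding kl_gauss_def
    by (intro has_bochner_integral_sum has_bochner_integral_add has_bochner_integral_diff
        has_bochner_integral_divide_zero std_mat_affine_square std_mat_square c) auto
  then show ?thesis
    unfolding has_bochner_integral_iff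
    by (simp add: integrable_vgauss_iff[OF A] integral_vgauss[OF A] log_ratio_mat_map[OF A s])
qed

lemma KL_vgauss:
  assumes A: "lower_tris d K A" and s: "s > 0"
  shows "KL (vgauss d K mu A) (prior_K s d K) = kl_gauss s d K mu A"
proof -
  interpret sigma_finite_measure "mat_space d K" by (rule sigma_finite_mat_space)
  let ?I = "\<lambda>i k :: nat. if i = k then s else 0"
  let ?g = "\<lambda>W. \<Prod>j<K. gauss_pdf d (mu j) (gram d (A j)) (W j)"
  let ?f = "\<lambda>W. \<Prod>j<K. gauss_pdf d (\<lambda>_. 0) (gram d ?I) (W j)"
  have I: "lower_tris d K (\<lambda>_. ?I)" using s by (simp add: lower_tris_def lower_tri_id)
  have p1: "?g W > 0" for W
    using A by (intro prod_pos gauss_pdf_pos pos_def_gram) (auto simp: lower_tris_def)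
  have p2: "?f W > 0" for W
    using s by (intro prod_pos ballI gauss_pdf_pos pos_def_gram lower_tri_id)
  have "KL (vgauss d K mu A) (prior_K s d K) = (\<integral>W. ?g W * log (exp 1) (?g W / ?f W) \<partial>mat_space d K)"
    unfolding KL_def prior_K_eq_vgauss vgauss_density[OF A] vgauss_density[OF I]
    using less_imp_neq[OF p2] less_imp_le[OF p1] less_imp_le[OF p2]
    by (intro KL_density_density measurable_prod_gauss_pdf AE_I2) (simp_all del: prod_zero_iff)
  also have "\<dots> = (\<integral>W. ?g W * log_ratio s d K mu A W \<partial>mat_space d K)"
    by (simp add: log_ratio_def log_ln)
  also have "\<dots> = integral\<^sup>L (vgauss d K mu A) (log_ratio s d K mu A)"
    unfolding vgauss_density[OF A] using less_imp_le[OF p1]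
    by (intro integral_real_density[symmetric] measurable_prod_gauss_pdf measurable_log_ratio AE_I2) simp
  finally show ?thesis using log_ratio_integral[OF A s, of mu] by (simp add: has_bochner_integral_iff)
qed

section \<open>Integrability of the log-likelihood\<close>

lemma measurable_loglik:
  assumes "\<sigma>2 > 0" shows "loglik \<sigma>2 d K n X \<in> borel_measurable (mat_space d K)"
  unfolding loglik_def[abs_def]
  by (intro borel_measurable_sum borel_measurable_ln measurable_ppca_pdf assms
      measurable_mat_space_entry borel_measurable_const)

definition loglik_bound :: "real \<Rightarrow> nat \<Rightarrow> nat \<Rightarrow> (nat \<Rightarrow> nat \<Rightarrow> real) \<Rightarrow> real" where
  "loglik_bound \<sigma>2 d n X = n * (d * \<bar>ln (2 * pi)\<bar> + d * \<bar>ln \<sigma>2\<bar> + d * \<sigma>2) + (\<Sum>m<n. \<Sum>i<d. (X m i)\<^sup>2) / \<sigma>2"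

text \<open>A quadratic envelope in \<open>W\<close>: it gives integrability under each Gaussian
  and, on bounded parameter sets, a common dominating function.\<close>

lemma abs_loglik_le:
  assumes s: "\<sigma>2 > 0"
  shows "\<bar>loglik \<sigma>2 d K n X W\<bar> \<le> loglik_bound \<sigma>2 d n X + real n * real d * (\<Sum>j<K. \<Sum>i<d. (W j i)\<^sup>2)"
proof -
  let ?w = "\<Sum>j<K. \<Sum>i<d. (W j i)\<^sup>2"
  have w: "?w \<ge> 0" by (intro sum_nonneg) auto
  have "\<bar>ln (ppca_pdf \<sigma>2 d K W x)\<bar> \<le> (d * \<bar>ln (2 * pi)\<bar> + d * \<bar>ln \<sigma>2\<bar> + d * \<sigma>2 + (\<Sum>i<d. (x i)\<^sup>2) / \<sigma>2) + d * ?w" for x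
  proof -
    have 1: "ln (ppca_pdf \<sigma>2 d K W x) \<le> - (d * ln (2 * pi) + d * ln \<sigma>2) / 2" by (rule ln_ppca_pdf_le[OF s])
    have 2: "ln (ppca_pdf \<sigma>2 d K W x) \<ge> - ((\<Sum>i<d. (x i)\<^sup>2) / \<sigma>2 + d * ln (2 * pi) + d * (\<sigma>2 + ?w)) / 2"
      by (rule ln_ppca_pdf_ge[OF s])
    have 3: "\<bar>d * ln (2 * pi)\<bar> = d * \<bar>ln (2 * pi)\<bar>" "\<bar>d * ln \<sigma>2\<bar> = d * \<bar>ln \<sigma>2\<bar>" by (auto simp: abs_mult)
    have 4: "(\<Sum>i<d. (x i)\<^sup>2) / \<sigma>2 \<ge> 0" "d * \<sigma>2 \<ge> 0" "d * ?w \<ge> 0"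
      using s w by (auto intro!: divide_nonneg_pos sum_nonneg)
    have gen: "\<bar>L\<bar> \<le> a + b + c + X + ww" if "L \<le> - (p + q) / 2" "L \<ge> - (X + p + (c + ww)) / 2" "\<bar>p\<bar> = a" "\<bar>q\<bar> = b"
      "X \<ge> 0" "c \<ge> 0" "ww \<ge> 0" for L p q a b c X ww :: real
    proof -
      have "p \<le> a" "- p \<le> a" "q \<le> b" "- q \<le> b" "0 \<le> a" "0 \<le> b" using that(3,4) by linarith+
      then show ?thesis using that(1,2,5-7) by argo
    qed
    show ?thesis
      by (rule gen[OF 1 _ 3 4]) (use 2 in \<open>simp add: algebra_simps\<close>)
  qed
  then have "\<bar>loglik \<sigma>2 d K n X W\<bar> \<le> (\<Sum>m<n. (d * \<bar>ln (2 * pi)\<bar> + d * \<bar>ln \<sigma>2\<bar> + d * \<sigma>2 + (\<Sum>i<d. (X m i)\<^sup>2) / \<sigma>2) + d * ?w)"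
    unfolding loglik_def by (intro order_trans[OF sum_abs] sum_mono)
  also have "\<dots> = loglik_bound \<sigma>2 d n X + real n * real d * ?w"
    by (simp add: loglik_bound_def sum.distrib sum_divide_distrib algebra_simps)
  finally show ?thesis .
qed

lemma integrable_mat_map_square:
  assumes "j < K" "i < d"
  shows "integrable (std_mat d K) (\<lambda>Z. (mat_map d K mu A Z j i)\<^sup>2)"
  using std_mat_affine_square[OF assms(1), of d "mu j i" "A j i"]
  by (simp add: mat_map_apply assms has_bochner_integral_iff)

text \<open>A Bochner integral of a non-integrable function is 0 by default; this lemma ensures that
  \<open>elbo_obj\<close> contains the true mean for every member of the family.\<close>

lemma integrable_loglik:
  assumes s: "\<sigma>2 > 0" and A: "lower_tris d K A"
  shows "integrable (vgauss d K mu A) (loglik \<sigma>2 d K n X)"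
proof -
  interpret prob_space "std_mat d K" by (rule prob_space_std_mat)
  let ?b = "\<lambda>Z. loglik_bound \<sigma>2 d n X + real n * real d * (\<Sum>j<K. \<Sum>i<d. (mat_map d K mu A Z j i)\<^sup>2)"
  have "integrable (std_mat d K) (\<lambda>Z. loglik \<sigma>2 d K n X (mat_map d K mu A Z))"
  proof (rule Bochner_Integration.integrable_bound)
    show "integrable (std_mat d K) ?b"
      by (intro Bochner_Integration.integrable_add integrable_mult_right
          Bochner_Integration.integrable_sum integrable_mat_map_square) auto
    show "AE Z in std_mat d K. norm (loglik \<sigma>2 d K n X (mat_map d K mu A Z)) \<le> norm (?b Z)"
      using abs_loglik_le[OF s, of d K n X] by (intro AE_I2) (simp add: order_trans[OF _ abs_ge_self])
    show "(\<lambda>Z. loglik \<sigma>2 d K n X (mat_map d K mu A Z)) \<in> borel_measurable (std_mat d K)"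
      by (rule measurable_compose[OF measurable_mat_map_std measurable_loglik[OF s]])
  qed
  then show ?thesis using integrable_vgauss_iff[OF A measurable_loglik[OF s]] by simp
qed

lemma elbo_obj_vgauss:
  assumes "\<sigma>2 > 0" "s > 0" "lower_tris d K A"
  shows "elbo_obj \<sigma>2 s \<alpha> d K n X (vgauss d K mu A)
    = \<alpha> * (\<integral>Z. loglik \<sigma>2 d K n X (mat_map d K mu A Z) \<partial>std_mat d K) - kl_gauss s d K mu A"
  unfolding elbo_obj_def KL_vgauss[OF assms(3,2)]
  using integral_vgauss[OF assms(3) measurable_loglik[OF assms(1)]] by simp

subsection \<open>Existence of a maximiser of the ELBO\<close>

text \<open>Tychonoff for the product topology on a function type; iterated once per index to reach
  arrays of parameters.\<close>

lemma compact_functions: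
  fixes S :: "'i \<Rightarrow> 'b::topological_space set"
  assumes "\<And>i. compact (S i)"
  shows "compact {f. \<forall>i. f i \<in> S i}"
proof -
  have "compactin (product_topology (\<lambda>i. euclidean) UNIV) (Pi\<^sub>E UNIV S)"
    unfolding compactin_PiE using assms by simp
  moreover have "Pi\<^sub>E UNIV S = {f. \<forall>i. f i \<in> S i}" by (auto simp: PiE_def Pi_def)
  ultimately show ?thesis by (simp add: euclidean_product_topology)
qed

lemma tendsto_function_apply:
  fixes f :: "'c \<Rightarrow> 'i \<Rightarrow> 'b::topological_space"
  assumes "(f \<longlongrightarrow> l) F" shows "((\<lambda>x. f x i) \<longlongrightarrow> l i) F"
  by (rule continuous_on_tendsto_compose[OF continuous_on_product_coordinates assms]) auto

definition elbo_par :: "real \<Rightarrow> real \<Rightarrow> real \<Rightarrow> nat \<Rightarrow> nat \<Rightarrow> nat \<Rightarrow> (nat \<Rightarrow> nat \<Rightarrow> real)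
    \<Rightarrow> (nat \<Rightarrow> nat \<Rightarrow> real) \<Rightarrow> (nat \<Rightarrow> nat \<Rightarrow> nat \<Rightarrow> real) \<Rightarrow> real" where
  "elbo_par \<sigma>2 s \<alpha> d K n X mu A =
    \<alpha> * (\<integral>Z. loglik \<sigma>2 d K n X (mat_map d K mu A Z) \<partial>std_mat d K) - kl_gauss s d K mu A"

definition mu_box :: "real \<Rightarrow> (nat \<Rightarrow> nat \<Rightarrow> real) set" where
  "mu_box B = {mu. \<forall>j. mu j \<in> {m. \<forall>i. m i \<in> {-B..B}}}"

text \<open>The diagonal stays in \<open>{c..B}\<close>, where the logarithm is continuous for
  \<open>c > 0\<close>. Entries without meaning are pinned to 0, since in a type of functions on all
  of \<open>nat\<close> compactness concerns every coordinate.\<close>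

definition entry_range :: "nat \<Rightarrow> nat \<Rightarrow> real \<Rightarrow> real \<Rightarrow> nat \<Rightarrow> nat \<Rightarrow> nat \<Rightarrow> real set" where
  "entry_range d K B c j i k = (if j < K \<and> i < d \<and> k < d
     then if i < k then {0} else if i = k then {c..B} else {-B..B} else {0})"

definition tri_box :: "nat \<Rightarrow> nat \<Rightarrow> real \<Rightarrow> real \<Rightarrow> (nat \<Rightarrow> nat \<Rightarrow> nat \<Rightarrow> real) set" where
  "tri_box d K B c = {A. \<forall>j. A j \<in> {A'. \<forall>i. A' i \<in> {a. \<forall>k. a k \<in> entry_range d K B c j i k}}}"

lemma compact_mu_box: "compact (mu_box B)"
  unfolding mu_box_def by (intro compact_functions) auto

lemma compact_tri_box: "compact (tri_box d K B c)"
  unfolding tri_box_def by (intro compact_functions) (auto simp: entry_range_def)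

lemma mu_boxD: "mu \<in> mu_box B \<Longrightarrow> \<bar>mu j i\<bar> \<le> B"
  unfolding mu_box_def by (auto simp: abs_le_iff) (metis neg_le_iff_le minus_minus)

lemma tri_boxD:
  assumes "A \<in> tri_box d K B c" "c > 0" "j < K" "i < d"
  shows "k < d \<Longrightarrow> \<bar>A j i k\<bar> \<le> B" "A j i i \<ge> c"
proof -
  have A: "A j i k \<in> entry_range d K B c j i k" for k using assms(1) by (auto simp: tri_box_def)
  show "A j i i \<ge> c" using A[of i] assms by (simp add: entry_range_def)
  have B: "c \<le> B" using A[of i] assms by (simp add: entry_range_def)
  assume "k < d"
  then show "\<bar>A j i k\<bar> \<le> B" using A[of k] assms B by (auto simp: entry_range_def split: if_splits)
qed

lemma tri_box_lower_tris:
  assumes "A \<in> tri_box d K B c" "c > 0" shows "lower_tris d K A"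
  unfolding lower_tris_def lower_tri_def
proof (intro allI impI conjI)
  fix j i assume ji: "j < K" "i < d"
  show "0 < A j i i" using tri_boxD(2)[OF assms ji] assms(2) by simp
  fix k assume "k < d" "i < k"
  moreover have "A j i k \<in> entry_range d K B c j i k" using assms(1) by (auto simp: tri_box_def)
  ultimately show "A j i k = 0" using ji by (simp add: entry_range_def)
qed

lemma mat_map_square_le:
  assumes mu: "mu \<in> mu_box B" and A: "A \<in> tri_box d K B c" and c: "c > 0" and ji: "j < K" "i < d"
  shows "(mat_map d K mu A Z j i)\<^sup>2 \<le> 2 * B\<^sup>2 + 2 * (d * B\<^sup>2 * (\<Sum>k<d. (Z j k)\<^sup>2))"
proof -
  have sq: "x\<^sup>2 \<le> B\<^sup>2" if "\<bar>x\<bar> \<le> B" for x using that abs_le_square_iff[of x B] by auto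
  have "(mat_map d K mu A Z j i)\<^sup>2 \<le> 2 * (mu j i)\<^sup>2 + 2 * (\<Sum>k<d. A j i k * Z j k)\<^sup>2"
    unfolding mat_map_apply[OF ji] using sq_add_le[of 1 "mu j i" "\<Sum>k<d. A j i k * Z j k"] by simp
  also have "(\<Sum>k<d. A j i k * Z j k)\<^sup>2 \<le> (\<Sum>k<d. (A j i k)\<^sup>2) * (\<Sum>k<d. (Z j k)\<^sup>2)"
    by (rule Cauchy_Schwarz_ineq_sum)
  also have "(\<Sum>k<d. (A j i k)\<^sup>2) \<le> (\<Sum>k<d. B\<^sup>2)"
    using tri_boxD(1)[OF A c ji] by (intro sum_mono sq) auto
  also have "(mu j i)\<^sup>2 \<le> B\<^sup>2" by (intro sq mu_boxD[OF mu])
  finally show ?thesis by (simp add: mult_right_mono sum_nonneg)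
qed

text \<open>Sequential continuity is enough, because countable products of lines are first
  countable. The likelihood term passes to the limit by dominated convergence under the fixed law
  \<open>std_mat\<close>; the divergence is an explicit formula.\<close>

lemma continuous_elbo_par:
  assumes s2: "\<sigma>2 > 0" and s: "s > 0" and c: "c > 0"
  shows "continuous_on (mu_box B \<times> tri_box d K B c) (\<lambda>(mu, A). elbo_par \<sigma>2 s \<alpha> d K n X mu A)"
proof (rule continuous_on_sequentiallyI)
  fix u :: "nat \<Rightarrow> (nat \<Rightarrow> nat \<Rightarrow> real) \<times> (nat \<Rightarrow> nat \<Rightarrow> nat \<Rightarrow> real)" and a
  assume u: "\<forall>m. u m \<in> mu_box B \<times> tri_box d K B c" and a: "a \<in> mu_box B \<times> tri_box d K B c"
    and lim: "u \<longlonglongrightarrow> a"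
  obtain mu A where aeq: "a = (mu, A)" by (cases a)
  have ubox: "fst (u m) \<in> mu_box B" "snd (u m) \<in> tri_box d K B c" for m
    using u[rule_format, of m] by (auto simp: mem_Times_iff)
  have muA: "mu \<in> mu_box B" "A \<in> tri_box d K B c" using a by (auto simp: aeq)
  have l1: "(\<lambda>m. fst (u m) j i) \<longlonglongrightarrow> mu j i" for j i
    using tendsto_function_apply[OF tendsto_function_apply[OF tendsto_fst[OF lim]], of j i] by (simp add: aeq)
  have l2: "(\<lambda>m. snd (u m) j i k) \<longlonglongrightarrow> A j i k" for j i k
    using tendsto_function_apply[OF tendsto_function_apply[OF tendsto_function_apply[OF tendsto_snd[OF lim]]], of j i k]
    by (simp add: aeq)
  interpret prob_space "std_mat d K" by (rule prob_space_std_mat)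
  \<comment> \<open>The envelope depends on the sequence only through the box, by the bound on
    \<open>mat_map\<close> in terms of \<open>B\<close> and the squares of \<open>Z\<close>.\<close>
  let ?b = "\<lambda>Z. loglik_bound \<sigma>2 d n X + real n * real d *
    (\<Sum>j<K. \<Sum>i<d. 2 * B\<^sup>2 + 2 * (d * B\<^sup>2 * (\<Sum>k<d. (Z j k)\<^sup>2)))"
  have mb: "(\<lambda>Z. loglik \<sigma>2 d K n X (mat_map d K mu' A' Z)) \<in> borel_measurable (std_mat d K)" for mu' A'
    by (rule measurable_compose[OF measurable_mat_map_std measurable_loglik[OF s2]])
  have sqi: "integrable (std_mat d K) (\<lambda>Z. (Z j k)\<^sup>2)" if "j < K" "k < d" for j k
    using std_mat_square[OF that] by (simp add: has_bochner_integral_iff)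
  have "(\<lambda>m. \<integral>Z. loglik \<sigma>2 d K n X (mat_map d K (fst (u m)) (snd (u m)) Z) \<partial>std_mat d K)
     \<longlonglongrightarrow> (\<integral>Z. loglik \<sigma>2 d K n X (mat_map d K mu A Z) \<partial>std_mat d K)"
  proof (rule integral_dominated_convergence[where w = ?b])
    show "integrable (std_mat d K) ?b"
      by (intro Bochner_Integration.integrable_add integrable_mult_right
          Bochner_Integration.integrable_sum integrable_const sqi) auto
    show "AE Z in std_mat d K. (\<lambda>m. loglik \<sigma>2 d K n X (mat_map d K (fst (u m)) (snd (u m)) Z))
      \<longlonglongrightarrow> loglik \<sigma>2 d K n X (mat_map d K mu A Z)"
    proof (intro AE_I2)
      fix Z
      have "(\<lambda>m. mat_map d K (fst (u m)) (snd (u m)) Z j i) \<longlonglongrightarrow> mat_map d K mu A Z j i"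
        if "j < K" "i < d" for j i
        unfolding mat_map_apply[OF that] by (intro tendsto_intros l1 l2)
      then show "(\<lambda>m. loglik \<sigma>2 d K n X (mat_map d K (fst (u m)) (snd (u m)) Z))
        \<longlonglongrightarrow> loglik \<sigma>2 d K n X (mat_map d K mu A Z)"
        unfolding loglik_def using less_imp_neq[OF ppca_pdf_pos[OF s2], symmetric]
        by (intro tendsto_sum tendsto_ln tendsto_ppca_pdf s2) auto
    qed
    fix m
    show "AE Z in std_mat d K. norm (loglik \<sigma>2 d K n X (mat_map d K (fst (u m)) (snd (u m)) Z)) \<le> ?b Z"
    proof (intro AE_I2)
      fix Z
      have "norm (loglik \<sigma>2 d K n X (mat_map d K (fst (u m)) (snd (u m)) Z))
        \<le> loglik_bound \<sigma>2 d n X + real n * real d * (\<Sum>j<K. \<Sum>i<d. (mat_map d K (fst (u m)) (snd (u m)) Z j i)\<^sup>2)"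
        using abs_loglik_le[OF s2] by simp
      also have "\<dots> \<le> ?b Z"
        by (intro add_left_mono mult_left_mono sum_mono mat_map_square_le[OF ubox c]) auto
      finally show "norm (loglik \<sigma>2 d K n X (mat_map d K (fst (u m)) (snd (u m)) Z)) \<le> ?b Z" .
    qed
  qed (rule mb)+
  moreover have "(\<lambda>m. kl_gauss s d K (fst (u m)) (snd (u m))) \<longlonglongrightarrow> kl_gauss s d K mu A"
  proof -
    have pos: "A j i i \<noteq> 0" if "j < K" "i < d" for j i
      using tri_boxD(2)[OF muA(2) c that] c by simp
    show ?thesis
      unfolding kl_gauss_def using s pos
      by (intro tendsto_sum tendsto_add tendsto_diff tendsto_divide tendsto_ln tendsto_power
          tendsto_const l1 l2) auto
  qed
  ultimately show "(\<lambda>m. case u m of (mu, A) \<Rightarrow> elbo_par \<sigma>2 s \<alpha> d K n X mu A)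
     \<longlonglongrightarrow> (case a of (mu, A) \<Rightarrow> elbo_par \<sigma>2 s \<alpha> d K n X mu A)"
    unfolding elbo_par_def aeq case_prod_beta fst_conv snd_conv by (intro tendsto_intros)
qed

section \<open>Coercivity of the divergence\<close>

lemma kl_term_bounds:
  fixes a q s R :: real
  assumes a: "a > 0" and s: "s > 0" and q: "q \<ge> 0"
    and R: "(q + a\<^sup>2) / (2 * s\<^sup>2) - 1 / 2 - ln a + ln s \<le> R"
  shows "q \<le> s\<^sup>2 * (2 * R)" "a\<^sup>2 \<le> s\<^sup>2 * (4 * R + 2)" "s * exp (- R - 1 / 2) \<le> a"
proof -
  \<comment> \<open>In the scale-free variables \<open>t\<close> and \<open>p\<close> the hypothesis
    reads \<open>p + (t - 1 - ln t) \<le> 2 * R\<close>. Three bounds on \<open>ln t\<close> give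
    the three claims: \<open>t - 1\<close> bounds \<open>p\<close>, \<open>t / 2\<close> bounds
    \<open>t\<close> from above, and dropping \<open>p\<close> and \<open>t\<close> bounds
    \<open>ln t\<close> from below.\<close>
  define t where "t = (a / s)\<^sup>2"
  define p where "p = q / s\<^sup>2"
  have t: "t > 0" using a s by (simp add: t_def)
  have p: "p \<ge> 0" using q by (simp add: p_def)
  have lnt: "ln t = 2 * (ln a - ln s)" using a s by (simp add: t_def ln_div ln_realpow)
  have as: "a\<^sup>2 = s\<^sup>2 * t" "q = s\<^sup>2 * p" using s by (auto simp: t_def p_def power_divide)
  have T: "p / 2 + t / 2 - 1 / 2 - ln t / 2 \<le> R"
  proof -
    have "(q + a\<^sup>2) / (2 * s\<^sup>2) = p / 2 + t / 2" using s by (simp add: as field_simps)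
    then show ?thesis using R lnt by argo
  qed
  have 1: "ln t \<le> t - 1" using ln_le_minus_one[OF t] .
  \<comment> \<open>The tangent of the logarithm at 2 has slope 1/2 and leaves half of the linear
    term; the tangent at 1 would cancel all of it.\<close>
  have "ln (t / 2) \<le> t / 2 - 1" using t by (intro ln_le_minus_one) auto
  then have 2: "ln t \<le> t / 2" using t ln_2_less_1 by (simp add: ln_div)
  have "p \<le> 2 * R" using T 1 by simp
  then show "q \<le> s\<^sup>2 * (2 * R)" unfolding as by (intro mult_left_mono) auto
  have "t \<le> 4 * R + 2" using T 2 p by simp
  then show "a\<^sup>2 \<le> s\<^sup>2 * (4 * R + 2)" unfolding as by (intro mult_left_mono) auto
  have "- R - 1 / 2 \<le> ln a - ln s" using T p t lnt by argo
  then have "exp (- R - 1 / 2) \<le> exp (ln a - ln s)" by simp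
  also have "\<dots> = a / s" using a s by (simp add: exp_diff)
  finally show "s * exp (- R - 1 / 2) \<le> a" using s by (simp add: field_simps)
qed

text \<open>Take \<open>R\<close> to be the term itself: then
  \<open>0 \<le> q \<le> 2 * s\<^sup>2 * R\<close> forces \<open>R \<ge> 0\<close>.\<close>

lemma kl_gauss_term_nonneg:
  fixes a q s :: real
  assumes a: "a > 0" and s: "s > 0" and q: "q \<ge> 0"
  shows "(q + a\<^sup>2) / (2 * s\<^sup>2) - 1 / 2 - ln a + ln s \<ge> 0"
  using kl_term_bounds(1)[OF assms order_refl] q s
  by (smt (verit) mult_nonneg_nonneg mult_pos_neg zero_less_power)

text \<open>All entrywise terms are nonnegative, so a bound on their sum bounds each of them, and
  each controls its mean entry, its row of the factor and the diagonal.\<close>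

lemma kl_gauss_coercive:
  assumes A: "lower_tris d K A" and s: "s > 0" and R: "kl_gauss s d K mu A \<le> R"
    and ji: "j < K" "i < d"
  shows "(mu j i)\<^sup>2 \<le> s\<^sup>2 * (4 * R + 2)" "k < d \<Longrightarrow> (A j i k)\<^sup>2 \<le> s\<^sup>2 * (4 * R + 2)"
    "s * exp (- R - 1 / 2) \<le> A j i i"
proof -
  \<comment> \<open>The mean and the off-diagonal entries are collected in \<open>q\<close>; the
    diagonal entry stays apart, as it alone also occurs under the logarithm.\<close>
  define q where "q j i = (mu j i)\<^sup>2 + (\<Sum>k\<in>{..<d} - {i}. (A j i k)\<^sup>2)" for j i
  define T where "T j i = (q j i + (A j i i)\<^sup>2) / (2 * s\<^sup>2) - 1 / 2 - ln (A j i i) + ln s" for j i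
  have q0: "q j i \<ge> 0" for j i unfolding q_def by (intro add_nonneg_nonneg sum_nonneg) auto
  have pos: "A j i i > 0" if "j < K" "i < d" for j i
    using A that by (auto simp: lower_tris_def lower_tri_def)
  have T0: "T j i \<ge> 0" if "j < K" "i < d" for j i
    unfolding T_def by (rule kl_gauss_term_nonneg[OF pos[OF that] s q0])
  have kl: "kl_gauss s d K mu A = (\<Sum>j<K. \<Sum>i<d. T j i)"
    unfolding kl_gauss_def T_def q_def
    by (intro sum.cong refl) (simp add: sum.remove[of "{..<d}"] add_ac)
  have "T j i \<le> (\<Sum>i<d. T j i)" using ji T0 by (intro member_le_sum) auto
  also have "\<dots> \<le> (\<Sum>j<K. \<Sum>i<d. T j i)" using ji T0 by (intro member_le_sum sum_nonneg) auto
  finally have TR: "T j i \<le> R" using R kl by simp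
  note b = kl_term_bounds[OF pos[OF ji] s q0 TR[unfolded T_def]]
  have R0: "0 \<le> R" using TR T0[OF ji] by simp
  have qb: "q j i \<le> s\<^sup>2 * (4 * R + 2)"
    using R0 by (intro order_trans[OF b(1)] mult_left_mono) auto
  show "s * exp (- R - 1 / 2) \<le> A j i i" by (rule b(3))
  show "(mu j i)\<^sup>2 \<le> s\<^sup>2 * (4 * R + 2)"
    using qb unfolding q_def by (smt (verit) sum_nonneg zero_le_power2)
  assume k: "k < d"
  show "(A j i k)\<^sup>2 \<le> s\<^sup>2 * (4 * R + 2)"
  proof (cases "k = i")
    case True then show ?thesis using b(2) by simp
  next
    case False
    then have "(A j i k)\<^sup>2 \<le> (\<Sum>k\<in>{..<d} - {i}. (A j i k)\<^sup>2)" using k by (intro member_le_sum) auto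
    also have "\<dots> \<le> q j i" unfolding q_def by simp
    finally show ?thesis using qb by simp
  qed
qed

text \<open>The bound is free of the parameters, so a large divergence cannot be compensated by the
  likelihood.\<close>

lemma integral_loglik_le:
  assumes "\<sigma>2 > 0"  "lower_tris d K A"
  shows "(\<integral>Z. loglik \<sigma>2 d K n X (mat_map d K mu A Z) \<partial>std_mat d K)
    \<le> n * (- (d * ln (2 * pi) + d * ln \<sigma>2) / 2)"
proof -
  interpret prob_space "std_mat d K" by (rule prob_space_std_mat)
  have "loglik \<sigma>2 d K n X W \<le> n * (- (d * ln (2 * pi) + d * ln \<sigma>2) / 2)" for W
  proof -
    have "loglik \<sigma>2 d K n X W \<le> (\<Sum>m<n. - (d * ln (2 * pi) + d * ln \<sigma>2) / 2)"
      unfolding loglik_def by (intro sum_mono ln_ppca_pdf_le assms)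
    then show ?thesis by simp
  qed
  moreover have "integrable (std_mat d K) (\<lambda>Z. loglik \<sigma>2 d K n X (mat_map d K mu A Z))"
    using integrable_loglik[OF assms] integrable_vgauss_iff[OF assms(2) measurable_loglik[OF assms(1)]] by blast
  ultimately show ?thesis by (intro integral_le_const AE_I2)
qed

lemma elbo_maximiser_exists:
  assumes s2: "\<sigma>2 > 0" and s: "s > 0" and \<alpha>: "\<alpha> > 0"
  shows "\<exists>\<rho>\<in>var_family d K. \<forall>\<rho>'\<in>var_family d K.
    elbo_obj \<sigma>2 s \<alpha> d K n X \<rho>' \<le> elbo_obj \<sigma>2 s \<alpha> d K n X \<rho>"
proof -
  let ?J = "elbo_par \<sigma>2 s \<alpha> d K n X"
  define m0 :: "nat \<Rightarrow> nat \<Rightarrow> real" where "m0 = (\<lambda>_ _. 0)"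
  define A0 :: "nat \<Rightarrow> nat \<Rightarrow> nat \<Rightarrow> real" where "A0 = (\<lambda>_ i k. if i = k then 1 else 0)"
  have A0: "lower_tris d K A0" by (simp add: A0_def lower_tris_def lower_tri_id)
  \<comment> \<open>A competitor at least as good as the reference \<open>(m0, A0)\<close> has
    divergence at most \<open>R\<close>: the uniform bound on its likelihood term minus the
    reference value.\<close>
  define R where "R = \<alpha> * (n * (- (d * ln (2 * pi) + d * ln \<sigma>2) / 2)) - ?J m0 A0"
  \<comment> \<open>The absolute value makes \<open>B\<close> nonnegative without knowing the sign
    of \<open>4 * R + 2\<close>; the padding zeros need this to lie in the box.\<close>
  define B where "B = s * \<bar>sqrt (4 * R + 2)\<bar>"
  define c where "c = s * exp (- R - 1 / 2)"
  have c: "c > 0" using s by (simp add: c_def)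
  have inbox: "\<exists>mu' A'. mu' \<in> mu_box B \<and> A' \<in> tri_box d K B c \<and> ?J mu' A' = ?J mu A"
    if A: "lower_tris d K A" and J: "?J mu A \<ge> ?J m0 A0" for mu A
  proof -
    have kl: "kl_gauss s d K mu A \<le> R"
      using J mult_left_mono[OF integral_loglik_le[OF s2 A, of n X mu] less_imp_le[OF \<alpha>]]
      unfolding R_def elbo_par_def[of _ _ _ _ _ _ _ mu A] by linarith
    note co = kl_gauss_coercive[OF A s kl]
    have le_B: "\<bar>x\<bar> \<le> B" if "x\<^sup>2 \<le> s\<^sup>2 * (4 * R + 2)" for x
    proof -
      have "\<bar>x\<bar> = sqrt (x\<^sup>2)" by simp
      also have "\<dots> \<le> sqrt (s\<^sup>2 * (4 * R + 2))" using that by (rule real_sqrt_le_mono)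
      also have "\<dots> \<le> B" using s by (simp add: B_def real_sqrt_mult)
      finally show ?thesis .
    qed
    \<comment> \<open>Entries outside the index range do not affect the objective; setting them to 0
      moves the parameters into the box.\<close>
    define mu' where "mu' = (\<lambda>j i. if j < K \<and> i < d then mu j i else 0)"
    define A' where "A' = (\<lambda>j i k. if j < K \<and> i < d \<and> k < d then A j i k else 0)"
    have "\<bar>mu' j i\<bar> \<le> B" for j i
      using le_B[OF co(1)] s by (auto simp: mu'_def B_def)
    then have "mu' \<in> mu_box B" by (simp add: mu_box_def abs_le_iff minus_le_iff)
    moreover have "A' \<in> tri_box d K B c"
    proof -
      have "A j i k \<in> entry_range d K B c j i k" if "j < K" "i < d" "k < d" for j i k
        using le_B[OF co(2)[OF that]] co(3)[OF that(1,2)] A that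
        by (auto simp: entry_range_def c_def lower_tris_def lower_tri_def abs_le_iff)
      moreover have "0 \<in> entry_range d K B c j i k" if "\<not> (j < K \<and> i < d \<and> k < d)" for j i k
        using that by (auto simp: entry_range_def)
      ultimately show ?thesis unfolding tri_box_def A'_def by auto
    qed
    moreover have "?J mu' A' = ?J mu A"
    proof -
      have "mat_map d K mu' A' Z = mat_map d K mu A Z" for Z
        by (auto simp: mat_map_def aff_map_def mu'_def A'_def restrict_def fun_eq_iff)
      moreover have "kl_gauss s d K mu' A' = kl_gauss s d K mu A"
        unfolding kl_gauss_def mu'_def A'_def by (intro sum.cong) auto
      ultimately show ?thesis by (simp add: elbo_par_def)
    qed
    ultimately show ?thesis by blast
  qed
  obtain m1 A1 where ref: "m1 \<in> mu_box B" "A1 \<in> tri_box d K B c" "?J m1 A1 = ?J m0 A0"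
    using inbox[OF A0 order_refl] by blast
  have "\<exists>p\<in>mu_box B \<times> tri_box d K B c. \<forall>q\<in>mu_box B \<times> tri_box d K B c.
     (case q of (mu, A) \<Rightarrow> ?J mu A) \<le> (case p of (mu, A) \<Rightarrow> ?J mu A)"
    using ref by (intro continuous_attains_sup compact_Times compact_mu_box compact_tri_box
        continuous_elbo_par s2 s c) auto
  then obtain mu A where opt: "mu \<in> mu_box B" "A \<in> tri_box d K B c"
    "\<And>mu' A'. mu' \<in> mu_box B \<Longrightarrow> A' \<in> tri_box d K B c \<Longrightarrow> ?J mu' A' \<le> ?J mu A"
    by force
  have A: "lower_tris d K A" by (rule tri_box_lower_tris[OF opt(2) c])
  have best: "?J mu' A' \<le> ?J mu A" if A': "lower_tris d K A'" for mu' A'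
  \<comment> \<open>A competitor above the reference value has an equivalent in the box; one below
    it loses to the reference, which has an equivalent there too.\<close>
  proof (cases "?J mu' A' \<ge> ?J m0 A0")
    case True
    then show ?thesis using inbox[OF A' True] opt(3) by metis
  next
    case False
    then show ?thesis using opt(3)[OF ref(1,2)] ref(3) by simp
  qed
  have J: "elbo_obj \<sigma>2 s \<alpha> d K n X (vgauss d K m A) = ?J m A" if "lower_tris d K A" for m A
    using elbo_obj_vgauss[OF s2 s that] by (simp add: elbo_par_def)
  show ?thesis
  proof (rule bexI[of _ "vgauss d K mu A"])
    show "vgauss d K mu A \<in> var_family d K" using A by (auto simp: var_family_eq)
    show "\<forall>\<rho>'\<in>var_family d K. elbo_obj \<sigma>2 s \<alpha> d K n X \<rho>' \<le> elbo_obj \<sigma>2 s \<alpha> d K n X (vgauss d K mu A)"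
      using best J A by (auto simp: var_family_eq)
  qed
qed

subsection \<open>Renyi divergence and exponential moments\<close>

text \<open>For positive densities the Radon-Nikodym derivative is \<open>p / q\<close>, and
  \<open>p * (p / q) powr (\<alpha> - 1)\<close> is the integrand of the Hellinger integral of order
  \<alpha>. Keeping it as an \<open>nn_integral\<close> avoids integrability questions.\<close>

lemma renyi_div_density:
  fixes p q :: "'a \<Rightarrow> real"
  assumes p[measurable]: "p \<in> borel_measurable M" and q[measurable]: "q \<in> borel_measurable M"
    and pos: "\<And>x. p x > 0" "\<And>x. q x > 0"
    and Q: "prob_space (density M q)"
  shows "renyi_div \<alpha> (density M p) (density M q)
    = ereal (1 / (\<alpha> - 1) * ln (enn2real (\<integral>\<^sup>+x. ennreal (p x powr \<alpha> * q x powr (1 - \<alpha>)) \<partial>M)))"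
proof -
  interpret Q: prob_space "density M q" by (rule Q)
  have dens: "density (density M q) (\<lambda>x. ennreal (p x / q x)) = density M p"
  proof (rule density_density_divide[OF q _ p])
    show "AE x in M. 0 \<le> q x" "AE x in M. 0 \<le> p x"
      by (intro AE_I2 less_imp_le pos)+
    show "AE x in M. q x = 0 \<longrightarrow> p x = 0"
      using less_imp_neq[OF pos(2)] by (intro AE_I2) metis
  qed
  have m: "(\<lambda>x. ennreal (p x / q x)) \<in> borel_measurable (density M q)" by simp
  have ac: "absolutely_continuous (density M q) (density M p)"
    unfolding dens[symmetric] by (rule absolutely_continuousI_density[OF m])
  have "AE x in density M q. ennreal (p x / q x) = RN_deriv (density M q) (density M p) x"
    by (rule Q.RN_deriv_unique[OF m dens])
  \<comment> \<open>Uniqueness holds up to null sets of \<open>q\<close>; since \<open>q\<close> is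
    positive these are the null sets of \<open>M\<close>, from where the statement passes to
    \<open>p\<close>.\<close>
  then have "AE x in M. ennreal (p x / q x) = RN_deriv (density M q) (density M p) x"
    using pos by (subst (asm) AE_density) auto
  then have rn: "AE x in density M p. RN_deriv (density M q) (density M p) x = ennreal (p x / q x)"
    by (subst AE_density) (auto elim: eventually_mono)
  have "(\<integral>x. (enn2real (RN_deriv (density M q) (density M p) x)) powr (\<alpha> - 1) \<partial>density M p)
      = (\<integral>x. (p x / q x) powr (\<alpha> - 1) \<partial>density M p)"
  proof (rule integral_cong_AE)
    show "AE x in density M p. enn2real (RN_deriv (density M q) (density M p) x) powr (\<alpha> - 1)
      = (p x / q x) powr (\<alpha> - 1)"
      using rn by eventually_elim (simp add: less_imp_le[OF pos(1)] less_imp_le[OF pos(2)])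
    have "RN_deriv (density M q) (density M p) \<in> borel_measurable (density M q)" by simp
    then have [measurable]: "RN_deriv (density M q) (density M p) \<in> borel_measurable M" by simp
    show "(\<lambda>x. enn2real (RN_deriv (density M q) (density M p) x) powr (\<alpha> - 1)) \<in> borel_measurable (density M p)"
      by simp
  qed simp
  also have "\<dots> = enn2real (\<integral>\<^sup>+x. ennreal ((p x / q x) powr (\<alpha> - 1)) \<partial>density M p)"
    by (rule integral_eq_nn_integral) auto
  also have "(\<integral>\<^sup>+x. ennreal ((p x / q x) powr (\<alpha> - 1)) \<partial>density M p)
     = (\<integral>\<^sup>+x. ennreal (p x) * ennreal ((p x / q x) powr (\<alpha> - 1)) \<partial>M)"
    by (rule nn_integral_density) auto
  also have "\<dots> = (\<integral>\<^sup>+x. ennreal (p x powr \<alpha> * q x powr (1 - \<alpha>)) \<partial>M)"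
  proof (rule nn_integral_cong)
    fix x
    have "p x * (p x / q x) powr (\<alpha> - 1) = p x powr \<alpha> * q x powr (1 - \<alpha>)"
    proof -
      have "p x * (p x / q x) powr (\<alpha> - 1) = exp (ln (p x)) * exp ((\<alpha> - 1) * (ln (p x) - ln (q x)))"
        using pos[of x] by (simp add: powr_def ln_divide_pos)
      also have "\<dots> = exp (\<alpha> * ln (p x) + (1 - \<alpha>) * ln (q x))"
        by (simp add: exp_add[symmetric] algebra_simps)
      finally show ?thesis using pos[of x] by (simp add: powr_def exp_add)
    qed
    then show "ennreal (p x) * ennreal ((p x / q x) powr (\<alpha> - 1)) = ennreal (p x powr \<alpha> * q x powr (1 - \<alpha>))"
      using pos(1)[of x] by (simp add: ennreal_mult[symmetric])
  qed
  finally show ?thesis unfolding renyi_div_def using ac by simp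
qed

text \<open>Pointwise weighted arithmetic-geometric mean, integrated against two probability
  densities.\<close>

lemma hellinger_le_1:
  fixes p q :: "'a \<Rightarrow> real"
  assumes p[measurable]: "p \<in> borel_measurable M" and q[measurable]: "q \<in> borel_measurable M"
    and pos: "\<And>x. p x > 0" "\<And>x. q x > 0" and \<alpha>: "0 < \<alpha>" "\<alpha> < 1"
    and P: "prob_space (density M p)" and Q: "prob_space (density M q)"
  shows "(\<integral>\<^sup>+x. ennreal (p x powr \<alpha> * q x powr (1 - \<alpha>)) \<partial>M) \<le> 1"
proof -
  have one: "(\<integral>\<^sup>+x. ennreal (f x) \<partial>M) = 1" if "prob_space (density M f)" and [measurable]: "f \<in> borel_measurable M" for f :: "'a \<Rightarrow> real"
    using prob_space.emeasure_space_1[OF that(1)]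
    by (simp add: emeasure_density cong: nn_integral_cong)
  have "(\<integral>\<^sup>+x. ennreal (p x powr \<alpha> * q x powr (1 - \<alpha>)) \<partial>M)
     \<le> (\<integral>\<^sup>+x. ennreal \<alpha> * ennreal (p x) + ennreal (1 - \<alpha>) * ennreal (q x) \<partial>M)"
  proof (rule nn_integral_mono)
    fix x
    have "p x powr \<alpha> * q x powr (1 - \<alpha>) \<le> \<alpha> * p x + (1 - \<alpha>) * q x"
      using \<alpha> pos by (intro Youngs_inequality_0) auto
    then show "ennreal (p x powr \<alpha> * q x powr (1 - \<alpha>)) \<le> ennreal \<alpha> * ennreal (p x) + ennreal (1 - \<alpha>) * ennreal (q x)"
      using \<alpha> less_imp_le[OF pos(1)[of x]] less_imp_le[OF pos(2)[of x]]
      by (simp add: ennreal_mult[symmetric] ennreal_plus[symmetric] del: ennreal_plus)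
  qed
  also have "\<dots> = ennreal \<alpha> + ennreal (1 - \<alpha>)"
    by (subst nn_integral_add) (auto simp: nn_integral_cmult one P Q)
  also have "\<dots> = 1" using \<alpha> by (simp add: ennreal_plus[symmetric] del: ennreal_plus)
  finally show ?thesis .
qed

text \<open>A signed integrable part and a nonnegative part of possibly infinite integral are
  combined; in the infinite case the bound is trivial, otherwise everything is integrable.\<close>

lemma nn_integral_le_integral_add:
  fixes u v w :: "'a \<Rightarrow> real"
  assumes v: "integrable M v" and w[measurable]: "w \<in> borel_measurable M"
    and w0: "\<And>x. w x \<ge> 0" and u0: "\<And>x. u x \<ge> 0" and le: "\<And>x. u x \<le> v x + w x"
    and V: "integral\<^sup>L M v \<le> V" "0 \<le> V"
  shows "(\<integral>\<^sup>+x. ennreal (u x) \<partial>M) \<le> ennreal V + (\<integral>\<^sup>+x. ennreal (w x) \<partial>M)"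
proof (cases "(\<integral>\<^sup>+x. ennreal (w x) \<partial>M) = \<infinity>")
  case False
  then have wi: "integrable M w"
    using w0 by (intro integrableI_nonneg) (auto simp: top.not_eq_extremum)
  have "(\<integral>\<^sup>+x. ennreal (u x) \<partial>M) \<le> (\<integral>\<^sup>+x. ennreal (v x + w x) \<partial>M)"
    using le by (intro nn_integral_mono ennreal_leI)
  also have "\<dots> = ennreal (\<integral>x. v x + w x \<partial>M)"
    using order_trans[OF u0 le] v wi by (intro nn_integral_eq_integral) auto
  also have "\<dots> = ennreal (integral\<^sup>L M v + integral\<^sup>L M w)" using v wi by simp
  also have "\<dots> \<le> ennreal (V + integral\<^sup>L M w)" using V by (intro ennreal_leI) auto
  also have "\<dots> = ennreal V + ennreal (integral\<^sup>L M w)" using V w0 by (intro ennreal_plus) auto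
  also have "ennreal (integral\<^sup>L M w) = (\<integral>\<^sup>+x. ennreal (w x) \<partial>M)"
    using wi w0 by (intro nn_integral_eq_integral[symmetric]) auto
  finally show ?thesis .
qed simp

section \<open>Hellinger integral and Renyi divergence of PPCA laws\<close>

definition hellinger :: "real \<Rightarrow> real \<Rightarrow> nat \<Rightarrow> nat \<Rightarrow> (nat \<Rightarrow> nat \<Rightarrow> real) \<Rightarrow> nat \<Rightarrow> (nat \<Rightarrow> nat \<Rightarrow> real) \<Rightarrow> ennreal" where
  "hellinger \<sigma>2 \<alpha> d K W K0 W0 =
     (\<integral>\<^sup>+x. ennreal (ppca_pdf \<sigma>2 d K W x powr \<alpha> * ppca_pdf \<sigma>2 d K0 W0 x powr (1 - \<alpha>)) \<partial>lborel_d d)"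

lemma P_W_density: "P_W \<sigma>2 d K W = density (lborel_d d) (\<lambda>x. ennreal (ppca_pdf \<sigma>2 d K W x))"
  by (simp add: P_W_def gauss_measure_def ppca_pdf_def)

lemma prob_space_P_W: "\<sigma>2 > 0 \<Longrightarrow> prob_space (P_W \<sigma>2 d K W)"
  unfolding P_W_def by (intro prob_space_gauss_measure pos_def_ppca_cov)

lemma measurable_ppca_pdf_vec[measurable]: "ppca_pdf \<sigma>2 d K W \<in> borel_measurable (lborel_d d)"
  unfolding ppca_pdf_def by simp

lemma sets_P_W: "sets (P_W \<sigma>2 d K W) = sets (lborel_d d)"
  by (simp add: P_W_density)

lemma hellinger_ppca_le_1:
  assumes "\<sigma>2 > 0" "0 < \<alpha>" "\<alpha> < 1" shows "hellinger \<sigma>2 \<alpha> d K W K0 W0 \<le> 1"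
  unfolding hellinger_def using assms prob_space_P_W[OF assms(1)]
  by (intro hellinger_le_1) (auto simp: P_W_density ppca_pdf_pos)

lemma renyi_div_P_W:
  assumes "\<sigma>2 > 0"
  shows "renyi_div \<alpha> (P_W \<sigma>2 d K W) (P_W \<sigma>2 d K0 W0)
    = ereal (1 / (1 - \<alpha>) * (- ln (enn2real (hellinger \<sigma>2 \<alpha> d K W K0 W0))))"
proof -
  have "1 / (\<alpha> - 1) * x = 1 / (1 - \<alpha>) * - x" for x :: real
    using minus_divide_right[of x "1 - \<alpha>"] by simp
  moreover have "renyi_div \<alpha> (P_W \<sigma>2 d K W) (P_W \<sigma>2 d K0 W0)
    = ereal (1 / (\<alpha> - 1) * (ln (enn2real (hellinger \<sigma>2 \<alpha> d K W K0 W0))))"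
    unfolding P_W_density hellinger_def using assms prob_space_P_W[OF assms]
    by (intro renyi_div_density) (auto simp: P_W_density ppca_pdf_pos)
  ultimately show ?thesis by simp
qed

text \<open>This is \<open>(1 - \<alpha>)\<close> times the Renyi divergence as a real number. It
  shares with \<open>renyi_div\<close> the convention \<open>ln 0 = 0\<close>, so the identity
  between them also covers a vanishing integral.\<close>

definition neg_ln_hellinger :: "real \<Rightarrow> real \<Rightarrow> nat \<Rightarrow> nat \<Rightarrow> (nat \<Rightarrow> nat \<Rightarrow> real) \<Rightarrow> nat \<Rightarrow> (nat \<Rightarrow> nat \<Rightarrow> real) \<Rightarrow> real" where
  "neg_ln_hellinger \<sigma>2 \<alpha> d K0 W0 K W = - ln (enn2real (hellinger \<sigma>2 \<alpha> d K W K0 W0))"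

lemma neg_ln_hellinger_nonneg:
  assumes "\<sigma>2 > 0" "0 < \<alpha>" "\<alpha> < 1" shows "neg_ln_hellinger \<sigma>2 \<alpha> d K0 W0 K W \<ge> 0"
proof -
  have "enn2real (hellinger \<sigma>2 \<alpha> d K W K0 W0) \<le> 1"
    using hellinger_ppca_le_1[OF assms, of d K W K0 W0] by (intro enn2real_leI) auto
  then show ?thesis
    unfolding neg_ln_hellinger_def
    using enn2real_nonneg[of "hellinger \<sigma>2 \<alpha> d K W K0 W0"]
    by (cases "enn2real (hellinger \<sigma>2 \<alpha> d K W K0 W0) = 0") (simp_all add: ln_le_zero_iff order_le_less)
qed

lemma measurable_hellinger:
  assumes "\<sigma>2 > 0"
  shows "(\<lambda>W. hellinger \<sigma>2 \<alpha> d K W K0 W0) \<in> borel_measurable (mat_space d K)"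
proof -
  interpret sigma_finite_measure "lborel_d d" by (rule sigma_finite_lborel_d)
  have [measurable]: "(\<lambda>\<omega>. ppca_pdf \<sigma>2 d K (fst \<omega>) (snd \<omega>)) \<in> borel_measurable (mat_space d K \<Otimes>\<^sub>M lborel_d d)"
    by (intro measurable_ppca_pdf assms measurable_compose[OF measurable_fst measurable_mat_space_entry]
        measurable_compose[OF measurable_snd measurable_lborel_d_component])
  have "(\<lambda>(W, x). ennreal (ppca_pdf \<sigma>2 d K W x powr \<alpha> * ppca_pdf \<sigma>2 d K0 W0 x powr (1 - \<alpha>)))
    \<in> borel_measurable (mat_space d K \<Otimes>\<^sub>M lborel_d d)"
    unfolding case_prod_beta by measurable
  then show ?thesis unfolding hellinger_def by (rule borel_measurable_nn_integral)
qed

lemma measurable_neg_ln_hellinger: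
  assumes "\<sigma>2 > 0" shows "neg_ln_hellinger \<sigma>2 \<alpha> d K0 W0 K \<in> borel_measurable (mat_space d K)"
  unfolding neg_ln_hellinger_def[abs_def]
  by (intro borel_measurable_uminus borel_measurable_ln borel_measurable_enn2real measurable_hellinger assms)

definition exp_dev :: "real \<Rightarrow> real \<Rightarrow> nat \<Rightarrow> nat \<Rightarrow> (nat \<Rightarrow> nat \<Rightarrow> real) \<Rightarrow> nat \<Rightarrow> nat \<Rightarrow> (nat \<Rightarrow> nat \<Rightarrow> real) \<Rightarrow> (nat \<Rightarrow> nat \<Rightarrow> real) \<Rightarrow> real" where
  "exp_dev \<sigma>2 \<alpha> d K0 W0 n K X W = - \<alpha> * (loglik \<sigma>2 d K0 n X W0 - loglik \<sigma>2 d K n X W)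
     + n * neg_ln_hellinger \<sigma>2 \<alpha> d K0 W0 K W"

lemma sets_prior_K[measurable_cong]: "sets (prior_K s d K) = sets (mat_space d K)"
  by (simp add: prior_K_eq_vgauss)

lemma prob_space_prior_K: "s > 0 \<Longrightarrow> prob_space (prior_K s d K)"
  unfolding prior_K_eq_vgauss by (intro prob_space_vgauss) (simp add: lower_tris_def lower_tri_id)

abbreviation sample :: "real \<Rightarrow> nat \<Rightarrow> nat \<Rightarrow> (nat \<Rightarrow> nat \<Rightarrow> real) \<Rightarrow> nat \<Rightarrow> (nat \<Rightarrow> nat \<Rightarrow> real) measure" where
  "sample \<sigma>2 d K0 W0 n \<equiv> PiM {..<n} (\<lambda>_. P_W \<sigma>2 d K0 W0)"

lemma measurable_sample_entry:
  assumes "m < n" "i < d"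
  shows "(\<lambda>X. X m i) \<in> borel_measurable (sample \<sigma>2 d K0 W0 n)"
proof -
  have "(\<lambda>X. X m) \<in> measurable (sample \<sigma>2 d K0 W0 n) (P_W \<sigma>2 d K0 W0)"
    using assms by (intro measurable_component_singleton) auto
  then have "(\<lambda>X. X m) \<in> measurable (sample \<sigma>2 d K0 W0 n) (lborel_d d)"
    by (simp add: sets_P_W cong: measurable_cong_sets)
  from measurable_compose[OF this measurable_lborel_d_component[OF assms(2)]] show ?thesis .
qed

text \<open>Joint measurability in sample and parameter, for exchanging the prior and the sample
  integral.\<close>

lemma measurable_exp_dev:
  assumes s2: "\<sigma>2 > 0"
  shows "(\<lambda>(X, W). exp_dev \<sigma>2 \<alpha> d K0 W0 n K X W) \<in> borel_measurable (sample \<sigma>2 d K0 W0 n \<Otimes>\<^sub>M prior_K s d K)"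
proof -
  let ?N = "sample \<sigma>2 d K0 W0 n \<Otimes>\<^sub>M prior_K s d K"
  have X: "(\<lambda>\<omega>. fst \<omega> m i) \<in> borel_measurable ?N" if "m < n" "i < d" for m i
    by (rule measurable_compose[OF measurable_fst measurable_sample_entry[OF that]])
  have snd: "snd \<in> measurable ?N (mat_space d K)"
    using measurable_snd[of "sample \<sigma>2 d K0 W0 n" "prior_K s d K"]
    by (simp add: measurable_cong_sets[OF refl sets_prior_K])
  have W: "(\<lambda>\<omega>. snd \<omega> j i) \<in> borel_measurable ?N" if "j < K" "i < d" for j i
    by (rule measurable_compose[OF snd measurable_mat_space_entry[OF that]])
  have l1: "(\<lambda>\<omega>. loglik \<sigma>2 d K0 n (fst \<omega>) W0) \<in> borel_measurable ?N"
    unfolding loglik_def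
    by (intro borel_measurable_sum borel_measurable_ln measurable_ppca_pdf s2 X borel_measurable_const) auto
  have l2: "(\<lambda>\<omega>. loglik \<sigma>2 d K n (fst \<omega>) (snd \<omega>)) \<in> borel_measurable ?N"
    unfolding loglik_def
    by (intro borel_measurable_sum borel_measurable_ln measurable_ppca_pdf s2 X W) auto
  have l3: "(\<lambda>\<omega>. neg_ln_hellinger \<sigma>2 \<alpha> d K0 W0 K (snd \<omega>)) \<in> borel_measurable ?N"
    by (rule measurable_compose[OF snd measurable_neg_ln_hellinger[OF s2]])
  show ?thesis
    unfolding exp_dev_def case_prod_beta
    by (intro borel_measurable_add borel_measurable_times borel_measurable_diff borel_measurable_const l1 l2 l3)
qed

text \<open>Independence turns the mean of the tempered likelihood ratio into the
  \<open>n\<close>-th power of the Hellinger integral, and \<open>exp (n * ?D)\<close> is its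
  reciprocal.\<close>

lemma nn_integral_exp_dev_sample:
  assumes s2: "\<sigma>2 > 0" and \<alpha>: "0 < \<alpha>" "\<alpha> < 1"
  shows "(\<integral>\<^sup>+X. ennreal (exp (exp_dev \<sigma>2 \<alpha> d K0 W0 n K X W)) \<partial>sample \<sigma>2 d K0 W0 n) \<le> 1"
proof -
  let ?p = "ppca_pdf \<sigma>2 d K W" and ?q = "ppca_pdf \<sigma>2 d K0 W0" and ?H = "hellinger \<sigma>2 \<alpha> d K W K0 W0"
  let ?D = "neg_ln_hellinger \<sigma>2 \<alpha> d K0 W0 K W"
  interpret P: prob_space "P_W \<sigma>2 d K0 W0" by (rule prob_space_P_W[OF s2])
  interpret product_sigma_finite "\<lambda>_::nat. P_W \<sigma>2 d K0 W0" by standard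
  define f where "f x = exp (\<alpha> * (ln (?p x) - ln (?q x)))" for x
  have [measurable]: "f \<in> borel_measurable (lborel_d d)" unfolding f_def by measurable
  have fm: "(\<lambda>x. ennreal (f x)) \<in> borel_measurable (P_W \<sigma>2 d K0 W0)"
    by (simp add: measurable_cong_sets[OF sets_P_W refl])
  have e: "exp (exp_dev \<sigma>2 \<alpha> d K0 W0 n K X W) = exp (n * ?D) * (\<Prod>m<n. f (X m))" for X
    unfolding exp_dev_def loglik_def f_def
    by (simp add: exp_sum[symmetric] exp_add[symmetric] sum_subtractf sum_distrib_left[symmetric] algebra_simps)
  have "(\<integral>\<^sup>+x. ennreal (f x) \<partial>P_W \<sigma>2 d K0 W0) = (\<integral>\<^sup>+x. ennreal (?q x) * ennreal (f x) \<partial>lborel_d d)"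
    unfolding P_W_density by (rule nn_integral_density) auto
  also have "\<dots> = ?H"
    unfolding hellinger_def
  proof (rule nn_integral_cong)
    fix x
    have pos: "?p x > 0" "?q x > 0" using s2 by (auto intro: ppca_pdf_pos)
    have "?q x * f x = exp (ln (?q x)) * f x" using pos by simp
    also have "\<dots> = exp (\<alpha> * ln (?p x) + (1 - \<alpha>) * ln (?q x))"
      unfolding f_def by (simp add: exp_add[symmetric] algebra_simps)
    also have "\<dots> = ?p x powr \<alpha> * ?q x powr (1 - \<alpha>)" using pos by (simp add: powr_def exp_add)
    finally show "ennreal (?q x) * ennreal (f x) = ennreal (?p x powr \<alpha> * ?q x powr (1 - \<alpha>))"
      using pos by (simp add: ennreal_mult[symmetric] f_def)
  qed
  finally have H: "(\<integral>\<^sup>+x. ennreal (f x) \<partial>P_W \<sigma>2 d K0 W0) = ?H" .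
  have f0: "f x \<ge> 0" for x by (simp add: f_def)
  have "(\<integral>\<^sup>+X. ennreal (exp (exp_dev \<sigma>2 \<alpha> d K0 W0 n K X W)) \<partial>sample \<sigma>2 d K0 W0 n)
     = (\<integral>\<^sup>+X. ennreal (exp (n * ?D)) * (\<Prod>m<n. ennreal (f (X m))) \<partial>sample \<sigma>2 d K0 W0 n)"
    unfolding e using f0 by (intro nn_integral_cong) (simp add: ennreal_mult prod_nonneg prod_ennreal)
  also have "\<dots> = ennreal (exp (n * ?D)) * (\<integral>\<^sup>+X. (\<Prod>m<n. ennreal (f (X m))) \<partial>sample \<sigma>2 d K0 W0 n)"
    by (intro nn_integral_cmult borel_measurable_prod_ennreal, rule measurable_compose[OF _ fm])
      (auto intro: measurable_component_singleton)
  also have "(\<integral>\<^sup>+X. (\<Prod>m<n. ennreal (f (X m))) \<partial>sample \<sigma>2 d K0 W0 n) = ?H ^ n"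
    by (subst product_nn_integral_prod) (auto simp: H fm)
  also have "ennreal (exp (n * ?D)) * ?H ^ n \<le> 1"
  proof -
    have H1: "?H \<le> 1" by (rule hellinger_ppca_le_1[OF s2 \<alpha>])
    then obtain h where h: "?H = ennreal h" "h \<ge> 0" by (cases ?H) (auto simp: top_unique)
    have D: "?D = - ln h" using h by (simp add: neg_ln_hellinger_def)
    show ?thesis
    \<comment> \<open>Here the convention \<open>ln 0 = 0\<close> makes the exponential factor 1,
      and \<open>0 ^ n\<close> is at most 1; this is why only an inequality is claimed.\<close>
    proof (cases "h = 0")
      case True
      then show ?thesis using h D by (cases n) auto
    next
      case False
      then have "h > 0" using h by simp
      then have "exp (n * ?D) * h ^ n = 1"
        unfolding D by (simp add: exp_minus exp_of_nat_mult)
      then show ?thesis using h by (simp add: ennreal_power ennreal_mult[symmetric])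
    qed
  qed
  finally show ?thesis .
qed

lemma nn_integral_exp_dev_le_1:
  assumes s2: "\<sigma>2 > 0" and \<alpha>: "0 < \<alpha>" "\<alpha> < 1" and s: "s > 0"
  shows "(\<lambda>X. \<integral>\<^sup>+W. ennreal (exp (exp_dev \<sigma>2 \<alpha> d K0 W0 n K X W)) \<partial>prior_K s d K)
      \<in> borel_measurable (sample \<sigma>2 d K0 W0 n)" (is ?m)
    and "(\<integral>\<^sup>+X. (\<integral>\<^sup>+W. ennreal (exp (exp_dev \<sigma>2 \<alpha> d K0 W0 n K X W)) \<partial>prior_K s d K) \<partial>sample \<sigma>2 d K0 W0 n) \<le> 1" (is ?i)
proof -
  interpret P: prob_space "prior_K s d K" by (rule prob_space_prior_K[OF s])
  interpret S: prob_space "sample \<sigma>2 d K0 W0 n" by (intro prob_space_PiM prob_space_P_W[OF s2])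
  interpret SP: pair_sigma_finite "sample \<sigma>2 d K0 W0 n" "prior_K s d K" by standard
  have m: "(\<lambda>(X, W). ennreal (exp (exp_dev \<sigma>2 \<alpha> d K0 W0 n K X W)))
    \<in> borel_measurable (sample \<sigma>2 d K0 W0 n \<Otimes>\<^sub>M prior_K s d K)"
    using measurable_compose[OF measurable_exp_dev[OF s2, of \<alpha> d K0 W0 n K s], of "\<lambda>x. ennreal (exp x)" borel]
    by (simp add: case_prod_beta)
  show ?m by (rule sigma_finite_measure.borel_measurable_nn_integral[OF P.sigma_finite_measure_axioms m])
  have "(\<integral>\<^sup>+X. (\<integral>\<^sup>+W. ennreal (exp (exp_dev \<sigma>2 \<alpha> d K0 W0 n K X W)) \<partial>prior_K s d K) \<partial>sample \<sigma>2 d K0 W0 n)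
     = (\<integral>\<^sup>+W. (\<integral>\<^sup>+X. ennreal (exp (exp_dev \<sigma>2 \<alpha> d K0 W0 n K X W)) \<partial>sample \<sigma>2 d K0 W0 n) \<partial>prior_K s d K)"
    by (rule SP.Fubini'[OF m, symmetric])
  also have "\<dots> \<le> (\<integral>\<^sup>+W. 1 \<partial>prior_K s d K)"
    by (intro nn_integral_mono nn_integral_exp_dev_sample s2 \<alpha>)
  finally show ?i by (simp add: P.emeasure_space_1)
qed

subsection \<open>The risk bound\<close>

text \<open>The choice operator yields a maximiser only because one exists; with this the ELBO
  dominates the objective on the whole family.\<close>

lemma var_post_maximises:
  assumes "\<sigma>2 > 0" "s > 0" "\<alpha> > 0"
  shows "var_post \<sigma>2 s \<alpha> d K n X \<in> var_family d K"
    and "\<rho> \<in> var_family d K \<Longrightarrow> elbo_obj \<sigma>2 s \<alpha> d K n X \<rho> \<le> ELBO \<sigma>2 s \<alpha> d K n X"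
proof -
  have "\<exists>\<rho>. \<rho> \<in> var_family d K \<and>
    (\<forall>\<rho>'\<in>var_family d K. elbo_obj \<sigma>2 s \<alpha> d K n X \<rho>' \<le> elbo_obj \<sigma>2 s \<alpha> d K n X \<rho>)"
    using elbo_maximiser_exists[OF assms] by blast
  from someI_ex[OF this]
  show "var_post \<sigma>2 s \<alpha> d K n X \<in> var_family d K"
    and "\<rho> \<in> var_family d K \<Longrightarrow> elbo_obj \<sigma>2 s \<alpha> d K n X \<rho> \<le> ELBO \<sigma>2 s \<alpha> d K n X"
    unfolding ELBO_def var_post_def[symmetric] by blast+
qed

text \<open>A maximum over a finite set; the prior weights are equal, so the penalties
  cancel.\<close>

lemma K_hat_maximises:
  assumes "d \<ge> 1"
  shows "K_hat \<sigma>2 s \<alpha> d n X \<in> {1..d}"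
    and "K \<in> {1..d} \<Longrightarrow> ELBO \<sigma>2 s \<alpha> d K n X \<le> ELBO \<sigma>2 s \<alpha> d (K_hat \<sigma>2 s \<alpha> d n X) n X"
proof -
  let ?f = "\<lambda>K. ELBO \<sigma>2 s \<alpha> d K n X"
  have ne: "finite (?f ` {1..d})" "?f ` {1..d} \<noteq> {}" using assms by auto
  obtain K0 where "K0 \<in> {1..d}" "?f K0 = Max (?f ` {1..d})"
    using Max_in[OF ne] by (metis (no_types, lifting) imageE)
  then have "\<exists>K. K \<in> {1..d} \<and> (\<forall>K' \<in> {1..d}. ?f K' - ln (1 / (1 / real d)) \<le> ?f K - ln (1 / (1 / real d)))"
    using Max_ge[OF ne(1)] by (intro exI[of _ K0]) auto
  from someI_ex[OF this]
  show "K_hat \<sigma>2 s \<alpha> d n X \<in> {1..d}"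
    and "K \<in> {1..d} \<Longrightarrow> ?f K \<le> ?f (K_hat \<sigma>2 s \<alpha> d n X)"
    unfolding K_hat_def[symmetric] by auto
qed

text \<open>The variational inequality \<open>\<integral>g d\<rho> - KL(\<rho>, \<Pi>) \<le> ln \<integral>exp g d\<Pi>\<close>, in the linearised form
  \<open>g \<le> exp g / d - 1 + ln d\<close>, which needs neither a logarithm of the random normalising constant nor
  integrability of the divergence.\<close>
lemma pac_bayes:
  assumes s2: "\<sigma>2 > 0" and s: "s > 0" and \<alpha>: "0 < \<alpha>" "\<alpha> < 1" and d: "d \<ge> 1"
    and A: "lower_tris d K A"
    and V: "\<alpha> * loglik \<sigma>2 d K0 n X W0 - elbo_obj \<sigma>2 s \<alpha> d K n X (vgauss d K mu A) + ln d - 1 \<le> V" "0 \<le> V"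
  shows "(\<integral>\<^sup>+W. ennreal (n * neg_ln_hellinger \<sigma>2 \<alpha> d K0 W0 K W) \<partial>vgauss d K mu A)
    \<le> ennreal V + (\<integral>\<^sup>+W. ennreal (exp (exp_dev \<sigma>2 \<alpha> d K0 W0 n K X W)) \<partial>prior_K s d K) / ennreal d"
proof -
  let ?\<rho> = "vgauss d K mu A" and ?lr = "log_ratio s d K mu A" and ?I = "\<lambda>i k :: nat. if i = k then s else 0"
  let ?g = "\<lambda>W. \<Prod>j<K. gauss_pdf d (mu j) (gram d (A j)) (W j)"
  let ?f = "\<lambda>W. \<Prod>j<K. gauss_pdf d (\<lambda>_. 0) (gram d ?I) (W j)"
  let ?e = "exp_dev \<sigma>2 \<alpha> d K0 W0 n K X"
  \<comment> \<open>\<open>?v\<close> is signed and integrable, and its mean is governed by the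
    objective; \<open>?w\<close> is nonnegative and becomes the exponential moment under the prior.
    The log-density ratio is added in the one and subtracted in the exponent of the other.\<close>
  let ?v = "\<lambda>W. \<alpha> * (loglik \<sigma>2 d K0 n X W0 - loglik \<sigma>2 d K n X W) + ?lr W + (ln d - 1)"
  let ?w = "\<lambda>W. exp (?e W - ?lr W) / d"
  interpret prob_space ?\<rho> by (rule prob_space_vgauss[OF A])
  have I: "lower_tris d K (\<lambda>_. ?I)" using s by (simp add: lower_tris_def lower_tri_id)
  have g0: "?g W > 0" for W
    using A by (intro prod_pos gauss_pdf_pos pos_def_gram) (auto simp: lower_tris_def)
  have f0: "?f W > 0" for W
    using s by (intro prod_pos ballI gauss_pdf_pos pos_def_gram lower_tri_id)
  have em: "?e \<in> borel_measurable (mat_space d K)"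
    unfolding exp_dev_def
    by (intro borel_measurable_add borel_measurable_times borel_measurable_diff borel_measurable_const
        measurable_loglik measurable_neg_ln_hellinger s2)
  have wm: "?w \<in> borel_measurable (mat_space d K)"
    using em by (intro borel_measurable_divide borel_measurable_exp borel_measurable_diff measurable_log_ratio) auto
  have li: "integrable ?\<rho> (loglik \<sigma>2 d K n X)" by (rule integrable_loglik[OF s2 A])
  have lr: "integrable ?\<rho> ?lr" "integral\<^sup>L ?\<rho> ?lr = kl_gauss s d K mu A"
    using log_ratio_integral[OF A s, of mu] by (auto simp: has_bochner_integral_iff)
  have vi: "integrable ?\<rho> ?v" using li lr by auto
  have "integral\<^sup>L ?\<rho> ?v = \<alpha> * (loglik \<sigma>2 d K0 n X W0 - (\<integral>W. loglik \<sigma>2 d K n X W \<partial>?\<rho>)) + kl_gauss s d K mu A + (ln d - 1)"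
    using li lr by (simp add: prob_space)
  also have "\<dots> \<le> V"
    using V(1) unfolding elbo_obj_def KL_vgauss[OF A s] by (simp add: algebra_simps)
  finally have vV: "integral\<^sup>L ?\<rho> ?v \<le> V" .
  have le: "n * neg_ln_hellinger \<sigma>2 \<alpha> d K0 W0 K W \<le> ?v W + ?w W" for W
  proof -
    \<comment> \<open>The shift of the tangent by \<open>ln d\<close> puts the factor
      \<open>1 / d\<close> on the exponential moment, which later compensates the sum over the
      \<open>d\<close> models.\<close>
    have "1 + (?e W - ?lr W - ln d) \<le> exp (?e W - ?lr W - ln d)" by (rule exp_ge_add_one_self)
    also have "\<dots> = ?w W" using d by (simp add: exp_diff)
    finally show ?thesis unfolding exp_dev_def by (simp add: algebra_simps)
  qed
  have "(\<integral>\<^sup>+W. ennreal (n * neg_ln_hellinger \<sigma>2 \<alpha> d K0 W0 K W) \<partial>?\<rho>) \<le> ennreal V + (\<integral>\<^sup>+W. ennreal (?w W) \<partial>?\<rho>)"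
  proof (rule nn_integral_le_integral_add[OF vi _ _ _ le vV V(2)])
    show "?w \<in> borel_measurable ?\<rho>" using wm by (simp cong: measurable_cong_sets)
    show "0 \<le> real n * neg_ln_hellinger \<sigma>2 \<alpha> d K0 W0 K W" for W
      using neg_ln_hellinger_nonneg[OF s2 \<alpha>] by simp
  qed simp
  also have "(\<integral>\<^sup>+W. ennreal (?w W) \<partial>?\<rho>) = (\<integral>\<^sup>+W. ennreal (?g W) * ennreal (?w W) \<partial>mat_space d K)"
    unfolding vgauss_density[OF A] using wm measurable_prod_gauss_pdf[of d mu "\<lambda>j. gram d (A j)" K]
    by (intro nn_integral_density) auto
  \<comment> \<open>Change of measure: \<open>exp (- ?lr W)\<close> is \<open>?f W / ?g W\<close>,
    which trades the variational density for that of the prior.\<close>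
  also have "\<dots> = (\<integral>\<^sup>+W. ennreal (?f W) * (ennreal (exp (?e W)) / ennreal d) \<partial>mat_space d K)"
  proof (rule nn_integral_cong)
    fix W
    have "exp (?lr W) = ?g W / ?f W" unfolding log_ratio_def using f0[of W] g0[of W] by (intro exp_ln divide_pos_pos)
    then have "exp (?e W - ?lr W) = exp (?e W) * ?f W / ?g W" by (simp only: exp_diff) simp
    then have "?g W * ?w W = ?f W * (exp (?e W) / d)"
      using less_imp_neq[OF g0[of W]] by (simp del: prod_zero_iff)
    moreover have "ennreal (exp (?e W)) / ennreal d = ennreal (exp (?e W) / d)"
      using d by (intro divide_ennreal) auto
    ultimately show "ennreal (?g W) * ennreal (?w W) = ennreal (?f W) * (ennreal (exp (?e W)) / ennreal d)"
      using less_imp_le[OF f0[of W]] less_imp_le[OF g0[of W]] by (simp only: ennreal_mult[symmetric] exp_ge_zero divide_nonneg_nonneg of_nat_0_le_iff)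
  qed
  also have "\<dots> = (\<integral>\<^sup>+W. ennreal (exp (?e W)) / ennreal d \<partial>prior_K s d K)"
    unfolding prior_K_eq_vgauss vgauss_density[OF I] using em measurable_prod_gauss_pdf[of d "\<lambda>_ _. 0" "\<lambda>j. gram d ?I" K]
    by (intro nn_integral_density[symmetric]) auto
  also have "\<dots> = (\<integral>\<^sup>+W. ennreal (exp (?e W)) \<partial>prior_K s d K) / ennreal d"
    using em by (intro nn_integral_divide) (simp add: measurable_cong_sets[OF sets_prior_K refl])
  finally show ?thesis .
qed

text \<open>The loss at a Gaussian centred at \<open>W0\<close>: the expected log-likelihood ratio
  is bounded observation by observation through the mean of \<open>pert\<close>, where each of the
  \<open>K * d\<close> entries contributes \<open>\<epsilon>\<^sup>2\<close>; the second summand is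
  the divergence from the prior.\<close>

lemma elbo_reference:
  assumes s2: "\<sigma>2 > 0" and s: "s > 0" and \<alpha>: "0 < \<alpha>" and \<eta>: "\<eta> > 0" and \<epsilon>: "\<epsilon> > 0"
  shows "\<alpha> * loglik \<sigma>2 d K n X W0
      - elbo_obj \<sigma>2 s \<alpha> d K n X (vgauss d K W0 (\<lambda>_ i k. if i = k then \<epsilon> else 0))
    \<le> \<alpha> * ((\<eta> + (1 + 1 / \<eta>) * (real K * real d * \<epsilon>\<^sup>2) / \<sigma>2) / 2 * (\<Sum>m<n. (\<Sum>i<d. (X m i)\<^sup>2) / \<sigma>2 + d))
      + (\<Sum>j<K. \<Sum>i<d. ((W0 j i)\<^sup>2 + \<epsilon>\<^sup>2) / (2 * s\<^sup>2) - 1 / 2 - ln \<epsilon> + ln s)"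
proof -
  let ?A = "\<lambda>_ i k :: nat. if i = k then \<epsilon> else 0"
  interpret prob_space "std_mat d K" by (rule prob_space_std_mat)
  have A: "lower_tris d K ?A" using \<epsilon> by (simp add: lower_tris_def lower_tri_id)
  define x where "x = (\<Sum>m<n. (\<Sum>i<d. (X m i)\<^sup>2) / \<sigma>2 + d)"
  let ?p = "\<lambda>Z. pert \<sigma>2 d K \<eta> (mat_map d K W0 ?A Z) W0"
  have pert: "?p Z = \<eta> + (1 + 1 / \<eta>) * (\<Sum>j<K. \<Sum>i<d. \<epsilon>\<^sup>2 * (Z j i)\<^sup>2) / \<sigma>2" for Z
  proof -
    have "(mat_map d K W0 ?A Z j i - W0 j i)\<^sup>2 = \<epsilon>\<^sup>2 * (Z j i)\<^sup>2" if "j < K" "i < d" for j i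
    proof -
      have "(\<Sum>k<d. (if i = k then \<epsilon> else 0) * Z j k) = (\<Sum>k<d. if k = i then \<epsilon> * Z j i else 0)"
        by (intro sum.cong) auto
      then show ?thesis using that by (simp add: mat_map_apply power_mult_distrib)
    qed
    then show ?thesis unfolding pert_def by simp
  qed
  have pint: "has_bochner_integral (std_mat d K) ?p (\<eta> + (1 + 1 / \<eta>) * (\<Sum>j<K. \<Sum>i<d. \<epsilon>\<^sup>2 * 1) / \<sigma>2)"
    unfolding pert
    by (intro has_bochner_integral_add has_bochner_integral_divide_zero has_bochner_integral_mult_right
        has_bochner_integral_sum std_mat_square) (auto simp: has_bochner_integral_iff prob_space)
  have li: "integrable (std_mat d K) (\<lambda>Z. loglik \<sigma>2 d K n X (mat_map d K W0 ?A Z))"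
    using integrable_loglik[OF s2 A] integrable_vgauss_iff[OF A measurable_loglik[OF s2]] by blast
  have "loglik \<sigma>2 d K n X W0 - (\<integral>Z. loglik \<sigma>2 d K n X (mat_map d K W0 ?A Z) \<partial>std_mat d K)
     = (\<integral>Z. loglik \<sigma>2 d K n X W0 - loglik \<sigma>2 d K n X (mat_map d K W0 ?A Z) \<partial>std_mat d K)"
    using li by (simp add: prob_space)
  also have "\<dots> \<le> (\<integral>Z. ?p Z / 2 * x \<partial>std_mat d K)"
  proof (rule integral_mono)
    show "integrable (std_mat d K) (\<lambda>Z. ?p Z / 2 * x)"
      using pint by (auto simp: has_bochner_integral_iff)
    show "loglik \<sigma>2 d K n X W0 - loglik \<sigma>2 d K n X (mat_map d K W0 ?A Z) \<le> ?p Z / 2 * x" for Z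
      unfolding loglik_def x_def sum_subtractf[symmetric] sum_distrib_left
      by (intro sum_mono ln_ppca_pdf_diff_le s2 \<eta>)
  qed (use li in auto)
  also have "\<dots> = (\<eta> + (1 + 1 / \<eta>) * (real K * real d * \<epsilon>\<^sup>2) / \<sigma>2) / 2 * x"
    using pint by (simp add: has_bochner_integral_iff mult.assoc)
  finally have "\<alpha> * (loglik \<sigma>2 d K n X W0 - (\<integral>Z. loglik \<sigma>2 d K n X (mat_map d K W0 ?A Z) \<partial>std_mat d K))
    \<le> \<alpha> * ((\<eta> + (1 + 1 / \<eta>) * (real K * real d * \<epsilon>\<^sup>2) / \<sigma>2) / 2 * x)"
    using \<alpha> by (intro mult_left_mono) auto
  moreover have "kl_gauss s d K W0 ?A = (\<Sum>j<K. \<Sum>i<d. ((W0 j i)\<^sup>2 + \<epsilon>\<^sup>2) / (2 * s\<^sup>2) - 1 / 2 - ln \<epsilon> + ln s)"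
  proof -
    have "(\<Sum>k<d. (if i = k then \<epsilon> else 0)\<^sup>2) = \<epsilon>\<^sup>2" if "i < d" for i
    proof -
      have "(\<Sum>k<d. (if i = k then \<epsilon> else 0)\<^sup>2) = (\<Sum>k<d. if k = i then \<epsilon>\<^sup>2 else 0)"
        by (intro sum.cong) auto
      then show ?thesis using that by simp
    qed
    then show ?thesis unfolding kl_gauss_def by (intro sum.cong) auto
  qed
  ultimately show ?thesis
    unfolding elbo_obj_vgauss[OF s2 s A] x_def[symmetric] right_diff_distrib by linarith
qed

text \<open>Row \<open>i\<close> of a Cholesky factor has as squared norm the diagonal entry of the
  covariance, and this is the variance of coordinate \<open>i\<close> of the affine image.\<close>

lemma P_W_second_moment:
  assumes "\<sigma>2 > 0" "i < d"
  shows "has_bochner_integral (P_W \<sigma>2 d K W) (\<lambda>x. (x i)\<^sup>2) ((\<Sum>j<K. (W j i)\<^sup>2) + \<sigma>2)"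
proof -
  obtain A where A: "lower_tri d A" "\<And>i j. i < d \<Longrightarrow> j < d \<Longrightarrow> ppca_cov \<sigma>2 d K W i j = gram d A i j"
    using cholesky[OF pos_def_ppca_cov[OF assms(1), of d K W]] by blast
  have "P_W \<sigma>2 d K W = distr (std_gauss d) (lborel_d d) (aff_map d (\<lambda>_. 0) A)"
    unfolding P_W_def gauss_measure_eq_distr[OF A(1), symmetric] by (rule gauss_measure_cong[OF A(2)])
  moreover have "has_bochner_integral (std_gauss d) (\<lambda>z. (aff_map d (\<lambda>_. 0) A z i)\<^sup>2) (\<Sum>k<d. (A i k)\<^sup>2)"
    using std_gauss_affine_square[of d 0 "A i"] by (simp add: aff_map_apply assms)
  moreover have "(\<Sum>k<d. (A i k)\<^sup>2) = (\<Sum>j<K. (W j i)\<^sup>2) + \<sigma>2"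
    using A(2)[OF assms(2) assms(2)] by (simp add: gram_def ppca_cov_def power2_eq_square)
  moreover have "aff_map d (\<lambda>_. 0) A \<in> measurable (std_gauss d) (lborel_d d)"
    using measurable_aff_map by (simp cong: measurable_cong_sets)
  ultimately show ?thesis
    using assms(2) by (simp add: has_bochner_integral_distr)
qed

text \<open>\<eta> and \<epsilon> stay free, so that the tuning is separate from the probability.
  \<open>c\<close> weights the second moments, \<open>B\<close> bounds the divergence at the
  reference, and the final 1 is the averaged exponential moment.\<close>

lemma risk_le:
  fixes \<eta> \<epsilon> c B :: real
  assumes s2: "\<sigma>2 > 0" and s: "s > 0" and \<alpha>: "0 < \<alpha>" "\<alpha> < 1"
    and K0: "1 \<le> K0" "K0 \<le> d" and n: "1 \<le> n" and \<eta>: "\<eta> > 0" and \<epsilon>: "\<epsilon> > 0"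
    and c: "c = \<alpha> * (\<eta> + (1 + 1 / \<eta>) * (real K0 * real d * \<epsilon>\<^sup>2) / \<sigma>2) / 2"
    and B: "(\<Sum>j<K0. \<Sum>i<d. ((W0 j i)\<^sup>2 + \<epsilon>\<^sup>2) / (2 * s\<^sup>2) - 1 / 2 - ln \<epsilon> + ln s) \<le> B" "0 \<le> B"
  shows "risk \<sigma>2 s \<alpha> d K0 W0 n \<le> ennreal (1 / (n * (1 - \<alpha>)) *
     (c * (n * ((\<Sum>i<d. (\<Sum>j<K0. (W0 j i)\<^sup>2) + \<sigma>2) / \<sigma>2 + d)) + B + ln d + 1))"
proof -
  let ?S = "sample \<sigma>2 d K0 W0 n" and ?D = "neg_ln_hellinger \<sigma>2 \<alpha> d K0 W0"
  define Z where "Z K X = (\<integral>\<^sup>+W. ennreal (exp (exp_dev \<sigma>2 \<alpha> d K0 W0 n K X W)) \<partial>prior_K s d K)" for K X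
  \<comment> \<open>Compared with the hypothesis of \<open>pac_bayes\<close> the term
    \<open>- 1\<close> is dropped, so that \<open>V X\<close> is nonnegative and may be read as an
    extended nonnegative real.\<close>
  define V where "V X = c * (\<Sum>m<n. (\<Sum>i<d. (X m i)\<^sup>2) / \<sigma>2 + d) + B + ln d" for X :: "nat \<Rightarrow> nat \<Rightarrow> real"
  define r where "r = 1 / (n * (1 - \<alpha>))"
  interpret S: prob_space ?S by (intro prob_space_PiM prob_space_P_W[OF s2])
  have d: "d \<ge> 1" using K0 by simp
  have c0: "c \<ge> 0" unfolding c using \<alpha> \<eta> s2 by simp
  have r0: "r \<ge> 0" unfolding r_def using \<alpha> by simp
  have V0: "0 \<le> V X" for X
    unfolding V_def using c0 B(2) s2 d
    by (intro add_nonneg_nonneg mult_nonneg_nonneg sum_nonneg divide_nonneg_nonneg) auto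
  have Zm: "Z K \<in> borel_measurable ?S" for K
    unfolding Z_def by (rule nn_integral_exp_dev_le_1(1)[OF s2 \<alpha> s])
  have ZE: "(\<integral>\<^sup>+X. Z K X \<partial>?S) \<le> 1" for K
    unfolding Z_def by (rule nn_integral_exp_dev_le_1(2)[OF s2 \<alpha> s])
  have inner: "(\<integral>\<^sup>+ W. e2ennreal (renyi_div \<alpha> (P_W \<sigma>2 d (K_hat \<sigma>2 s \<alpha> d n X) W) (P_W \<sigma>2 d K0 W0))
      \<partial>(var_post \<sigma>2 s \<alpha> d (K_hat \<sigma>2 s \<alpha> d n X) n X))
    \<le> ennreal r * (ennreal (V X) + (\<Sum>K=1..d. Z K X) / ennreal d)" for X
  proof -
    define K where "K = K_hat \<sigma>2 s \<alpha> d n X"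
    have K: "K \<in> {1..d}" unfolding K_def by (rule K_hat_maximises(1)[OF d])
    obtain mu A where A: "var_post \<sigma>2 s \<alpha> d K n X = vgauss d K mu A" "lower_tris d K A"
      using var_post_maximises(1)[OF s2 s \<alpha>(1), of d K n X] unfolding var_family_eq by blast
    let ?ref = "vgauss d K0 W0 (\<lambda>_ i k. if i = k then \<epsilon> else 0)"
    have "lower_tris d K0 (\<lambda>_ i k. if i = k then \<epsilon> else 0)"
      using \<epsilon> by (simp add: lower_tris_def lower_tri_id)
    then have "?ref \<in> var_family d K0" unfolding var_family_eq by blast
    then have "elbo_obj \<sigma>2 s \<alpha> d K0 n X ?ref \<le> ELBO \<sigma>2 s \<alpha> d K0 n X"
      by (rule var_post_maximises(2)[OF s2 s \<alpha>(1)])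
    also have "\<dots> \<le> ELBO \<sigma>2 s \<alpha> d K n X"
      unfolding K_def using K0 by (intro K_hat_maximises(2)[OF d]) auto
    also have "\<dots> = elbo_obj \<sigma>2 s \<alpha> d K n X (vgauss d K mu A)" by (simp add: ELBO_def A)
    finally have "\<alpha> * loglik \<sigma>2 d K0 n X W0 - elbo_obj \<sigma>2 s \<alpha> d K n X (vgauss d K mu A) + ln d - 1 \<le> V X"
      using elbo_reference[OF s2 s \<alpha>(1) \<eta> \<epsilon>, of d K0 n X W0] B(1) unfolding V_def c by simp
    from pac_bayes[OF s2 s \<alpha> d A(2) this V0]
    have *: "(\<integral>\<^sup>+W. ennreal (n * ?D K W) \<partial>vgauss d K mu A) \<le> ennreal (V X) + Z K X / ennreal d"
      unfolding Z_def .
    have Dm: "?D K \<in> borel_measurable (vgauss d K mu A)"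
      using measurable_neg_ln_hellinger[OF s2] by (simp cong: measurable_cong_sets)
    have "(\<integral>\<^sup>+ W. e2ennreal (renyi_div \<alpha> (P_W \<sigma>2 d K W) (P_W \<sigma>2 d K0 W0)) \<partial>vgauss d K mu A)
      = (\<integral>\<^sup>+W. ennreal r * ennreal (n * ?D K W) \<partial>vgauss d K mu A)"
    proof (rule nn_integral_cong)
      fix W
      have "1 / (1 - \<alpha>) * ?D K W = r * (n * ?D K W)" unfolding r_def using n by simp
      then show "e2ennreal (renyi_div \<alpha> (P_W \<sigma>2 d K W) (P_W \<sigma>2 d K0 W0)) = ennreal r * ennreal (n * ?D K W)"
        unfolding renyi_div_P_W[OF s2] neg_ln_hellinger_def[symmetric]
        using r0 neg_ln_hellinger_nonneg[OF s2 \<alpha>] by (simp add: e2ennreal_ereal ennreal_mult[symmetric])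
    qed
    also have "\<dots> = ennreal r * (\<integral>\<^sup>+W. ennreal (n * ?D K W) \<partial>vgauss d K mu A)"
      using Dm by (intro nn_integral_cmult) auto
    also have "\<dots> \<le> ennreal r * (ennreal (V X) + Z K X / ennreal d)"
      by (intro mult_left_mono *) auto
    \<comment> \<open>The index \<open>K\<close> depends on \<open>X\<close>. Since all summands are
      nonnegative, the full sum is a majorant whose measurability does not involve
      \<open>K_hat\<close>.\<close>
    also have "Z K X \<le> (\<Sum>K=1..d. Z K X)" using K by (intro member_le_sum) auto
    finally show ?thesis
      unfolding K_def[symmetric] A(1) by (simp add: divide_right_mono_ennreal add_left_mono mult_left_mono)
  qed
  have mom: "has_bochner_integral ?S (\<lambda>X. (X m i)\<^sup>2) ((\<Sum>j<K0. (W0 j i)\<^sup>2) + \<sigma>2)" if "m < n" "i < d" for m i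
    using that has_bochner_integral_PiM_component[of "{..<n}" "\<lambda>_. P_W \<sigma>2 d K0 W0" m,
      OF prob_space_P_W[OF s2] _ P_W_second_moment[OF s2]] by simp
  have const: "has_bochner_integral ?S (\<lambda>_. t) t" for t :: real
    by (simp add: has_bochner_integral_iff S.prob_space)
  have VE: "has_bochner_integral ?S V
      (c * (\<Sum>m<n. (\<Sum>i<d. (\<Sum>j<K0. (W0 j i)\<^sup>2) + \<sigma>2) / \<sigma>2 + d) + B + ln d)"
    unfolding V_def[abs_def]
    by (intro has_bochner_integral_add has_bochner_integral_mult_right has_bochner_integral_sum
        has_bochner_integral_divide_zero mom const) auto
  have Vm: "(\<lambda>X. ennreal (V X)) \<in> borel_measurable ?S"
    using borel_measurable_has_bochner_integral[OF VE] by simp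
  have Zs: "(\<lambda>X. \<Sum>K=1..d. Z K X) \<in> borel_measurable ?S"
    by (intro borel_measurable_sum Zm)
  have "risk \<sigma>2 s \<alpha> d K0 W0 n \<le> (\<integral>\<^sup>+X. ennreal r * (ennreal (V X) + (\<Sum>K=1..d. Z K X) / ennreal d) \<partial>?S)"
    unfolding risk_def by (intro nn_integral_mono inner)
  also have "\<dots> = ennreal r * (\<integral>\<^sup>+X. ennreal (V X) + (\<Sum>K=1..d. Z K X) / ennreal d \<partial>?S)"
    using Vm Zs by (intro nn_integral_cmult) auto
  also have "\<dots> = ennreal r * ((\<integral>\<^sup>+X. ennreal (V X) \<partial>?S) + (\<integral>\<^sup>+X. (\<Sum>K=1..d. Z K X) / ennreal d \<partial>?S))"
    using Vm Zs by (subst nn_integral_add) auto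
  also have "(\<integral>\<^sup>+X. (\<Sum>K=1..d. Z K X) / ennreal d \<partial>?S) = (\<Sum>K=1..d. \<integral>\<^sup>+X. Z K X \<partial>?S) / ennreal d"
    using Zs Zm by (subst nn_integral_divide) (auto simp: nn_integral_sum)
  \<comment> \<open>The union over models is paid for here: \<open>d\<close> moments of mean at most
    one against the factor \<open>1 / d\<close>.\<close>
  also have "\<dots> \<le> (\<Sum>K=1..d. 1) / ennreal d"
    by (intro divide_right_mono_ennreal sum_mono ZE)
  also have "(\<Sum>K=1..d. 1 :: ennreal) / ennreal d = 1" using d by (simp add: ennreal_of_nat_eq_real_of_nat divide_ennreal)
  also have "(\<integral>\<^sup>+X. ennreal (V X) \<partial>?S) = ennreal (integral\<^sup>L ?S V)"
    using VE V0 by (intro nn_integral_eq_integral) (auto simp: has_bochner_integral_iff)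
  also have "ennreal r * (ennreal (integral\<^sup>L ?S V) + 1) = ennreal (r * (integral\<^sup>L ?S V + 1))"
    using r0 V0 by (simp add: ennreal_mult integral_nonneg ennreal_plus)
  also have "integral\<^sup>L ?S V = c * (n * ((\<Sum>i<d. (\<Sum>j<K0. (W0 j i)\<^sup>2) + \<sigma>2) / \<sigma>2 + d)) + B + ln d"
    using VE by (simp add: has_bochner_integral_iff)
  finally show ?thesis unfolding r_def by (simp add: mult_left_mono)
qed

theorem theorem5:
  fixes \<sigma>2 s \<alpha> C :: real
  assumes "\<sigma>2 > 0" and "s > 0" and "0 < \<alpha>" and "\<alpha> < 1"
  shows "\<exists>M::real. \<forall>d K0 (W0 :: nat \<Rightarrow> nat \<Rightarrow> real) n.
           1 \<le> K0 \<longrightarrow> K0 \<le> d \<longrightarrow> (\<forall>i<d. \<forall>j<K0. \<bar>W0 j i\<bar> \<le> C) \<longrightarrow> 2 \<le> n \<longrightarrow>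
           risk \<sigma>2 s \<alpha> d K0 W0 n
             \<le> ennreal (M * (real d * real K0 * ln (real d * real n) / real n))"
proof -
  \<comment> \<open>\<open>a\<close> is the product of the two bounds shown later:
    \<open>(1 + 2 / \<sigma>2) / 2\<close> for \<open>c * n\<close> and
    \<open>2 + C\<^sup>2 / \<sigma>2\<close> for the second moment per unit of
    \<open>N\<close>.\<close>
  define a where "a = (1 + 2 / \<sigma>2) * (2 + C\<^sup>2 / \<sigma>2) / 2"
  define b where "b = (C\<^sup>2 + 1) / (2 * s\<^sup>2) + \<bar>ln s\<bar>"
  have a0: "a \<ge> 0" unfolding a_def using assms by (intro divide_nonneg_nonneg mult_nonneg_nonneg add_nonneg_nonneg) auto
  have b0: "b \<ge> 0" unfolding b_def by simp
  show ?thesis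
  \<comment> \<open>In units of \<open>N * L\<close>: \<open>2 * a\<close> from the likelihood,
    \<open>2 * b + 1\<close> from the divergence, 1 from \<open>ln d\<close> and 2 from the
    exponential moment.\<close>
  proof (intro exI[of _ "(2 * a + 2 * b + 4) / (1 - \<alpha>)"] allI impI)
    fix d K0 n :: nat and W0 :: "nat \<Rightarrow> nat \<Rightarrow> real"
    assume K0: "1 \<le> K0" "K0 \<le> d" and W0: "\<forall>i<d. \<forall>j<K0. \<bar>W0 j i\<bar> \<le> C" and n: "2 \<le> n"
    define N where "N = real d * real K0"
    define L where "L = ln (real d * real n)"
    define \<epsilon> where "\<epsilon> = 1 / (real n * sqrt N)"
    define c where "c = \<alpha> * (1 / real n + (1 + 1 / (1 / real n)) * (real K0 * real d * \<epsilon>\<^sup>2) / \<sigma>2) / 2"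
    define B where "B = N * (b + L)"
    have d: "1 \<le> real d" "1 \<le> real K0" "real K0 \<le> real d" "2 \<le> real n" using K0 n by auto
    have N: "1 \<le> N" "real d \<le> N" "N \<le> (real d)\<^sup>2"
      unfolding N_def power2_eq_square using d mult_mono[of 1 "real d" 1 "real K0"] by (auto intro: mult_left_mono)
    have "2 \<le> real d * real n" using d mult_mono[of 1 "real d" 2 "real n"] by simp
    then have "ln 2 \<le> L" unfolding L_def by (intro ln_mono) auto
    \<comment> \<open>Constants are turned into multiples of the logarithm; this uses
      \<open>n \<ge> 2\<close>, since for \<open>d = n = 1\<close> the logarithm would be 0.\<close>
    then have L: "1 \<le> 2 * L" using ln2_ge_two_thirds by simp
    have e0: "\<epsilon> > 0" unfolding \<epsilon>_def using d N by (intro divide_pos_pos mult_pos_pos) auto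
    have e2: "\<epsilon>\<^sup>2 = 1 / ((real n)\<^sup>2 * N)" unfolding \<epsilon>_def using N by (simp add: power_divide power_mult_distrib)
    have "1 \<le> (real n)\<^sup>2 * N" using d N mult_mono[of 1 "(real n)\<^sup>2" 1 N] by (simp add: one_le_power)
    then have e1: "\<epsilon>\<^sup>2 \<le> 1" unfolding e2 by simp
    \<comment> \<open>From \<open>K0 \<le> d\<close> follows \<open>sqrt N \<le> d\<close>, so
      \<open>1 / \<epsilon> = n * sqrt N\<close> is at most \<open>d * n\<close>.\<close>
    have lne: "- ln \<epsilon> \<le> L"
    proof -
      have "sqrt N \<le> real d" using N real_sqrt_le_mono[of N "(real d)\<^sup>2"] by simp
      then have "ln (real n * sqrt N) \<le> L"
        unfolding L_def using d N by (intro ln_mono) (auto simp: mult.commute[of "real d"] intro!: mult_left_mono)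
      then show ?thesis unfolding \<epsilon>_def using d N by (simp add: ln_div)
    qed
    have WC: "(W0 j i)\<^sup>2 \<le> C\<^sup>2" if "j < K0" "i < d" for j i
      using W0 that abs_le_square_iff[of "W0 j i" C] by force
    have "(\<Sum>j<K0. \<Sum>i<d. ((W0 j i)\<^sup>2 + \<epsilon>\<^sup>2) / (2 * s\<^sup>2) - 1 / 2 - ln \<epsilon> + ln s) \<le> (\<Sum>j<K0. \<Sum>i<d. b + L)"
    proof (intro sum_mono)
      fix j i assume "j \<in> {..<K0}" "i \<in> {..<d}"
      then have "((W0 j i)\<^sup>2 + \<epsilon>\<^sup>2) / (2 * s\<^sup>2) \<le> (C\<^sup>2 + 1) / (2 * s\<^sup>2)"
        using WC e1 by (intro divide_right_mono add_mono) auto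
      then show "((W0 j i)\<^sup>2 + \<epsilon>\<^sup>2) / (2 * s\<^sup>2) - 1 / 2 - ln \<epsilon> + ln s \<le> b + L"
        unfolding b_def using lne abs_ge_self[of "ln s"] by linarith
    qed
    also have "\<dots> = B" by (simp add: B_def N_def mult_ac)
    finally have B: "(\<Sum>j<K0. \<Sum>i<d. ((W0 j i)\<^sup>2 + \<epsilon>\<^sup>2) / (2 * s\<^sup>2) - 1 / 2 - ln \<epsilon> + ln s) \<le> B" .
    have B0: "0 \<le> B" unfolding B_def using N L b0 by simp
    have n0: "1 \<le> n" "1 / real n > 0" using n by auto
    have cn: "c * n \<le> (1 + 2 / \<sigma>2) / 2"
    proof -
      \<comment> \<open>With \<open>\<eta> = 1 / n\<close> the factor
        \<open>1 + 1 / \<eta> = 1 + n\<close> meets \<open>1 / n\<^sup>2\<close>, so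
        \<open>c\<close> is of order \<open>1 / n\<close>.\<close>
      have "real K0 * real d * \<epsilon>\<^sup>2 = 1 / (real n)\<^sup>2" unfolding e2 N_def using K0 by simp
      then have "c * n = \<alpha> * ((1 + (1 + 1 / real n) / \<sigma>2) / 2)"
        unfolding c_def using d assms by (simp add: field_simps power2_eq_square)
      also have "\<dots> \<le> 1 * ((1 + 2 / \<sigma>2) / 2)"
        using d assms by (intro mult_mono divide_right_mono add_left_mono) auto
      finally show ?thesis by simp
    qed
    have mom: "(\<Sum>i<d. (\<Sum>j<K0. (W0 j i)\<^sup>2) + \<sigma>2) / \<sigma>2 + d \<le> N * (2 + C\<^sup>2 / \<sigma>2)"
    proof -
      have "(\<Sum>i<d. (\<Sum>j<K0. (W0 j i)\<^sup>2) + \<sigma>2) \<le> (\<Sum>i<d. (\<Sum>j<K0. C\<^sup>2) + \<sigma>2)"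
        using WC by (intro sum_mono add_right_mono) auto
      also have "\<dots> = N * C\<^sup>2 + d * \<sigma>2" by (simp add: N_def algebra_simps)
      finally have "(\<Sum>i<d. (\<Sum>j<K0. (W0 j i)\<^sup>2) + \<sigma>2) / \<sigma>2 \<le> (N * C\<^sup>2 + d * \<sigma>2) / \<sigma>2"
        using assms by (intro divide_right_mono) auto
      also have "\<dots> = N * (C\<^sup>2 / \<sigma>2) + d" using assms by (simp add: field_simps)
      finally show ?thesis using N by (simp add: algebra_simps)
    qed
    have "c * (n * ((\<Sum>i<d. (\<Sum>j<K0. (W0 j i)\<^sup>2) + \<sigma>2) / \<sigma>2 + d)) \<le> a * N"
    proof -
      have "c * n * ((\<Sum>i<d. (\<Sum>j<K0. (W0 j i)\<^sup>2) + \<sigma>2) / \<sigma>2 + d)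
        \<le> (1 + 2 / \<sigma>2) / 2 * (N * (2 + C\<^sup>2 / \<sigma>2))"
        using assms cn mom by (intro mult_mono add_nonneg_nonneg divide_nonneg_nonneg sum_nonneg) auto
      then show ?thesis by (simp add: a_def mult_ac)
    qed
    moreover have "a * N \<le> a * N * (2 * L)"
      using mult_left_mono[OF L, of "a * N"] a0 N by simp
    moreover have "B \<le> 2 * b * (N * L) + N * L"
      using mult_left_mono[OF L, of "b * N"] b0 N by (simp add: B_def algebra_simps)
    moreover have "ln d \<le> N * L"
    proof -
      have "ln d \<le> L" unfolding L_def using d by (intro ln_mono) auto
      also have "\<dots> \<le> N * L" using N L mult_right_mono[of 1 N L] by simp
      finally show ?thesis .
    qed
    moreover have "1 \<le> 2 * (N * L)" using N L mult_mono[of 1 N 1 "2 * L"] by simp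
    ultimately have tot: "c * (n * ((\<Sum>i<d. (\<Sum>j<K0. (W0 j i)\<^sup>2) + \<sigma>2) / \<sigma>2 + d)) + B + ln d + 1
      \<le> (2 * a + 2 * b + 4) * (N * L)"
      by (simp add: algebra_simps)
    have "risk \<sigma>2 s \<alpha> d K0 W0 n \<le> ennreal (1 / (n * (1 - \<alpha>)) *
      (c * (n * ((\<Sum>i<d. (\<Sum>j<K0. (W0 j i)\<^sup>2) + \<sigma>2) / \<sigma>2 + d)) + B + ln d + 1))"
      by (rule risk_le[OF assms K0 n0(1,2) e0 c_def B B0])
    also have "\<dots> \<le> ennreal (1 / (n * (1 - \<alpha>)) * ((2 * a + 2 * b + 4) * (N * L)))"
      using assms by (intro ennreal_leI mult_left_mono tot) auto
    also have "1 / (n * (1 - \<alpha>)) * ((2 * a + 2 * b + 4) * (N * L))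
      = (2 * a + 2 * b + 4) / (1 - \<alpha>) * (real d * real K0 * ln (real d * real n) / real n)"
      by (simp add: N_def L_def mult_ac)
    finally show "risk \<sigma>2 s \<alpha> d K0 W0 n \<le> ennreal ((2 * a + 2 * b + 4) / (1 - \<alpha>) *
      (real d * real K0 * ln (real d * real n) / real n))" .
  qed
qed

end
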